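(* Let $(V,\sigma)$ be a braided vector space over $K$, let $T_\sigma(V)$ be the quantum shuffle algebra, i.e. the space $T(V)=\bigoplus_{n\ge 0}V^{\otimes n}$ with the quantum shuffle product, and let $\beta$ be the braiding on $T(V)$ induced by $\sigma$. Then $(T_\sigma(V),\beta)$ is a braided algebra. Moreover, the subalgebra $S_\sigma(V)$ of $T_\sigma(V)$ generated by $V$ is also a braided algebra with the braiding $\beta$ (restricted to $S_\sigma(V)\otimes S_\sigma(V)$).
   Context: $K$ is a field of characteristic $0$. A braiding on a vector space $V$ is an invertible linear map $\sigma\in\mathrm{End}(V\otimes V)$ with $\sigma_1\sigma_2\sigma_1=\sigma_2\sigma_1\sigma_2$ on $V^{\otimes 3}$; $(V,\sigma)$ is then a braided vector space. On $V^{\otimes n}$ put $\sigma_i=\mathrm{id}_V^{\otimes i-1}\otimes\sigma\otimes\mathrm{id}_V^{\otimes n-i-1}$. For $w\in\mathfrak{S}_n$ with reduced expression $w=s_{i_1}\cdots s_{i_l}$, $s_i=(i,i+1)$, put $T_w^\sigma=\sigma_{i_1}\cdots\sigma_{i_l}$ (independent of the reduced expression). Braiding $\beta$: for $i,j\ge1$ let $\chi_{ij}\in\mathfrak{S}_{i+j}$ be given by $\chi_{ij}(k)=j+k$ for $1\le k\le i$ and $\chi_{ij}(i+k)=k$ for $1\le k\le j$. Then $\beta: T(V)\otimes T(V)\to T(V)\otimes T(V)$ is the linear map whose restriction to $V^{\otimes i}\otimes V^{\otimes j}$ is $\beta_{ij}=T^\sigma_{\chi_{ij}}$ (with values in $V^{\otimes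 j}\otimes V^{\otimes i}$), with $\beta_{0i},\beta_{i0}$ the usual flips. Quantum shuffle product: for $x_1,\dots,x_{i+j}\in V$, the product of $x_1\otimes\cdots\otimes x_i$ and $x_{i+1}\otimes\cdots\otimes x_{i+j}$ is $\sum_{w\in\mathfrak{S}_{i,j}}T^\sigma_w(x_1\otimes\cdots\otimes x_{i+j})$, where $\mathfrak{S}_{i,j}$ is the set of $w\in\mathfrak{S}_{i+j}$ with $w(1)<\cdots<w(i)$ and $w(i+1)<\cdots<w(i+j)$; it is associative with unit $1\in K=V^{\otimes 0}$. A braided algebra $(A,m,\sigma)$ is an associative unital algebra with a braiding $\sigma$ on $A$ such that $\sigma(m\otimes\mathrm{id}_A)=(\mathrm{id}_A\otimes m)\sigma_1\sigma_2$, $\sigma(\mathrm{id}_A\otimes m)=(m\otimes\mathrm{id}_A)\sigma_2\sigma_1$, $\sigma(1_A\otimes a)=a\otimes 1_A$ and $\sigma(a\otimes 1_A)=1_A\otimes a$ for all $a\in A$. *)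

theory Defs
  imports Complex_Main "HOL-Library.Function_Algebras" "HOL-Combinatorics.Permutations"
begin

section \<open>Tensor powers of a vector space\<close>

text \<open>
  Vector spaces are given by a type with a scalar multiplication \<open>s\<close>, and a subspace \<open>A\<close> of it.
  The library has no tensor products, so we construct them: \<open>x\<^sub>1 \<otimes> \<dots> \<otimes> x\<^sub>n\<close> is the evaluation functional
  \<open>f \<mapsto> f(x\<^sub>1, \<dots>, x\<^sub>n)\<close> on multilinear forms, and tensor powers are spans of such functionals in the
  space of all functions. The lemmas \<open>tensor_universal\<close> and \<open>tpower_universal\<close> below are
  the universal properties of \<open>T(V)\<close> and of \<open>A\<^sup>\<otimes>\<^sup>n\<close> for an arbitrary target space.
\<close>

definition fscale :: "'k::field \<Rightarrow> ('x \<Rightarrow> 'k) \<Rightarrow> 'x \<Rightarrow> 'k" where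
  "fscale c f = (\<lambda>x. c * f x)"

text \<open>A function on lists is a family of maps \<open>V\<^sup>n \<rightarrow> W\<close>, one for every \<open>n \<ge> 0\<close>;
  it is arbitrary on the empty list.\<close>

definition multilinear ::
    "('k::field \<Rightarrow> 'v::ab_group_add \<Rightarrow> 'v) \<Rightarrow> ('k \<Rightarrow> 'w::ab_group_add \<Rightarrow> 'w) \<Rightarrow> ('v list \<Rightarrow> 'w) \<Rightarrow> bool" where
  "multilinear s t f \<longleftrightarrow> (\<forall>xs ys. Vector_Spaces.linear s t (\<lambda>x. f (xs @ x # ys)))"

type_synonym ('v, 'k) tens = "('v list \<Rightarrow> 'k) \<Rightarrow> 'k"

definition pure :: "('k::field \<Rightarrow> 'v::ab_group_add \<Rightarrow> 'v) \<Rightarrow> 'v list \<Rightarrow> ('v, 'k) tens" where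
  "pure s xs = (\<lambda>f. if multilinear s (*) f then f xs else 0)"

text \<open>\<open>A\<^sup>\<otimes>\<^sup>n\<close>, as a subspace of the \<open>n\<close>-th tensor power of the ambient space.\<close>

definition tpower :: "('k::field \<Rightarrow> 'v::ab_group_add \<Rightarrow> 'v) \<Rightarrow> 'v set \<Rightarrow> nat \<Rightarrow> ('v, 'k) tens set" where
  "tpower s A n = module.span fscale (pure s ` {xs. set xs \<subseteq> A \<and> length xs = n})"

definition tensor_space :: "('k::field \<Rightarrow> 'v::ab_group_add \<Rightarrow> 'v) \<Rightarrow> ('v, 'k) tens set" where
  "tensor_space s = module.span fscale (range (pure s))"

definition linear_on ::
    "('k::field \<Rightarrow> 'v::ab_group_add \<Rightarrow> 'v) \<Rightarrow> ('k \<Rightarrow> 'w::ab_group_add \<Rightarrow> 'w) \<Rightarrow> 'v set \<Rightarrow> ('v \<Rightarrow> 'w) \<Rightarrow> bool" where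
  "linear_on s t A f \<longleftrightarrow>
     (\<forall>x\<in>A. \<forall>y\<in>A. f (x + y) = f x + f y) \<and> (\<forall>c. \<forall>x\<in>A. f (s c x) = t c (f x))"

text \<open>The linear map on \<open>A\<^sup>\<otimes>\<^sup>n\<close> with \<open>x\<^sub>1 \<otimes> \<dots> \<otimes> x\<^sub>n \<mapsto> F [x\<^sub>1, \<dots>, x\<^sub>n]\<close>. By \<open>tpower_universal\<close> it exists
  when \<open>F\<close> is multilinear on \<open>A\<close>; it is determined on \<open>A\<^sup>\<otimes>\<^sup>n\<close> only.\<close>

definition lin_ext ::
    "('k::field \<Rightarrow> 'v::ab_group_add \<Rightarrow> 'v) \<Rightarrow> 'v set \<Rightarrow> nat \<Rightarrow> ('v list \<Rightarrow> ('x \<Rightarrow> 'k))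
      \<Rightarrow> ('v, 'k) tens \<Rightarrow> ('x \<Rightarrow> 'k)" where
  "lin_ext s A n F = (SOME h. linear_on fscale fscale (tpower s A n) h \<and>
     (\<forall>xs. set xs \<subseteq> A \<and> length xs = n \<longrightarrow> h (pure s xs) = F xs))"

text \<open>The bilinear map on \<open>T(V) \<times> T(V)\<close> with \<open>(pure s xs, pure s ys) \<mapsto> F xs ys\<close>,
  for \<open>F\<close> multilinear in \<open>xs\<close> and in \<open>ys\<close>; see \<open>bilin_ext_pure\<close>.\<close>

definition bilin_ext ::
    "('v list \<Rightarrow> 'v list \<Rightarrow> ('x \<Rightarrow> 'k)) \<Rightarrow> ('v, 'k) tens \<Rightarrow> ('v, 'k) tens \<Rightarrow> ('x \<Rightarrow> 'k)" where
  "bilin_ext F a b = (\<lambda>g. a (\<lambda>xs. b (\<lambda>ys. F xs ys g)))"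

text \<open>Concatenation of tensors, \<open>V\<^sup>\<otimes>\<^sup>m \<times> V\<^sup>\<otimes>\<^sup>n \<rightarrow> V\<^sup>\<otimes>\<^sup>m\<^sup>+\<^sup>n\<close>.\<close>

definition conc ::
    "('k::field \<Rightarrow> 'v::ab_group_add \<Rightarrow> 'v) \<Rightarrow> ('v, 'k) tens \<Rightarrow> ('v, 'k) tens \<Rightarrow> ('v, 'k) tens" where
  "conc s = bilin_ext (\<lambda>xs ys. pure s (xs @ ys))"


section \<open>Braided vector spaces and braided algebras\<close>

text \<open>\<open>\<sigma>\<^sub>i = id\<^sup>\<otimes>\<^sup>i\<^sup>-\<^sup>1 \<otimes> \<sigma> \<otimes> id\<^sup>\<otimes>\<^sup>n\<^sup>-\<^sup>i\<^sup>-\<^sup>1\<close> on \<open>A\<^sup>\<otimes>\<^sup>n\<close>, for \<open>1 \<le> i < n\<close>.\<close>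

definition braid_at ::
    "('k::field \<Rightarrow> 'v::ab_group_add \<Rightarrow> 'v) \<Rightarrow> 'v set \<Rightarrow> (('v, 'k) tens \<Rightarrow> ('v, 'k) tens)
      \<Rightarrow> nat \<Rightarrow> nat \<Rightarrow> ('v, 'k) tens \<Rightarrow> ('v, 'k) tens" where
  "braid_at s A \<sigma> n i = lin_ext s A n
     (\<lambda>xs. conc s (conc s (pure s (take (i - 1) xs)) (\<sigma> (pure s [xs ! (i - 1), xs ! i])))
                  (pure s (drop (i + 1) xs)))"

definition braided_vector_space ::
    "('k::field \<Rightarrow> 'v::ab_group_add \<Rightarrow> 'v) \<Rightarrow> 'v set \<Rightarrow> (('v, 'k) tens \<Rightarrow> ('v, 'k) tens) \<Rightarrow> bool" where
  "braided_vector_space s A \<sigma> \<longleftrightarrow>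
     vector_space s \<and> module.subspace s A \<and>
     linear_on fscale fscale (tpower s A 2) \<sigma> \<and>
     bij_betw \<sigma> (tpower s A 2) (tpower s A 2) \<and>
     (\<forall>X \<in> tpower s A 3.
        braid_at s A \<sigma> 3 1 (braid_at s A \<sigma> 3 2 (braid_at s A \<sigma> 3 1 X)) =
        braid_at s A \<sigma> 3 2 (braid_at s A \<sigma> 3 1 (braid_at s A \<sigma> 3 2 X)))"

definition subalgebra ::
    "('k::field \<Rightarrow> 'a::ab_group_add \<Rightarrow> 'a) \<Rightarrow> 'a set \<Rightarrow> ('a \<Rightarrow> 'a \<Rightarrow> 'a) \<Rightarrow> 'a \<Rightarrow> 'a set \<Rightarrow> bool" where
  "subalgebra s A m e B \<longleftrightarrow>
     B \<subseteq> A \<and> module.subspace s B \<and> e \<in> B \<and> (\<forall>x\<in>B. \<forall>y\<in>B. m x y \<in> B)"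

definition generated_subalgebra ::
    "('k::field \<Rightarrow> 'a::ab_group_add \<Rightarrow> 'a) \<Rightarrow> 'a set \<Rightarrow> ('a \<Rightarrow> 'a \<Rightarrow> 'a) \<Rightarrow> 'a \<Rightarrow> 'a set \<Rightarrow> 'a set" where
  "generated_subalgebra s A m e G = \<Inter>{B. subalgebra s A m e B \<and> G \<subseteq> B}"

definition unital_algebra ::
    "('k::field \<Rightarrow> 'a::ab_group_add \<Rightarrow> 'a) \<Rightarrow> 'a set \<Rightarrow> ('a \<Rightarrow> 'a \<Rightarrow> 'a) \<Rightarrow> 'a \<Rightarrow> bool" where
  "unital_algebra s A m e \<longleftrightarrow>
     vector_space s \<and> subalgebra s A m e A \<and>
     (\<forall>x\<in>A. linear_on s s A (m x) \<and> linear_on s s A (\<lambda>y. m y x)) \<and>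
     (\<forall>x\<in>A. \<forall>y\<in>A. \<forall>z\<in>A. m (m x y) z = m x (m y z)) \<and>
     (\<forall>x\<in>A. m e x = x \<and> m x e = x)"

text \<open>\<open>m \<otimes> id\<close> and \<open>id \<otimes> m\<close>, as maps \<open>A\<^sup>\<otimes>\<^sup>3 \<rightarrow> A\<^sup>\<otimes>\<^sup>2\<close>.\<close>

definition mult_id ::
    "('k::field \<Rightarrow> 'a::ab_group_add \<Rightarrow> 'a) \<Rightarrow> 'a set \<Rightarrow> ('a \<Rightarrow> 'a \<Rightarrow> 'a) \<Rightarrow> ('a, 'k) tens \<Rightarrow> ('a, 'k) tens" where
  "mult_id s A m = lin_ext s A 3 (\<lambda>xs. pure s [m (xs ! 0) (xs ! 1), xs ! 2])"

definition id_mult ::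
    "('k::field \<Rightarrow> 'a::ab_group_add \<Rightarrow> 'a) \<Rightarrow> 'a set \<Rightarrow> ('a \<Rightarrow> 'a \<Rightarrow> 'a) \<Rightarrow> ('a, 'k) tens \<Rightarrow> ('a, 'k) tens" where
  "id_mult s A m = lin_ext s A 3 (\<lambda>xs. pure s [xs ! 0, m (xs ! 1) (xs ! 2)])"

definition braided_algebra ::
    "('k::field \<Rightarrow> 'a::ab_group_add \<Rightarrow> 'a) \<Rightarrow> 'a set \<Rightarrow> ('a \<Rightarrow> 'a \<Rightarrow> 'a) \<Rightarrow> 'a
      \<Rightarrow> (('a, 'k) tens \<Rightarrow> ('a, 'k) tens) \<Rightarrow> bool" where
  "braided_algebra s A m e \<sigma> \<longleftrightarrow>
     unital_algebra s A m e \<and> braided_vector_space s A \<sigma> \<and>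
     (\<forall>X \<in> tpower s A 3.
        \<sigma> (mult_id s A m X) = id_mult s A m (braid_at s A \<sigma> 3 1 (braid_at s A \<sigma> 3 2 X)) \<and>
        \<sigma> (id_mult s A m X) = mult_id s A m (braid_at s A \<sigma> 3 2 (braid_at s A \<sigma> 3 1 X))) \<and>
     (\<forall>a\<in>A. \<sigma> (pure s [e, a]) = pure s [a, e] \<and> \<sigma> (pure s [a, e]) = pure s [e, a])"


section \<open>Lifts of permutations\<close>

text \<open>Products in the symmetric group are compositions of functions, so the rightmost factor acts
  first, both in \<open>s\<^sub>i\<^sub>1 \<cdots> s\<^sub>i\<^sub>l\<close> and in \<open>\<sigma>\<^sub>i\<^sub>1 \<cdots> \<sigma>\<^sub>i\<^sub>l\<close>.\<close>

definition word_perm :: "nat list \<Rightarrow> nat \<Rightarrow> nat" where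
  "word_perm is = foldr (\<lambda>i w. Transposition.transpose i (i + 1) \<circ> w) is id"

definition expression :: "nat \<Rightarrow> (nat \<Rightarrow> nat) \<Rightarrow> nat list \<Rightarrow> bool" where
  "expression n w is \<longleftrightarrow> set is \<subseteq> {1..<n} \<and> word_perm is = w"

definition reduced_expression :: "nat \<Rightarrow> (nat \<Rightarrow> nat) \<Rightarrow> nat list \<Rightarrow> bool" where
  "reduced_expression n w is \<longleftrightarrow>
     expression n w is \<and> (\<forall>js. expression n w js \<longrightarrow> length is \<le> length js)"

definition T_perm ::
    "('k::field \<Rightarrow> 'v::ab_group_add \<Rightarrow> 'v) \<Rightarrow> (('v, 'k) tens \<Rightarrow> ('v, 'k) tens)
      \<Rightarrow> nat \<Rightarrow> (nat \<Rightarrow> nat) \<Rightarrow> ('v, 'k) tens \<Rightarrow> ('v, 'k) tens" where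
  "T_perm s \<sigma> n w =
     foldr (\<lambda>i h. braid_at s UNIV \<sigma> n i \<circ> h) (SOME is. reduced_expression n w is) id"


section \<open>The quantum shuffle algebra and its braiding\<close>

definition shuffles_perm :: "nat \<Rightarrow> nat \<Rightarrow> (nat \<Rightarrow> nat) set" where
  "shuffles_perm i j = {w. w permutes {1..i + j} \<and>
     strict_mono_on {1..i} w \<and> strict_mono_on {i + 1..i + j} w}"

definition qshuffle ::
    "('k::field \<Rightarrow> 'v::ab_group_add \<Rightarrow> 'v) \<Rightarrow> (('v, 'k) tens \<Rightarrow> ('v, 'k) tens)
      \<Rightarrow> ('v, 'k) tens \<Rightarrow> ('v, 'k) tens \<Rightarrow> ('v, 'k) tens" where
  "qshuffle s \<sigma> = bilin_ext (\<lambda>xs ys. \<Sum>w\<in>shuffles_perm (length xs) (length ys).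
     T_perm s \<sigma> (length xs + length ys) w (pure s (xs @ ys)))"

definition chi :: "nat \<Rightarrow> nat \<Rightarrow> nat \<Rightarrow> nat" where
  "chi i j k = (if 1 \<le> k \<and> k \<le> i then j + k else if i < k \<and> k \<le> i + j then k - i else k)"

text \<open>The identification of \<open>V\<^sup>\<otimes>\<^sup>j\<^sup>+\<^sup>i\<close> with \<open>V\<^sup>\<otimes>\<^sup>j \<otimes> V\<^sup>\<otimes>\<^sup>i \<subseteq> T(V) \<otimes> T(V)\<close>.\<close>

definition deconc ::
    "('k::field \<Rightarrow> 'v::ab_group_add \<Rightarrow> 'v) \<Rightarrow> nat \<Rightarrow> nat \<Rightarrow> ('v, 'k) tens \<Rightarrow> (('v, 'k) tens, 'k) tens" where
  "deconc s j i = lin_ext s UNIV (j + i)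
     (\<lambda>zs. pure fscale [pure s (take j zs), pure s (drop j zs)])"

text \<open>Value of \<open>\<beta>\<close> on \<open>(x\<^sub>1 \<otimes> \<dots> \<otimes> x\<^sub>i) \<otimes> (y\<^sub>1 \<otimes> \<dots> \<otimes> y\<^sub>j)\<close>.\<close>

definition beta_pure ::
    "('k::field \<Rightarrow> 'v::ab_group_add \<Rightarrow> 'v) \<Rightarrow> (('v, 'k) tens \<Rightarrow> ('v, 'k) tens)
      \<Rightarrow> 'v list \<Rightarrow> 'v list \<Rightarrow> (('v, 'k) tens, 'k) tens" where
  "beta_pure s \<sigma> xs ys =
     (if xs = [] \<or> ys = [] then pure fscale [pure s ys, pure s xs]
      else deconc s (length ys) (length xs)
             (T_perm s \<sigma> (length xs + length ys) (chi (length xs) (length ys)) (pure s (xs @ ys))))"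

definition beta ::
    "('k::field \<Rightarrow> 'v::ab_group_add \<Rightarrow> 'v) \<Rightarrow> (('v, 'k) tens \<Rightarrow> ('v, 'k) tens)
      \<Rightarrow> (('v, 'k) tens, 'k) tens \<Rightarrow> (('v, 'k) tens, 'k) tens" where
  "beta s \<sigma> = lin_ext fscale (tensor_space s) 2
     (\<lambda>ab. bilin_ext (beta_pure s \<sigma>) (ab ! 0) (ab ! 1))"

definition qsymmetric ::
    "('k::field \<Rightarrow> 'v::ab_group_add \<Rightarrow> 'v) \<Rightarrow> (('v, 'k) tens \<Rightarrow> ('v, 'k) tens) \<Rightarrow> ('v, 'k) tens set" where
  "qsymmetric s \<sigma> = generated_subalgebra fscale (tensor_space s) (qshuffle s \<sigma>) (pure s [])
     (range (\<lambda>v. pure s [v]))"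


section \<open>Universal properties\<close>

lemma vector_space_fscale: "vector_space (fscale :: 'k::field \<Rightarrow> ('x \<Rightarrow> 'k) \<Rightarrow> _)"
  by unfold_locales (auto simp: fscale_def fun_eq_iff algebra_simps)

lemma vector_space_mult: "vector_space ((*) :: 'k::field \<Rightarrow> 'k \<Rightarrow> 'k)"
  by unfold_locales (auto simp: algebra_simps)

lemma bilin_ext_pure:
  fixes F :: "'v::ab_group_add list \<Rightarrow> 'v list \<Rightarrow> ('x \<Rightarrow> 'k::field)"
  assumes "\<And>ys. multilinear s fscale (\<lambda>xs. F xs ys)" and "\<And>xs. multilinear s fscale (F xs)"
  shows "bilin_ext F (pure s xs) (pure s ys) = F xs ys"
proof -
  have ev: "multilinear s (*) (\<lambda>zs. G zs g)"
    if "multilinear s fscale G" for G :: "'v list \<Rightarrow> 'x \<Rightarrow> 'k" and g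
    using that vector_space_mult
    by (auto simp: multilinear_def Vector_Spaces.linear_iff fscale_def)
  show ?thesis
    using ev[OF assms(1)] ev[OF assms(2)] by (simp add: bilin_ext_def pure_def fun_eq_iff)
qed

lemma tensor_universal:
  fixes s :: "'k::field \<Rightarrow> 'v::ab_group_add \<Rightarrow> 'v" and t :: "'k \<Rightarrow> 'w::ab_group_add \<Rightarrow> 'w"
  assumes t: "vector_space t" and F: "multilinear s t F"
  shows "\<exists>h. Vector_Spaces.linear fscale t h \<and> (\<forall>xs. h (pure s xs) = F xs)"
proof -
  interpret t: vector_space t by fact
  interpret f: vector_space "fscale :: 'k \<Rightarrow> ('v, 'k) tens \<Rightarrow> _" by (rule vector_space_fscale)
  interpret ft: vector_space_pair "fscale :: 'k \<Rightarrow> ('v, 'k) tens \<Rightarrow> _" t ..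
  interpret k: vector_space "(*) :: 'k \<Rightarrow> 'k \<Rightarrow> 'k" by (rule vector_space_mult)
  interpret tk: vector_space_pair t "(*) :: 'k \<Rightarrow> 'k \<Rightarrow> 'k" ..
  interpret fk: vector_space_pair "fscale :: 'k \<Rightarrow> ('v, 'k) tens \<Rightarrow> _" "(*) :: 'k \<Rightarrow> 'k \<Rightarrow> 'k" ..
  obtain B where B: "B \<subseteq> range (pure s)" "f.independent B" "range (pure s) \<subseteq> f.span B"
    using f.maximal_independent_subset by metis
  define h where "h = ft.construct B (\<lambda>b. F (SOME xs. pure s xs = b))"
  have lin: "Vector_Spaces.linear fscale t h"
    unfolding h_def using B(2) by (rule ft.linear_construct)
  have "h (pure s xs) = F xs" for xs
  proof (rule ccontr)
    assume "h (pure s xs) \<noteq> F xs"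
    then have "t.independent {h (pure s xs) - F xs}" by simp
    from tk.linear_independent_extend[OF this, of "\<lambda>_. 1"]
    obtain \<phi> where \<phi>: "Vector_Spaces.linear t (*) \<phi>" "\<phi> (h (pure s xs) - F xs) = 1" by auto
    have m: "multilinear s (*) (\<phi> \<circ> F)"
      using F \<phi>(1) unfolding multilinear_def Vector_Spaces.linear_iff by simp
    have 1: "Vector_Spaces.linear fscale (*) (\<phi> \<circ> h)"
      using lin \<phi>(1) by (rule Vector_Spaces.linear_compose)
    have 2: "Vector_Spaces.linear fscale (*) (\<lambda>X::('v, 'k) tens. X (\<phi> \<circ> F))"
      by (unfold_locales) (auto simp: fscale_def)
    have "(\<phi> \<circ> h) (pure s xs) = pure s xs (\<phi> \<circ> F)"
    proof (rule fk.linear_eq_on[OF 1 2, of _ B])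
      show "pure s xs \<in> f.span B" using B(3) by auto
      fix b assume b: "b \<in> B"
      define ys where "ys = (SOME xs. pure s xs = b)"
      have ys: "pure s ys = b"
        unfolding ys_def by (rule someI_ex) (use b B(1) in auto)
      have "h b = F ys"
        unfolding h_def ys_def using b B(2) by (rule ft.construct_basis[rotated])
      then show "(\<phi> \<circ> h) b = b (\<phi> \<circ> F)"
        using m by (simp add: ys[symmetric] pure_def)
    qed
    then have "\<phi> (h (pure s xs)) = \<phi> (F xs)"
      using m by (simp add: pure_def)
    then show False
      using \<phi> by (simp add: module_hom.diff module_hom_iff_linear[symmetric])
  qed
  with lin show ?thesis by blast
qed

lemma tpower_universal:
  fixes s :: "'k::field \<Rightarrow> 'v::ab_group_add \<Rightarrow> 'v" and t :: "'k \<Rightarrow> 'w::ab_group_add \<Rightarrow> 'w"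
  assumes s: "vector_space s" and A: "module.subspace s A" and t: "vector_space t"
    and F: "\<And>xs ys. set xs \<subseteq> A \<Longrightarrow> set ys \<subseteq> A \<Longrightarrow> Suc (length xs + length ys) = n \<Longrightarrow>
              linear_on s t A (\<lambda>x. F (xs @ x # ys))"
  shows "\<exists>h. linear_on fscale t (tpower s A n) h \<and>
    (\<forall>xs. set xs \<subseteq> A \<and> length xs = n \<longrightarrow> h (pure s xs) = F xs)"
proof -
  interpret s: vector_space s by fact
  interpret t: vector_space t by fact
  interpret ss: vector_space_pair s s ..
  obtain p where p: "p ` UNIV \<subseteq> A" "Vector_Spaces.linear s s p" "\<And>v. v \<in> A \<Longrightarrow> p v = v"
    using ss.linear_exists_left_inverse_on[OF s.linear_id A] by auto
  define G where "G xs = (if length xs = n then F (map p xs) else 0)" for xs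
  have "multilinear s t G"
    unfolding multilinear_def
  proof (intro allI)
    fix xs ys
    show "Vector_Spaces.linear s t (\<lambda>x. G (xs @ x # ys))"
    proof (cases "Suc (length xs + length ys) = n")
      case True
      have "linear_on s t A (\<lambda>x. F (map p xs @ x # map p ys))"
        using p(1) True by (intro F) auto
      then show ?thesis
        using p(2) True s t range_subsetD[OF p(1)]
        unfolding Vector_Spaces.linear_iff linear_on_def G_def by simp
    next
      case False
      then show ?thesis using s t by (auto simp: Vector_Spaces.linear_iff G_def)
    qed
  qed
  from tensor_universal[OF t this] obtain h
    where h: "Vector_Spaces.linear fscale t h" "\<And>xs. h (pure s xs) = G xs" by blast
  have "h (pure s xs) = F xs" if "set xs \<subseteq> A" "length xs = n" for xs
  proof -
    have "map p xs = xs" using that(1) p(3) by (intro map_idI) auto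
    then show ?thesis using that(2) by (simp add: h(2) G_def)
  qed
  moreover have "linear_on fscale t (tpower s A n) h"
    using h(1) by (auto simp: linear_on_def Vector_Spaces.linear_iff)
  ultimately show ?thesis by blast
qed

end

theory Submission
  imports Defs "HOL-Library.Infinite_Set"
begin

text \<open>By Matsumoto's theorem \<open>T\<^sub>u T\<^sub>v = T\<^sub>u\<^sub>v\<close> whenever the numbers of inversions of \<open>u\<close> and \<open>v\<close> add up
  in \<open>u v\<close>. On \<open>V\<^sup>\<otimes>\<^sup>i \<otimes> V\<^sup>\<otimes>\<^sup>j\<close> both the product and the braiding are given by operators \<open>T\<^sub>w\<close>, so
  each axiom becomes an identity between length-additive products of permutations. Associativity
  holds because a permutation that is increasing on three consecutive blocks factors uniquely as a
  shuffle of two blocks (merging the first two, or the last two, of the three) times a shuffle inside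
  the merged block. The braid equation and the compatibility with the product follow from the
  factorizations of \<open>\<chi>\<^sub>i\<^sub>+\<^sub>j\<^sub>,\<^sub>k\<close> and \<open>\<chi>\<^sub>i\<^sub>,\<^sub>j\<^sub>+\<^sub>k\<close> and from the fact that \<open>\<chi>\<close> intertwines a permutation
  of a block with its translate.

  An operator satisfying the axioms of a braided algebra maps \<open>S \<otimes> S\<close> to itself once it maps
  \<open>V \<otimes> V\<close> to itself, where \<open>S\<close> is the subalgebra generated by \<open>V\<close>. The inverse of \<open>\<beta>\<close> is the braiding
  induced by \<open>\<sigma>\<^sup>-\<^sup>1\<close> and satisfies the same axioms, hence \<open>\<beta>\<close> restricts to a bijection of \<open>S \<otimes> S\<close>.\<close>

section \<open>Inversions and reduced expressions\<close>

text \<open>The maps of the statement are picked by \<open>SOME\<close> and determined on tensor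
  powers only, and \<open>\<sigma>\<close> is linear only on V \<otimes> V. Each is therefore
  replaced by an operator that is linear on the whole function space: \<open>\<sigma>\<close> by a
  linear extension \<open>B\<close>, multilinear families by \<open>mext\<close>, bilinear ones by
  \<open>tbil\<close>. Identities are proved for these operators and carried back by agreement on
  tensors. A lift belongs to one chosen reduced word, so no product formula for it is available
  before Matsumoto's theorem. That theorem is stated for operators on an invariant set
  \<open>X\<close>, because the braid relations hold only on a fixed tensor power. Additivity of
  lengths is tested without words: \<open>u\<close> must not restore the order of a pair that
  \<open>v\<close> has inverted. A dimension count cannot make the restriction to S \<otimes> S
  surjective, since V may be infinite-dimensional; hence the inverse is followed on S \<otimes> S
  too. It is compatible with the product built from \<open>\<sigma>\<close> itself, and each of its
  axioms is the opposite axiom of \<beta>, solved for the inverse.\<close>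

definition adj :: "nat \<Rightarrow> nat \<Rightarrow> nat" where
  "adj i = Transposition.transpose i (i + 1)"

text \<open>Pairs range over all naturals rather than over {1..n}, so a permutation has the same
  length in every symmetric group that contains it; \<open>T_left\<close> relies on this.\<close>

definition inversions :: "(nat \<Rightarrow> nat) \<Rightarrow> (nat \<times> nat) set" where
  "inversions w = {(a, b). a < b \<and> w b < w a}"

definition ninv :: "(nat \<Rightarrow> nat) \<Rightarrow> nat" where
  "ninv w = card (inversions w)"

text \<open>Compatible permutations are those whose lengths add up in the product.\<close>

definition compatible :: "(nat \<Rightarrow> nat) \<Rightarrow> (nat \<Rightarrow> nat) \<Rightarrow> bool" where
  "compatible u v \<longleftrightarrow> (\<forall>a b. a < b \<longrightarrow> v b < v a \<longrightarrow> u (v b) < u (v a))"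

lemma word_perm_Nil [simp]: "word_perm [] = id"
  by (simp add: word_perm_def)

lemma word_perm_Cons [simp]: "word_perm (i # is) = adj i \<circ> word_perm is"
  by (simp add: word_perm_def adj_def)

lemma word_perm_append: "word_perm (is @ js) = word_perm is \<circ> word_perm js"
  by (induction "is") (simp_all only: append_Nil append_Cons word_perm_Nil word_perm_Cons id_o o_assoc)

lemma adj_permutes: "1 \<le> i \<Longrightarrow> i < n \<Longrightarrow> adj i permutes {1..n}"
  unfolding adj_def by (intro permutes_swap_id) auto

lemma adj_adj: "adj i \<circ> adj i = id"
  unfolding adj_def by (rule transpose_comp_involutory)

lemma adj_adj_comp: "adj i \<circ> (adj i \<circ> w) = w"
  by (simp only: o_assoc adj_adj id_o)

lemma word_perm_permutes: "set is \<subseteq> {1..<n} \<Longrightarrow> word_perm is permutes {1..n}"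
proof (induction "is")
  case Nil show ?case unfolding word_perm_Nil by (rule permutes_id)
next
  case (Cons i "is")
  then show ?case
    unfolding word_perm_Cons by (intro permutes_compose adj_permutes) auto
qed

lemma permutes_bounds:
  fixes w :: "nat \<Rightarrow> nat"
  assumes "w permutes {1..n}"
  shows "1 \<le> k \<Longrightarrow> k \<le> n \<Longrightarrow> 1 \<le> w k \<and> w k \<le> n" "n < k \<Longrightarrow> w k = k" "w 0 = 0"
    and "(w k \<le> n) = (k \<le> n)" and "(w k = 0) = (k = 0)"
proof -
  show 1: "1 \<le> k \<Longrightarrow> k \<le> n \<Longrightarrow> 1 \<le> w k \<and> w k \<le> n" for k
    using permutes_in_image[OF assms, of k] by auto
  show 2: "n < k \<Longrightarrow> w k = k" for k using permutes_not_in[OF assms, of k] by auto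
  show 3: "w 0 = 0" using permutes_not_in[OF assms, of 0] by auto
  show "(w k \<le> n) = (k \<le> n)" using 1[of k] 2[of k] 3 by (cases "k = 0"; cases "k \<le> n") auto
  show "(w k = 0) = (k = 0)" using 1[of k] 2[of k] 3 by (cases "k = 0"; cases "k \<le> n") auto
qed

text \<open>Points outside {1..n} are fixed: 0 stays below everything, and a point above
  \<open>n\<close> stays above the images of all smaller points.\<close>

lemma inversions_bounds:
  assumes "w permutes {1..n}" "(a, b) \<in> inversions w"
  shows "1 \<le> a" "a < b" "b \<le> n"
proof -
  have ab: "a < b" "w b < w a" using assms(2) by (auto simp: inversions_def)
  show "a < b" by fact
  show "1 \<le> a" using ab permutes_bounds(3)[OF assms(1)] by (cases "a = 0") auto
  show "b \<le> n"
  proof (rule ccontr)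
    assume "\<not> b \<le> n"
    then show False
      using ab permutes_bounds(2)[OF assms(1), of b] permutes_bounds(2)[OF assms(1), of a]
        permutes_bounds(4)[OF assms(1), of a] by (cases "a \<le> n") auto
  qed
qed

lemma finite_inversions:
  assumes "w permutes {1..n}" shows "finite (inversions w)"
proof (rule finite_subset)
  show "inversions w \<subseteq> {1..n} \<times> {1..n}"
  proof
    fix x assume "x \<in> inversions w"
    then show "x \<in> {1..n} \<times> {1..n}"
      using inversions_bounds[OF assms, of "fst x" "snd x"] by (cases x) auto
  qed
qed simp

lemma permutes_eq_iff: "w permutes S \<Longrightarrow> w a = w b \<longleftrightarrow> a = b"
  using permutes_inj[of w S] by (simp add: inj_eq)

text \<open>An inversion of the product is either a pair that \<open>v\<close> has inverted or a
  pair that \<open>v\<close> keeps and \<open>u\<close> then inverts. Compatibility enters twice: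
  \<open>u\<close> undoes no inversion of \<open>v\<close>, and every inversion of \<open>u\<close>
  comes from a pair that \<open>v\<close> keeps in order.\<close>

lemma ninv_comp:
  assumes u: "u permutes {1..n}" and v: "v permutes {1..n}" and c: "compatible u v"
  shows "ninv (u \<circ> v) = ninv u + ninv v"
proof -
  define J where "J = {(a, b). a < b \<and> v a < v b \<and> u (v b) < u (v a)}"
  have split: "inversions (u \<circ> v) = J \<union> inversions v"
  proof (intro set_eqI)
    fix x :: "nat \<times> nat"
    obtain a b where x: "x = (a, b)" by (cases x)
    show "(x \<in> inversions (u \<circ> v)) = (x \<in> J \<union> inversions v)"
      using c permutes_eq_iff[OF v, of a b]
      by (auto simp: x inversions_def J_def compatible_def)
  qed
  have disj: "J \<inter> inversions v = {}" by (auto simp: J_def inversions_def)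
  have "bij_betw (map_prod v v) J (inversions u)"
  proof (rule bij_betw_imageI)
    show "inj_on (map_prod v v) J"
      by (auto simp: inj_on_def permutes_eq_iff[OF v])
    show "map_prod v v ` J = inversions u"
    proof (intro set_eqI iffI)
      fix x assume "x \<in> map_prod v v ` J"
      then show "x \<in> inversions u" by (auto simp: J_def inversions_def)
    next
      fix x assume x: "x \<in> inversions u"
      obtain p q where pq: "x = (p, q)" by (cases x)
      define a b where "a = inv v p" and "b = inv v q"
      have ab: "v a = p" "v b = q"
        using permutes_inverses(1)[OF v] by (auto simp: a_def b_def)
      have h: "p < q" "u q < u p" using x pq by (auto simp: inversions_def)
      have "\<not> b < a" using c h ab by (auto simp: compatible_def dest: less_asym)
      moreover have "a \<noteq> b" using h ab by auto
      ultimately have "(a, b) \<in> J" using h ab by (auto simp: J_def)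
      then show "x \<in> map_prod v v ` J" unfolding pq by (rule rev_image_eqI) (simp add: ab)
    qed
  qed
  then have "card J = ninv u" by (simp add: ninv_def bij_betw_same_card)
  moreover have "finite J" "finite (inversions v)"
    using finite_inversions[OF permutes_compose[OF v u]] split by auto
  ultimately show ?thesis
    using disj split by (simp add: ninv_def card_Un_disjoint)
qed

lemma ninv_id [simp]: "ninv id = 0"
proof -
  have "inversions id = {}" by (auto simp: inversions_def)
  then show ?thesis by (simp add: ninv_def)
qed

lemma adj_apply: "adj i k = (if k = i then i + 1 else if k = i + 1 then i else k)"
  by (simp add: adj_def Transposition.transpose_def)

lemma ninv_adj: "ninv (adj i) = 1"
proof -
  have "inversions (adj i) = {(i, i + 1)}"
    by (auto simp: inversions_def adj_apply split: if_splits)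
  then show ?thesis by (simp add: ninv_def)
qed

text \<open>Left multiplication by \<open>adj i\<close> exchanges the values \<open>i\<close> and
  \<open>i + 1\<close> and keeps the order of every other pair of values. As these two values occur
  in increasing order, no inversion of \<open>w\<close> is lost.\<close>

lemma ninv_ascent:
  assumes i: "1 \<le> i" "i < n" and w: "w permutes {1..n}"
    and ab: "a < b" "w a = i" "w b = i + 1"
  shows "ninv (adj i \<circ> w) = Suc (ninv w)"
proof -
  have "compatible (adj i) w"
    unfolding compatible_def
  proof (intro allI impI)
    fix c d assume cd: "c < d" "w d < w c"
    have "\<not> (w d = i \<and> w c = i + 1)"
      using permutes_eq_iff[OF w, of d a] permutes_eq_iff[OF w, of c b] ab cd by auto
    then show "adj i (w d) < adj i (w c)" using cd by (auto simp: adj_apply)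
  qed
  then show ?thesis using ninv_comp[OF adj_permutes[OF i] w] ninv_adj by simp
qed

lemma ninv_descent:
  assumes i: "1 \<le> i" "i < n" and w: "w permutes {1..n}"
    and ab: "a < b" "w a = i + 1" "w b = i"
  shows "ninv w = Suc (ninv (adj i \<circ> w))"
proof -
  have "ninv (adj i \<circ> (adj i \<circ> w)) = Suc (ninv (adj i \<circ> w))"
    by (rule ninv_ascent[OF i permutes_compose[OF w adj_permutes[OF i]] ab(1)])
      (use ab in \<open>auto simp: adj_apply\<close>)
  then show ?thesis by (simp only: adj_adj_comp)
qed

lemma permutes_preimages:
  fixes w :: "nat \<Rightarrow> nat"
  assumes "w permutes S" obtains a where "w a = i"
  using permutes_surj[OF assms] by (metis surjD)

lemma ninv_adj_cases:
  assumes i: "1 \<le> i" "i < n" and w: "w permutes {1..n}"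
  obtains (asc) a b where "a < b" "w a = i" "w b = i + 1" "ninv (adj i \<circ> w) = Suc (ninv w)"
  | (desc) a b where "a < b" "w a = i + 1" "w b = i" "ninv w = Suc (ninv (adj i \<circ> w))"
proof -
  obtain a where a: "w a = i" by (rule permutes_preimages[OF w])
  obtain b where b: "w b = i + 1" by (rule permutes_preimages[OF w])
  consider "a < b" | "b < a" using a b by (cases a b rule: linorder_cases) auto
  then show thesis
  proof cases
    case 1 then show thesis using asc ninv_ascent[OF i w 1 a b] a b by blast
  next
    case 2 then show thesis using desc ninv_descent[OF i w 2 b a] a b by blast
  qed
qed

lemma ninv_word_perm_le: "set is \<subseteq> {1..<n} \<Longrightarrow> ninv (word_perm is) \<le> length is"
proof (induction "is")
  case (Cons i "is")
  then have i: "1 \<le> i" "i < n" and w: "word_perm is permutes {1..n}"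
    and le: "ninv (word_perm is) \<le> length is"
    using word_perm_permutes by auto
  show ?case unfolding word_perm_Cons
    by (rule ninv_adj_cases[OF i w]) (use le in \<open>simp_all del: comp_apply\<close>)
qed simp

text \<open>Applying \<open>p\<close> to the sorted enumeration of \<open>S\<close> gives a sorted
  enumeration of \<open>S\<close> without repetitions, and there is only one.\<close>

lemma strict_mono_permutes_id:
  fixes p :: "'a::linorder \<Rightarrow> 'a"
  assumes "finite S" "p permutes S" "strict_mono_on S p"
  shows "p = id"
proof -
  define xs where "xs = sorted_list_of_set S"
  have xs: "set xs = S" "sorted xs" "distinct xs" using assms(1) by (auto simp: xs_def)
  have "sorted (map p xs)" unfolding sorted_map
    by (rule sorted_wrt_mono_rel[OF _ xs(2)])
      (use assms(3) xs(1) in \<open>auto simp: strict_mono_on_def le_less\<close>)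
  moreover have "distinct (map p xs)"
    using xs(3) by (simp add: distinct_map inj_on_def permutes_eq_iff[OF assms(2)])
  moreover have "set (map p xs) = set xs" using xs(1) permutes_image[OF assms(2)] by simp
  ultimately have "map p xs = xs" using xs by (intro sorted_distinct_set_unique) auto
  then have "p x = x" if "x \<in> S" for x
    using that xs(1) map_eq_conv[of p xs id] by simp
  then show ?thesis using permutes_not_in[OF assms(2)] by (metis eq_id_iff)
qed

text \<open>These are left descents, read off from positions of values. Without one, each value
  \<open>i\<close> stands before \<open>i + 1\<close>, so the inverse of \<open>w\<close> is
  increasing and hence the identity.\<close>

lemma exists_descent:
  fixes w :: "nat \<Rightarrow> nat"
  assumes w: "w permutes {1..n}" and "w \<noteq> id"
  shows "\<exists>i a b. 1 \<le> i \<and> i < n \<and> a < b \<and> w a = i + 1 \<and> w b = i"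
proof (rule ccontr)
  assume no: "\<not> ?thesis"
  define v where "v = inv w"
  have v: "v permutes {1..n}" unfolding v_def by (rule permutes_inv[OF w])
  have wv: "w (v k) = k" for k unfolding v_def by (rule permutes_inverses(1)[OF w])
  have step: "v i < v (Suc i)" if i: "1 \<le> i" "i < n" for i
  proof (rule ccontr)
    assume "\<not> v i < v (Suc i)"
    moreover have "v i \<noteq> v (Suc i)" using permutes_eq_iff[OF v] by simp
    ultimately have "v (Suc i) < v i" by simp
    with no i show False using wv[of "Suc i"] wv[of i] by (metis Suc_eq_plus1)
  qed
  have "strict_mono_on {1..n} v"
  proof (rule strict_mono_onI)
    fix r t assume rt: "r \<in> {1..n}" "t \<in> {1..n}" "r < t"
    have "Suc r \<le> t" using rt by simp
    then have "t \<le> n \<longrightarrow> v r < v t"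
    proof (induction t rule: dec_induct)
      case base then show ?case using rt step[of r] by simp
    next
      case (step m) then show ?case using rt \<open>\<And>i. 1 \<le> i \<Longrightarrow> i < n \<Longrightarrow> v i < v (Suc i)\<close>[of m] by auto
    qed
    then show "v r < v t" using rt by simp
  qed
  then have "v = id" using v by (intro strict_mono_permutes_id[of "{1..n}"]) auto
  then have "w = id" using wv by (auto simp: fun_eq_iff)
  then show False using \<open>w \<noteq> id\<close> by simp
qed

text \<open>Sorting by left descents removes one inversion per letter. Together with
  \<open>ninv_word_perm_le\<close> this identifies the number of inversions with the minimal word
  length.\<close>

lemma exists_expression_ninv:
  assumes "w permutes {1..n}"
  shows "\<exists>is. set is \<subseteq> {1..<n} \<and> word_perm is = w \<and> length is = ninv w"
  using assms
proof (induction "ninv w" arbitrary: w)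
  case 0
  have w: "w = id"
  proof (rule ccontr)
    assume "w \<noteq> id"
    from exists_descent[OF 0(2) this] obtain i a b
      where "1 \<le> i" "i < n" "a < b" "w a = i + 1" "w b = i" by blast
    from ninv_descent[OF this(1,2) 0(2) this(3-)] 0 show False by simp
  qed
  show ?case unfolding w by (intro exI[of _ "[]"]) (simp only: word_perm_Nil ninv_id list.set list.size empty_subsetI simp_thms)
next
  case (Suc m)
  have "w \<noteq> id" using Suc(2) by auto
  from exists_descent[OF Suc(3) this] obtain i a b
    where i: "1 \<le> i" "i < n" "a < b" "w a = i + 1" "w b = i" by blast
  have "ninv w = Suc (ninv (adj i \<circ> w))" by (rule ninv_descent[OF i(1,2) Suc(3) i(3-)])
  then have "m = ninv (adj i \<circ> w)" using Suc(2) by simp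
  from Suc(1)[OF this permutes_compose[OF Suc(3) adj_permutes[OF i(1,2)]]]
  obtain "is" where "set is \<subseteq> {1..<n}" "word_perm is = adj i \<circ> w" "length is = m"
    using \<open>m = _\<close> by auto
  then show ?case using i(1,2) Suc(2)
    by (intro exI[of _ "i # is"]) (simp add: adj_adj_comp del: comp_apply)
qed

lemma reduced_expression_iff:
  assumes w: "w permutes {1..n}"
  shows "reduced_expression n w is \<longleftrightarrow>
    set is \<subseteq> {1..<n} \<and> word_perm is = w \<and> length is = ninv w"
proof -
  obtain js where "set js \<subseteq> {1..<n}" "word_perm js = w" "length js = ninv w"
    using exists_expression_ninv[OF w] by blast
  then show ?thesis
    unfolding reduced_expression_def expression_def
    by (metis ninv_word_perm_le antisym)
qed

text \<open>Induction on the length. If the two words start with \<open>i \<noteq> j\<close>, then both are descents, so both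
  words can be replaced by words that start with the two sides of the braid relation of \<open>i\<close> and \<open>j\<close>
  and have the same tail.\<close>

lemma matsumoto:
  fixes h :: "nat \<Rightarrow> 'x \<Rightarrow> 'x"
  assumes closed: "\<And>i x. 1 \<le> i \<Longrightarrow> i < n \<Longrightarrow> x \<in> X \<Longrightarrow> h i x \<in> X"
    and braid: "\<And>i x. 1 \<le> i \<Longrightarrow> i + 1 < n \<Longrightarrow> x \<in> X \<Longrightarrow>
      h i (h (i + 1) (h i x)) = h (i + 1) (h i (h (i + 1) x))"
    and comm: "\<And>i j x. 1 \<le> i \<Longrightarrow> i + 1 < j \<Longrightarrow> j < n \<Longrightarrow> x \<in> X \<Longrightarrow> h i (h j x) = h j (h i x)"
    and "set is \<subseteq> {1..<n}" "set js \<subseteq> {1..<n}" "word_perm is = word_perm js"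
    and "length is = ninv (word_perm is)" "length js = ninv (word_perm js)" and x: "x \<in> X"
  shows "foldr h is x = foldr h js x"
  using assms(4-8)
proof (induction "length is" arbitrary: "is" js rule: less_induct)
  case less
  note IH = less(1)
  have mem: "foldr h ks x \<in> X" if "set ks \<subseteq> {1..<n}" for ks
    using that x by (induction ks) (auto intro: closed)
  define G where "G is \<longleftrightarrow> set is \<subseteq> {1..<n} \<and> length is = ninv (word_perm is)" for "is"
  \<comment> \<open>A reduced word starts with a left descent: in the case \<open>asc\<close> the
    tail would express a permutation with more inversions than the tail has letters.\<close>
  have tl: "G ks \<and> 1 \<le> i \<and> i < n \<and> word_perm ks = adj i \<circ> w \<and> w permutes {1..n}
      \<and> (\<exists>a b. a < b \<and> w a = i + 1 \<and> w b = i) \<and> length ks < length (i # ks)"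
    if g: "G (i # ks)" and w: "word_perm (i # ks) = w" for i ks w
  proof -
    have i: "1 \<le> i" "i < n" and ks: "set ks \<subseteq> {1..<n}" using g by (auto simp: G_def)
    have wp: "w permutes {1..n}" using g w word_perm_permutes by (auto simp: G_def simp del: word_perm_Cons)
    have kw: "word_perm ks = adj i \<circ> w"
      unfolding w[symmetric] word_perm_Cons by (rule adj_adj_comp[symmetric])
    have len: "Suc (length ks) = ninv w" using g w by (simp add: G_def)
    have le: "ninv (adj i \<circ> w) \<le> length ks" using ninv_word_perm_le[OF ks] kw by simp
    from i wp show ?thesis
    proof (cases rule: ninv_adj_cases)
      case (asc a b) then show ?thesis using le len by simp
    next
      case (desc a b) then show ?thesis using g i ks kw wp len by (auto simp: G_def)
    qed
  qed
  have red: "\<exists>ks. G ks \<and> word_perm ks = w" if "w permutes {1..n}" for w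
    using exists_expression_ninv[OF that] by (auto simp: G_def)
  have IH': "foldr h ks x = foldr h ls x"
    if "length ks < length is" "G ks" "G ls" "word_perm ks = word_perm ls" for ks ls
    using IH that unfolding G_def by blast
  \<comment> \<open>Different first letters may be taken in increasing order by symmetry; equal
    first letters are settled by the induction hypothesis for the tails.\<close>
  have lt: "foldr h (i # ks) x = foldr h (j # ls) x"
    if ij: "i < j" and len: "length (i # ks) = length is" "length (j # ls) = length is"
      and G: "G (i # ks)" "G (j # ls)" and eq: "word_perm (i # ks) = word_perm (j # ls)" for i j ks ls
  proof -
    define w where "w = word_perm (i # ks)"
    have w1: "word_perm (i # ks) = w" and w2: "word_perm (j # ls) = w" using eq w_def by auto
    note t1 = tl[OF G(1) w1] and t2 = tl[OF G(2) w2]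
    have w: "w permutes {1..n}" and i: "1 \<le> i" "i < n" and j: "1 \<le> j" "j < n"
      using t1 t2 by auto
    obtain a b where ab: "a < b" "w a = i + 1" "w b = i" using t1 by blast
    obtain c d where cd: "c < d" "w c = j + 1" "w d = j" using t2 by blast
    have lw: "ninv w = length is" using G len w1 by (simp add: G_def)
    have pi: "adj i \<circ> w permutes {1..n}"
      using w i by (blast intro: permutes_compose adj_permutes)
    have ni: "ninv w = Suc (ninv (adj i \<circ> w))" by (rule ninv_descent[OF i w ab])
    have nj: "ninv w = Suc (ninv (adj j \<circ> w))" by (rule ninv_descent[OF j w cd])
    show ?thesis
    proof (cases "j = i + 1")
      case False
      then have far: "i + 1 < j" using ij by simp
      \<comment> \<open>Exchanging the values \<open>i\<close> and \<open>i + 1\<close> leaves the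
        distant descent at \<open>j\<close> intact, so both letters can be stripped. A reduced word
        \<open>ms\<close> of the rest extends to the reduced words \<open>j # ms\<close> and
        \<open>i # ms\<close> of the two tails.\<close>
      define w0 where "w0 = adj j \<circ> (adj i \<circ> w)"
      have n2: "ninv (adj i \<circ> w) = Suc (ninv w0)" unfolding w0_def
        by (rule ninv_descent[OF j pi cd(1)]) (use far cd in \<open>auto simp: adj_apply\<close>)
      have p0: "w0 permutes {1..n}" unfolding w0_def by (intro permutes_compose[OF pi adj_permutes[OF j]])
      obtain ms where ms: "G ms" "word_perm ms = w0" using red[OF p0] by blast
      have com: "adj i \<circ> (adj j \<circ> u) = adj j \<circ> (adj i \<circ> u)" for u :: "nat \<Rightarrow> nat"
        using far by (auto simp: fun_eq_iff adj_apply)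
      have e1: "word_perm (j # ms) = adj i \<circ> w"
        by (simp only: word_perm_Cons ms w0_def adj_adj_comp)
      have e2: "word_perm (i # ms) = adj j \<circ> w"
        by (simp only: word_perm_Cons ms w0_def com adj_adj_comp)
      have g1: "G (j # ms)" using ms j n2 e1 by (simp add: G_def del: word_perm_Cons)
      have g2: "G (i # ms)" using ms i n2 ni nj e2 by (simp add: G_def del: word_perm_Cons)
      have "foldr h ks x = foldr h (j # ms) x"
        by (rule IH') (use t1 len g1 e1 in auto)
      moreover have "foldr h ls x = foldr h (i # ms) x"
        by (rule IH') (use t2 len g2 e2 in auto)
      ultimately show ?thesis
        using comm[OF i(1) far j(2) mem, of ms] ms(1) by (simp add: G_def)
    next
      case True
      \<comment> \<open>The value \<open>j = i + 1\<close> belongs to both descents, so the values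
        \<open>i + 2\<close>, \<open>i + 1\<close>, \<open>i\<close> stand at the positions
        \<open>c < a < b\<close>. Hence \<open>adj i\<close>, \<open>adj j\<close>,
        \<open>adj i\<close> can be stripped in turn, each lowering the length by one.\<close>
      have bc: "d = a" using permutes_eq_iff[OF w, of d a] ab cd True by auto
      define w1 where "w1 = adj j \<circ> (adj i \<circ> w)"
      define w0 where "w0 = adj i \<circ> w1"
      have n2: "ninv (adj i \<circ> w) = Suc (ninv w1)" unfolding w1_def
        by (rule ninv_descent[OF j pi, of c b]) (use ab cd bc True in \<open>auto simp: adj_apply\<close>)
      have p1: "w1 permutes {1..n}" unfolding w1_def by (intro permutes_compose[OF pi adj_permutes[OF j]])
      have n3: "ninv w1 = Suc (ninv w0)" unfolding w0_def
        by (rule ninv_descent[OF i p1, of c d]) (use ab cd bc True in \<open>auto simp: adj_apply w1_def\<close>)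
      have p0: "w0 permutes {1..n}" unfolding w0_def by (intro permutes_compose[OF p1 adj_permutes[OF i]])
      obtain ms where ms: "G ms" "word_perm ms = w0" using red[OF p0] by blast
      have br: "adj i \<circ> (adj j \<circ> (adj i \<circ> u)) = adj j \<circ> (adj i \<circ> (adj j \<circ> u))" for u :: "nat \<Rightarrow> nat"
        using True by (auto simp: fun_eq_iff adj_apply)
      have e0: "word_perm (i # ms) = w1"
        by (simp only: word_perm_Cons ms w0_def adj_adj_comp)
      have e1: "word_perm (j # i # ms) = adj i \<circ> w"
        by (subst word_perm_Cons, subst e0) (simp only: w1_def adj_adj_comp)
      have "w0 = adj j \<circ> (adj i \<circ> (adj j \<circ> w))" by (simp only: w0_def w1_def br)
      then have e2: "word_perm (i # j # ms) = adj j \<circ> w"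
        by (simp only: word_perm_Cons ms adj_adj_comp)
      have g1: "G (j # i # ms)" using ms i j n2 n3 e1 by (simp add: G_def del: word_perm_Cons)
      have g2: "G (i # j # ms)" using ms i j n2 n3 ni nj e2 by (simp add: G_def del: word_perm_Cons)
      have "foldr h ks x = foldr h (j # i # ms) x"
        by (rule IH') (use t1 len g1 e1 in auto)
      moreover have "foldr h ls x = foldr h (i # j # ms) x"
        by (rule IH') (use t2 len g2 e2 in auto)
      ultimately show ?thesis
        using braid[OF i(1) _ mem, of ms] ms(1) True j by (simp add: G_def)
    qed
  qed
  have G: "G is" "G js" using less by (auto simp: G_def)
  have len: "length js = length is" using less by simp
  show ?case
  proof (cases "is")
    case Nil then show ?thesis using len by simp
  next
    case (Cons i ks)
    then obtain j ls where js: "js = j # ls" using len by (cases js) auto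
    consider "i < j" | "i = j" | "j < i" by linarith
    then show ?thesis
    proof cases
      case 1 then show ?thesis using lt[of i j ks ls] G len less(4) Cons js by simp
    next
      case 3 then show ?thesis using lt[of j i ls ks] G len less(4) Cons js by simp
    next
      case 2
      have "foldr h ks x = foldr h ls x"
      proof (rule IH')
        show "length ks < length is" "G ks" "G ls"
          using tl[OF _ refl, of i ks] tl[OF _ refl, of j ls] G unfolding Cons js by blast+
        have "word_perm ks = adj i \<circ> word_perm is"
          using tl[OF _ refl, of i ks] G(1) unfolding Cons by blast
        also have "\<dots> = word_perm ls"
          using tl[OF _ refl, of j ls] G(2) unfolding less(4) 2 js by metis
        finally show "word_perm ks = word_perm ls" .
      qed
      then show ?thesis using 2 Cons js by simp
    qed
  qed
qed

section \<open>Block permutations and shuffles\<close>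

lemma permutes_inverse_intro:
  assumes "p \<circ> q = id" "q \<circ> p = id" "\<And>x. x \<notin> S \<Longrightarrow> p x = x" "\<And>x. x \<notin> S \<Longrightarrow> q x = x"
  shows "p permutes S"
proof -
  have pq: "p (q x) = x" "q (p x) = x" for x
    using assms(1,2) by (auto simp: fun_eq_iff)
  have "\<exists>!x. p x = y" for y
    by (rule ex1I[of _ "q y"]) (use pq in auto)
  then show ?thesis using assms(3) by (simp add: permutes_def)
qed

text \<open>The embedding of the symmetric group on \<open>n\<close> letters that acts on the last
  \<open>n\<close> of \<open>m + n\<close> letters; its lift is the identity tensored with the lift
  of \<open>v\<close>, see \<open>T_right\<close>.\<close>

definition shift :: "nat \<Rightarrow> (nat \<Rightarrow> nat) \<Rightarrow> nat \<Rightarrow> nat" where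
  "shift m v k = (if k \<le> m then k else m + v (k - m))"

text \<open>\<open>shift m u\<close> compares its argument with \<open>m\<close>. As
  \<open>v\<close> sends no positive number to 0, points above \<open>m\<close> stay on the branch
  where \<open>u\<close> is applied.\<close>

lemma shift_comp:
  assumes "v permutes {1..n}"
  shows "shift m (u \<circ> v) = shift m u \<circ> shift m v"
proof
  fix k
  have "v (k - m) \<noteq> 0" if "m < k" using permutes_bounds(5)[OF assms, of "k - m"] that by simp
  then show "shift m (u \<circ> v) k = (shift m u \<circ> shift m v) k" by (auto simp: shift_def)
qed

lemma shift_id: "shift m id = id"
  by (auto simp: shift_def fun_eq_iff)

lemma shift_permutes:
  assumes v: "v permutes {1..n}" shows "shift m v permutes {m + 1..m + n}"
proof (rule permutes_inverse_intro[where q = "shift m (inv v)"])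
  note iv = permutes_inv[OF v]
  show "shift m v \<circ> shift m (inv v) = id" "shift m (inv v) \<circ> shift m v = id"
    using shift_comp[OF iv, of m v] shift_comp[OF v, of m "inv v"]
    by (simp_all only: permutes_inv_o[OF v] shift_id)
  show "shift m v x = x" "shift m (inv v) x = x" if "x \<notin> {m + 1..m + n}" for x
    using that permutes_bounds(2)[OF v, of "x - m"] permutes_bounds(2)[OF iv, of "x - m"]
    by (auto simp: shift_def)
qed

lemma shift_permutes_all: "v permutes {1..n} \<Longrightarrow> shift m v permutes {1..m + n}"
  by (rule permutes_subset[OF shift_permutes]) auto

lemma shift_adj: "1 \<le> i \<Longrightarrow> shift m (adj i) = adj (m + i)"
  by (auto simp: fun_eq_iff shift_def adj_apply)

lemma word_perm_shift:
  "set is \<subseteq> {1..<n} \<Longrightarrow> word_perm (map ((+) m) is) = shift m (word_perm is)"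
proof (induction "is")
  case Nil show ?case by (simp only: list.map word_perm_Nil shift_id)
next
  case (Cons i "is")
  then have "shift m (word_perm (i # is)) = adj (m + i) \<circ> shift m (word_perm is)"
    unfolding word_perm_Cons by (subst shift_comp[OF word_perm_permutes]) (auto simp: shift_adj)
  with Cons show ?case by (simp del: comp_apply)
qed

lemma ninv_shift:
  assumes v: "v permutes {1..n}" shows "ninv (shift m v) = ninv v"
proof -
  have "bij_betw (map_prod ((+) m) ((+) m)) (inversions v) (inversions (shift m v))"
  proof (rule bij_betw_imageI)
    show "inj_on (map_prod ((+) m) ((+) m)) (inversions v)" by (auto simp: inj_on_def)
    show "map_prod ((+) m) ((+) m) ` inversions v = inversions (shift m v)"
    proof (intro set_eqI iffI)
      fix x assume "x \<in> map_prod ((+) m) ((+) m) ` inversions v"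
      then obtain a b where ab: "(a, b) \<in> inversions v" "x = (m + a, m + b)" by auto
      then show "x \<in> inversions (shift m v)"
        using inversions_bounds[OF v ab(1)] by (auto simp: inversions_def shift_def)
    next
      fix x assume x: "x \<in> inversions (shift m v)"
      obtain a b where ab: "x = (a, b)" by (cases x)
      have lt: "a < b" "shift m v b < shift m v a" using x ab by (auto simp: inversions_def)
      have "m < a"
      proof (rule ccontr)
        assume "\<not> m < a"
        then show False using lt by (cases "b \<le> m") (simp_all add: shift_def)
      qed
      with lt have "m < a" "m < b" by auto
      then have "(a - m, b - m) \<in> inversions v" "x = map_prod ((+) m) ((+) m) (a - m, b - m)"
        using x ab by (auto simp: inversions_def shift_def)
      then show "x \<in> map_prod ((+) m) ((+) m) ` inversions v" by (rule rev_image_eqI)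
    qed
  qed
  then show ?thesis by (simp add: ninv_def bij_betw_same_card)
qed

section \<open>Block transpositions and length-additive products\<close>

lemma chi_comp_chi: "chi j i \<circ> chi i j = id"
  by (auto simp: chi_def fun_eq_iff)

lemma chi_permutes: "chi i j permutes {1..i + j}"
  by (rule permutes_inverse_intro[OF chi_comp_chi chi_comp_chi]) (auto simp: chi_def)

lemma inv_chi: "inv (chi i j) = chi j i"
  by (rule inv_unique_comp[OF chi_comp_chi chi_comp_chi])

lemma chi_0: "chi 0 j = id" "chi i 0 = id"
  by (auto simp: chi_def fun_eq_iff)

text \<open>Read from the right: the third block passes the second, then the first.\<close>

lemma chi_add_left: "chi (i + j) k = chi i k \<circ> shift i (chi j k)"
  by (auto simp: chi_def fun_eq_iff shift_def)

text \<open>Read from the right: the first block passes the second, then the third.\<close>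

lemma chi_add_right: "chi i (j + k) = shift j (chi i k) \<circ> chi i j"
  by (auto simp: chi_def fun_eq_iff shift_def)

lemma chi_comp_left:
  assumes v: "v permutes {1..m}" shows "chi m k \<circ> v = shift k v \<circ> chi m k"
proof
  fix x
  show "(chi m k \<circ> v) x = (shift k v \<circ> chi m k) x"
    using permutes_bounds(1,2,4,5)[OF v, of x] permutes_bounds(2)[OF v, of "x - k"]
    by (auto simp: chi_def shift_def)
qed

lemma chi_comp_right:
  assumes v: "v permutes {1..k}" shows "chi i k \<circ> shift i v = v \<circ> chi i k"
proof
  fix x
  show "(chi i k \<circ> shift i v) x = (v \<circ> chi i k) x"
    using permutes_bounds(1,2,4,5)[OF v, of "x - i"] permutes_bounds(2)[OF v, of x]
      permutes_bounds(2)[OF v, of "k + x"] permutes_bounds(3)[OF v]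
    by (cases "x = 0") (auto simp: chi_def shift_def)
qed

lemma compatible_iff_inversions:
  "compatible u v \<longleftrightarrow> (\<forall>(a, b) \<in> inversions v. u (v b) < u (v a))"
  by (auto simp: compatible_def inversions_def)

text \<open>The values of an inverted pair of \<open>v\<close> lie in {1..n}, where \<open>u\<close>
  keeps their order.\<close>

lemma compatible_if_mono:
  assumes v: "v permutes {1..n}" and "strict_mono_on {1..n} u"
  shows "compatible u v"
  unfolding compatible_iff_inversions
proof (safe)
  fix a b assume ab: "(a, b) \<in> inversions v"
  then have "v b < v a" "v b \<in> {1..n}" "v a \<in> {1..n}"
    using inversions_bounds[OF v ab] permutes_in_image[OF v, of a] permutes_in_image[OF v, of b]
    by (auto simp: inversions_def)
  then show "u (v b) < u (v a)" using assms(2) by (auto simp: strict_mono_on_def)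
qed

lemma compatible_shift_if_mono:
  assumes v: "v permutes {1..n}" and "strict_mono_on {m + 1..m + n} u"
  shows "compatible u (shift m v)"
  unfolding compatible_def
proof (intro allI impI)
  fix a b assume ab: "a < b" "shift m v b < shift m v a"
  have *: "shift m v c = c" if "c \<notin> {m + 1..m + n}" for c
    using permutes_not_in[OF shift_permutes[OF v] that] .
  have **: "shift m v c \<in> {m + 1..m + n} \<longleftrightarrow> c \<in> {m + 1..m + n}" for c
    by (rule permutes_in_image[OF shift_permutes[OF v]])
  \<comment> \<open>A point outside the block is fixed, and the block is an interval mapped to
    itself, so such a point takes part in no inversion.\<close>
  have "a \<in> {m + 1..m + n} \<and> b \<in> {m + 1..m + n}"
    using ab *[of a] *[of b] **[of a] **[of b] by fastforce
  then show "u (shift m v b) < u (shift m v a)"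
    using assms(2) ab ** by (auto simp: strict_mono_on_def)
qed

lemma chi_strict_mono: "strict_mono_on {1..i} (chi i k)" "strict_mono_on {i + 1..i + k} (chi i k)"
  by (auto simp: strict_mono_on_def chi_def)

text \<open>An inversion of \<open>chi i k\<close> has one value at most \<open>k\<close> and one
  above \<open>k\<close>, and \<open>v\<close> preserves both ranges.\<close>

lemma compatible_left_chi:
  assumes v: "v permutes {1..k}" shows "compatible v (chi i k)"
  unfolding compatible_def
proof (intro allI impI)
  fix a b assume "a < b" "chi i k b < chi i k a"
  then have "chi i k b \<le> k" "k < chi i k a" by (auto simp: chi_def split: if_splits)
  then show "v (chi i k b) < v (chi i k a)"
    using permutes_bounds(2,4)[OF v] by (metis le_less_trans)
qed

lemma compatible_shift_chi:
  assumes v: "v permutes {1..m}" shows "compatible (shift k v) (chi m k)"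
  unfolding compatible_def
proof (intro allI impI)
  fix a b assume "a < b" "chi m k b < chi m k a"
  then have "chi m k b \<le> k" "k < chi m k a" by (auto simp: chi_def split: if_splits)
  then show "shift k v (chi m k b) < shift k v (chi m k a)"
    using permutes_bounds(5)[OF v, of "chi m k a - k"] by (auto simp: shift_def)
qed

lemma compatible_chi_add_left: "compatible (chi i k) (shift i (chi j k))"
  by (rule compatible_shift_if_mono[OF chi_permutes]) (auto simp: strict_mono_on_def chi_def)

lemma compatible_chi_add_right: "compatible (shift j (chi i k)) (chi i j)"
  by (rule compatible_if_mono[OF chi_permutes]) (auto simp: strict_mono_on_def chi_def shift_def)

section \<open>Minimal coset representatives of parabolic subgroups\<close>

lemma strict_mono_on_less_cong:
  fixes w :: "'a::linorder \<Rightarrow> 'b::linorder"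
  assumes "strict_mono_on S w" "x \<in> S" "y \<in> S"
  shows "w x < w y \<longleftrightarrow> x < y"
  using assms by (metis linorder_neqE order_less_asym strict_mono_onD)

text \<open>The first factors are the minimal coset representatives for the parabolic subgroup of \<open>S\<close>: the
  representative of \<open>u\<close> takes the values of \<open>u\<close> on \<open>S\<close> in increasing order.\<close>

lemma parabolic_bij_betw:
  fixes N S :: "nat set"
  assumes fin: "finite N" and SN: "S \<subseteq> N"
  shows "bij_betw (\<lambda>(w, v). w \<circ> v)
    ({w. w permutes N \<and> strict_mono_on S w} \<times> {v. v permutes S}) {u. u permutes N}"
proof (rule bij_betw_imageI)
  have finS: "finite S" by (rule finite_subset[OF SN fin])
  show "inj_on (\<lambda>(w, v). w \<circ> v) ({w. w permutes N \<and> strict_mono_on S w} \<times> {v. v permutes S})"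
  proof (rule inj_onI, safe)
    fix w v w' v' :: "nat \<Rightarrow> nat"
    assume w: "w permutes N" "strict_mono_on S w" and w': "w' permutes N" "strict_mono_on S w'"
      and v: "v permutes S" and v': "v' permutes S" and eq: "w \<circ> v = w' \<circ> v'"
    \<comment> \<open>Two factorizations differ by a permutation \<open>p\<close> of
      \<open>S\<close>. As \<open>w\<close> and \<open>w'\<close> both increase on \<open>S\<close>,
      so does \<open>p\<close>, which forces \<open>p = id\<close>.\<close>
    define p where "p = v' \<circ> inv v"
    have p: "p permutes S" unfolding p_def by (intro permutes_compose[OF permutes_inv[OF v] v'])
    have wp: "w = w' \<circ> p"
      unfolding p_def o_assoc eq[symmetric] by (simp only: o_assoc[symmetric] permutes_inv_o[OF v] o_id)
    have "strict_mono_on S p"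
    proof (rule strict_mono_onI)
      fix r t assume rt: "r \<in> S" "t \<in> S" "r < t"
      have "w' (p r) < w' (p t)" using strict_mono_onD[OF w(2) rt] by (simp add: wp)
      then show "p r < p t"
        using strict_mono_on_less_cong[OF w'(2), of "p r" "p t"] rt permutes_in_image[OF p] by simp
    qed
    then have pid: "p = id" by (rule strict_mono_permutes_id[OF finS p])
    show "w = w'" using wp pid by simp
    have "v' = p \<circ> v" unfolding p_def o_assoc[symmetric] permutes_inv_o[OF v] by simp
    then show "v = v'" using pid by simp
  qed
  show "(\<lambda>(w, v). w \<circ> v) ` ({w. w permutes N \<and> strict_mono_on S w} \<times> {v. v permutes S})
    = {u. u permutes N}"
  proof (intro set_eqI iffI)
    fix u assume "u \<in> (\<lambda>(w, v). w \<circ> v) ` ({w. w permutes N \<and> strict_mono_on S w} \<times> {v. v permutes S})"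
    then obtain w v where "w permutes N" "v permutes S" "u = w \<circ> v" by auto
    then show "u \<in> {u. u permutes N}" using permutes_compose[OF permutes_subset[OF _ SN]] by simp
  next
    fix u assume "u \<in> {u. u permutes N}"
    then have u: "u permutes N" by simp
    have injS: "inj_on u S" using permutes_inj_on[OF u] by blast
    obtain h where h: "bij_betw h {..<card S} S" "strict_mono_on {..<card S} h"
      using ex_bij_betw_strict_mono_card[OF finS] by blast
    obtain g where g: "bij_betw g {..<card S} (u ` S)" "strict_mono_on {..<card S} g"
      using ex_bij_betw_strict_mono_card[of "u ` S"] finS card_image[OF injS] by auto
    \<comment> \<open>\<open>q\<close> sends the t-th element of \<open>S\<close> to the point at
      which \<open>u\<close> takes its t-th smallest value on \<open>S\<close>, so
      \<open>u \<circ> q\<close> increases on \<open>S\<close>.\<close>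
    define q where "q x = (if x \<in> S then inv u (g (inv_into {..<card S} h x)) else x)" for x
    have "bij_betw (\<lambda>x. inv u (g (inv_into {..<card S} h x))) S S"
    proof -
      have 1: "bij_betw (inv_into {..<card S} h) S {..<card S}" by (rule bij_betw_inv_into[OF h(1)])
      have "inv u ` u ` S = S" using permutes_inverses(2)[OF u] by (simp add: image_image)
      then have 3: "bij_betw (inv u) (u ` S) S"
        using permutes_inj_on[OF permutes_inv[OF u], of "u ` S"] by (simp add: bij_betw_def)
      have "bij_betw (inv u \<circ> (g \<circ> inv_into {..<card S} h)) S S"
        by (rule bij_betw_trans[OF bij_betw_trans[OF 1 g(1)] 3])
      then show ?thesis by (simp add: o_def)
    qed
    then have "bij_betw q S S" by (rule bij_betw_cong[THEN iffD1, rotated]) (simp add: q_def)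
    then have q: "q permutes S" by (rule bij_imp_permutes) (simp add: q_def)
    have qN: "q permutes N" by (rule permutes_subset[OF q SN])
    have uq: "u (q (h t)) = g t" if t: "t \<in> {..<card S}" for t
    proof -
      have "h t \<in> S" "inv_into {..<card S} h (h t) = t"
        using t h(1) by (auto simp: bij_betw_def)
      then show ?thesis by (simp add: q_def permutes_inverses(1)[OF u])
    qed
    have "strict_mono_on S (u \<circ> q)"
    proof (rule strict_mono_onI)
      fix x y assume xy: "x \<in> S" "y \<in> S" "x < y"
      obtain a b where ab: "a \<in> {..<card S}" "b \<in> {..<card S}" "x = h a" "y = h b"
        using xy h(1) unfolding bij_betw_def by blast
      then have "a < b" using xy strict_mono_on_less_cong[OF h(2)] by simp
      then show "(u \<circ> q) x < (u \<circ> q) y"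
        using strict_mono_onD[OF g(2) ab(1,2)] uq ab by simp
    qed
    moreover have "u \<circ> q permutes N" by (rule permutes_compose[OF qN u])
    moreover have "u = (u \<circ> q) \<circ> inv q"
      by (simp only: o_assoc[symmetric] permutes_inv_o[OF q] o_id)
    ultimately show "u \<in> (\<lambda>(w, v). w \<circ> v) ` ({w. w permutes N \<and> strict_mono_on S w} \<times> {v. v permutes S})"
      using permutes_inv[OF q] by (intro rev_image_eqI[of "(u \<circ> q, inv q)"]) auto
  qed
qed

text \<open>Since \<open>w\<close> increases on \<open>S\<close>, monotonicity of
  \<open>w \<circ> v\<close> inside \<open>S\<close> depends on \<open>v\<close> alone; on
  \<open>B\<close>, which misses \<open>S\<close>, the factor \<open>v\<close> is the identity, so
  monotonicity there depends on \<open>w\<close> alone. The bijection thus restricts to these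
  conditions.\<close>

lemma parabolic_block_bij_betw:
  fixes N S :: "nat set"
  assumes fin: "finite N" and SN: "S \<subseteq> N" and S12: "S1 \<subseteq> S" "S2 \<subseteq> S" and B: "B \<inter> S = {}"
  shows "bij_betw (\<lambda>(w, v). w \<circ> v)
    ({w. w permutes N \<and> strict_mono_on S w \<and> strict_mono_on B w} \<times>
      {v. v permutes S \<and> strict_mono_on S1 v \<and> strict_mono_on S2 v})
    {u. u permutes N \<and> strict_mono_on S1 u \<and> strict_mono_on S2 u \<and> strict_mono_on B u}"
    (is "bij_betw ?f (?W \<times> ?V) ?U")
proof -
  note bij = parabolic_bij_betw[OF fin SN]
  have iff: "w \<circ> v \<in> ?U \<longleftrightarrow> w \<in> ?W \<and> v \<in> ?V"
    if w: "w permutes N" "strict_mono_on S w" and v: "v permutes S" for w v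
  proof -
    have p: "w \<circ> v permutes N" by (rule permutes_compose[OF permutes_subset[OF v SN] w(1)])
    have sub: "strict_mono_on T (w \<circ> v) \<longleftrightarrow> strict_mono_on T v" if "T \<subseteq> S" for T
    proof -
      have "w (v x) < w (v y) \<longleftrightarrow> v x < v y" if "x \<in> T" "y \<in> T" for x y
        using strict_mono_on_less_cong[OF w(2), of "v x" "v y"] that \<open>T \<subseteq> S\<close> permutes_in_image[OF v] by blast
      then show ?thesis by (auto simp: strict_mono_on_def)
    qed
    have "v x = x" if "x \<in> B" for x using permutes_not_in[OF v, of x] that B by blast
    then have "strict_mono_on B (w \<circ> v) \<longleftrightarrow> strict_mono_on B w" by (auto simp: strict_mono_on_def)
    then show ?thesis using w v p sub[OF S12(1)] sub[OF S12(2)] by auto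
  qed
  have "?f ` (?W \<times> ?V) = ?U"
  proof (intro set_eqI iffI)
    fix u assume "u \<in> ?f ` (?W \<times> ?V)"
    then obtain w v where wv: "w \<in> ?W" "v \<in> ?V" "u = w \<circ> v" by auto
    then show "u \<in> ?U" using iff[of w v] by blast
  next
    fix u assume u: "u \<in> ?U"
    then have "u \<in> ?f ` ({w. w permutes N \<and> strict_mono_on S w} \<times> {v. v permutes S})"
      using bij by (auto simp: bij_betw_def)
    then obtain w v where wv: "w permutes N" "strict_mono_on S w" "v permutes S" "u = w \<circ> v" by auto
    then have "w \<in> ?W \<and> v \<in> ?V" using iff[of w v] u by blast
    then show "u \<in> ?f ` (?W \<times> ?V)" using wv(4) by (intro rev_image_eqI[of "(w, v)"]) auto
  qed
  then show ?thesis by (rule bij_betw_subset[OF bij, rotated]) auto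
qed

section \<open>Shuffles of three blocks\<close>

definition shuffles3_perm :: "nat \<Rightarrow> nat \<Rightarrow> nat \<Rightarrow> (nat \<Rightarrow> nat) set" where
  "shuffles3_perm i j k = {u. u permutes {1..i + j + k} \<and> strict_mono_on {1..i} u \<and>
     strict_mono_on {i + 1..i + j} u \<and> strict_mono_on {i + j + 1..i + j + k} u}"

lemma shuffles3_bij_left:
  "bij_betw (\<lambda>(w, v). w \<circ> v) (shuffles_perm (i + j) k \<times> shuffles_perm i j) (shuffles3_perm i j k)"
  using parabolic_block_bij_betw[of "{1..i + j + k}" "{1..i + j}" "{1..i}" "{i + 1..i + j}"
      "{i + j + 1..i + j + k}"]
  unfolding shuffles_perm_def shuffles3_perm_def by fastforce

lemma shift_bij_betw:
  "bij_betw (shift i) (shuffles_perm j k) {v. v permutes {i + 1..i + j + k} \<and>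
    strict_mono_on {i + 1..i + j} v \<and> strict_mono_on {i + j + 1..i + j + k} v}"
proof (rule bij_betw_imageI)
  show "inj_on (shift i) (shuffles_perm j k)"
  proof (rule inj_onI)
    fix u v assume uv: "u \<in> shuffles_perm j k" "v \<in> shuffles_perm j k" "shift i u = shift i v"
    have "u x = v x" for x
    proof (cases "x = 0")
      case True then show ?thesis using uv permutes_bounds(3)[of u "j + k"] permutes_bounds(3)[of v "j + k"] by (simp add: shuffles_perm_def)
    next
      case False then show ?thesis using fun_cong[OF uv(3), of "i + x"] by (simp add: shift_def)
    qed
    then show "u = v" by blast
  qed
  have mono: "strict_mono_on {i + a..i + b} (shift i v) \<longleftrightarrow> strict_mono_on {a..b} v" if "1 \<le> a" for a b v
  proof
    assume m: "strict_mono_on {i + a..i + b} (shift i v)"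
    show "strict_mono_on {a..b} v"
    proof (rule strict_mono_onI)
      fix x y assume "x \<in> {a..b}" "y \<in> {a..b}" "x < y"
      then show "v x < v y" using strict_mono_onD[OF m, of "i + x" "i + y"] that by (auto simp: shift_def)
    qed
  next
    assume m: "strict_mono_on {a..b} v"
    show "strict_mono_on {i + a..i + b} (shift i v)"
    proof (rule strict_mono_onI)
      fix x y assume "x \<in> {i + a..i + b}" "y \<in> {i + a..i + b}" "x < y"
      moreover from this have "x - i \<in> {a..b}" "y - i \<in> {a..b}" "x - i < y - i" using that by auto
      ultimately show "shift i v x < shift i v y"
        using strict_mono_onD[OF m, of "x - i" "y - i"] that by (auto simp: shift_def)
    qed
  qed
  have mono': "strict_mono_on {i + 1..i + j} (shift i v) \<longleftrightarrow> strict_mono_on {1..j} v"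
    "strict_mono_on {i + j + 1..i + j + k} (shift i v) \<longleftrightarrow> strict_mono_on {j + 1..j + k} v" for v
    using mono[of 1 j] mono[of "j + 1" "j + k"] by (simp_all add: add.assoc)
  show "shift i ` shuffles_perm j k = {v. v permutes {i + 1..i + j + k} \<and>
    strict_mono_on {i + 1..i + j} v \<and> strict_mono_on {i + j + 1..i + j + k} v}" (is "_ = ?V")
  proof (intro set_eqI iffI)
    fix p assume "p \<in> shift i ` shuffles_perm j k"
    then obtain v where v: "v \<in> shuffles_perm j k" "p = shift i v" by blast
    have "shift i v permutes {i + 1..i + (j + k)}"
      using v(1) by (intro shift_permutes) (simp add: shuffles_perm_def)
    then show "p \<in> ?V"
      using v mono'[of v] by (simp add: shuffles_perm_def add.assoc)
  next
    fix p assume p: "p \<in> ?V"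
    \<comment> \<open>Translation back by \<open>i\<close>. Truncated subtraction loses nothing: by
      \<open>nz\<close>, points above \<open>i\<close> have values above \<open>i\<close>.\<close>
    define un where "un q x = (if x = 0 then 0 else q (i + x) - i)" for q :: "nat \<Rightarrow> nat" and x :: nat
    have pp: "p permutes {i + 1..i + j + k}" using p by simp
    have sh: "shift i (un q) = q" if q: "q permutes {i + 1..i + j + k}" for q
    proof
      fix x
      show "shift i (un q) x = q x"
        using permutes_not_in[OF q, of x] permutes_in_image[OF q, of x]
        by (cases "x \<in> {i + 1..i + j + k}") (auto simp: shift_def un_def)
    qed
    have nz: "i < q (i + x)" if "q permutes {i + 1..i + j + k}" "0 < x" for q x
      using that(2) permutes_not_in[OF that(1), of "i + x"] permutes_in_image[OF that(1), of "i + x"]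
      by (cases "i + x \<in> {i + 1..i + j + k}") auto
    have inv: "un q \<circ> un q' = id"
      if q: "q permutes {i + 1..i + j + k}" "q' permutes {i + 1..i + j + k}" "q \<circ> q' = id" for q q'
    proof
      fix x
      have "q (q' (i + x)) = i + x" using fun_cong[OF q(3), of "i + x"] by simp
      then show "(un q \<circ> un q') x = id x" using nz[OF q(2), of x] by (auto simp: un_def)
    qed
    note ip = permutes_inv[OF pp]
    have "un p permutes {1..j + k}"
    proof (rule permutes_inverse_intro[of _ "un (inv p)"])
      show "un p \<circ> un (inv p) = id" "un (inv p) \<circ> un p = id"
        using inv[OF pp ip] inv[OF ip pp] permutes_inv_o[OF pp] by auto
      show "un p x = x" "un (inv p) x = x" if "x \<notin> {1..j + k}" for x
        using that permutes_not_in[OF pp, of "i + x"] permutes_not_in[OF ip, of "i + x"]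
        by (auto simp: un_def)
    qed
    then have "un p \<in> shuffles_perm j k"
      using p mono'[of "un p"] by (simp add: shuffles_perm_def sh[OF pp])
    then show "p \<in> shift i ` shuffles_perm j k" by (rule rev_image_eqI) (simp add: sh[OF pp])
  qed
qed

lemma shuffles3_bij_right:
  "bij_betw (\<lambda>(w, v). w \<circ> shift i v) (shuffles_perm i (j + k) \<times> shuffles_perm j k) (shuffles3_perm i j k)"
proof -
  have 1: "bij_betw (map_prod id (shift i)) (shuffles_perm i (j + k) \<times> shuffles_perm j k)
    (shuffles_perm i (j + k) \<times> {v. v permutes {i + 1..i + j + k} \<and>
    strict_mono_on {i + 1..i + j} v \<and> strict_mono_on {i + j + 1..i + j + k} v})"
    by (rule bij_betw_map_prod[OF bij_betw_id shift_bij_betw])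
  have s: "shuffles_perm i (j + k) = {w. w permutes {1..i + j + k} \<and>
      strict_mono_on {i + 1..i + j + k} w \<and> strict_mono_on {1..i} w}"
    by (auto simp: shuffles_perm_def add.assoc)
  have t: "shuffles3_perm i j k = {u. u permutes {1..i + j + k} \<and> strict_mono_on {i + 1..i + j} u \<and>
      strict_mono_on {i + j + 1..i + j + k} u \<and> strict_mono_on {1..i} u}"
    by (auto simp: shuffles3_perm_def)
  have 2: "bij_betw (\<lambda>(w, v). w \<circ> v)
    (shuffles_perm i (j + k) \<times> {v. v permutes {i + 1..i + j + k} \<and>
    strict_mono_on {i + 1..i + j} v \<and> strict_mono_on {i + j + 1..i + j + k} v}) (shuffles3_perm i j k)"
    unfolding s t by (rule parabolic_block_bij_betw) auto
  show ?thesis using bij_betw_trans[OF 1 2] by (simp add: o_def case_prod_unfold)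
qed

section \<open>Linear operators on tensor powers\<close>

text \<open>As rewrite rules, these are eta-contracted and unfold every sum of functions.\<close>

declare plus_fun_apply [simp del] zero_fun_apply [simp del]

abbreviation flin :: "(('x \<Rightarrow> 'k::field) \<Rightarrow> ('y \<Rightarrow> 'k)) \<Rightarrow> bool" where
  "flin \<equiv> Vector_Spaces.linear fscale fscale"

lemma flinI:
  assumes "\<And>x y. f (x + y) = f x + f y" "\<And>c x. f (fscale c x) = fscale c (f x)"
  shows "flin f"
  unfolding Vector_Spaces.linear_iff by (intro conjI allI vector_space_fscale assms)

lemma flinD:
  assumes "flin f"
  shows "f (x + y) = f x + f y" "f (fscale c x) = fscale c (f x)"
  using assms unfolding Vector_Spaces.linear_iff by blast+

lemma fscale_simps:
  "fscale c (x + y) = fscale c x + fscale c y" "fscale c 0 = 0" "fscale 0 x = 0"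
  "fscale c (fscale d x) = fscale (c * d) x"
  by (auto simp: fscale_def fun_eq_iff algebra_simps plus_fun_apply zero_fun_apply)

lemma flin_0: "flin f \<Longrightarrow> f 0 = 0"
  using flinD(2)[of f 0 0] by (simp add: fscale_simps)

lemma flin_sum: "flin f \<Longrightarrow> f (sum g I) = (\<Sum>i\<in>I. f (g i))"
  by (induction I rule: infinite_finite_induct) (simp_all add: flin_0 flinD)

lemma flin_id: "flin (\<lambda>x. x)" by (rule flinI) auto
lemma flin_zero: "flin (\<lambda>x. 0)" by (rule flinI) (auto simp: fscale_simps)
lemma flin_comp: "flin f \<Longrightarrow> flin g \<Longrightarrow> flin (\<lambda>x. f (g x))"
  by (rule flinI) (simp_all add: flinD)
lemma flin_plus: "flin f \<Longrightarrow> flin g \<Longrightarrow> flin (\<lambda>x. f x + g x)"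
  by (rule flinI) (simp_all add: flinD fscale_simps add_ac)
lemma flin_scale: "flin f \<Longrightarrow> flin (\<lambda>x. fscale c (f x))"
  by (rule flinI) (simp_all add: flinD fscale_simps mult.commute)
lemma flin_sum_fun: "(\<And>i. i \<in> I \<Longrightarrow> flin (f i)) \<Longrightarrow> flin (\<lambda>x. \<Sum>i\<in>I. f i x)"
proof (induction I rule: infinite_finite_induct)
  case (insert i I)
  then have "flin (\<lambda>x. f i x + (\<Sum>i\<in>I. f i x))" by (intro flin_plus) auto
  with insert show ?case by simp
qed (simp_all add: flin_zero)

lemma multilinear_fscale_iff:
  fixes F :: "'v::ab_group_add list \<Rightarrow> ('x \<Rightarrow> 'k::field)"
  assumes "vector_space s"
  shows "multilinear s fscale F \<longleftrightarrow>
    (\<forall>xs ys x y. F (xs @ (x + y) # ys) = F (xs @ x # ys) + F (xs @ y # ys)) \<and>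
    (\<forall>xs ys c x. F (xs @ s c x # ys) = fscale c (F (xs @ x # ys)))"
  using assms vector_space_fscale by (auto simp: multilinear_def Vector_Spaces.linear_iff)

lemma pure_multilinear: "vector_space s \<Longrightarrow> multilinear s fscale (pure s)"
  by (auto simp: multilinear_fscale_iff pure_def fun_eq_iff fscale_def plus_fun_apply)
    (auto simp: multilinear_def Vector_Spaces.linear_iff)

lemma pure_add: "vector_space s \<Longrightarrow>
    pure s (xs @ (x + y) # ys) = pure s (xs @ x # ys) + pure s (xs @ y # ys)"
  and pure_scale: "vector_space s \<Longrightarrow> pure s (xs @ s c x # ys) = fscale c (pure s (xs @ x # ys))"
  using pure_multilinear multilinear_fscale_iff by blast+

lemma pure_add_short:
  assumes "vector_space s"
  shows "pure s [x + y] = pure s [x] + pure s [y]"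
    "pure s [x + y, b] = pure s [x, b] + pure s [y, b]"
    "pure s [a, x + y] = pure s [a, x] + pure s [a, y]"
    "pure s [x + y, b, c] = pure s [x, b, c] + pure s [y, b, c]"
    "pure s [a, x + y, c] = pure s [a, x, c] + pure s [a, y, c]"
    "pure s [a, b, x + y] = pure s [a, b, x] + pure s [a, b, y]"
  using pure_add[OF assms, of "[]" x y "[]"] pure_add[OF assms, of "[]" x y "[b]"]
    pure_add[OF assms, of "[a]" x y "[]"] pure_add[OF assms, of "[]" x y "[b, c]"]
    pure_add[OF assms, of "[a]" x y "[c]"] pure_add[OF assms, of "[a, b]" x y "[]"]
  by simp_all

lemma pure_scale_short:
  assumes "vector_space s"
  shows "pure s [s k x] = fscale k (pure s [x])"
    "pure s [s k x, b] = fscale k (pure s [x, b])"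
    "pure s [a, s k x] = fscale k (pure s [a, x])"
    "pure s [s k x, b, c] = fscale k (pure s [x, b, c])"
    "pure s [a, s k x, c] = fscale k (pure s [a, x, c])"
    "pure s [a, b, s k x] = fscale k (pure s [a, b, x])"
  using pure_scale[OF assms, of "[]" k x "[]"] pure_scale[OF assms, of "[]" k x "[b]"]
    pure_scale[OF assms, of "[a]" k x "[]"] pure_scale[OF assms, of "[]" k x "[b, c]"]
    pure_scale[OF assms, of "[a]" k x "[c]"] pure_scale[OF assms, of "[a, b]" k x "[]"]
  by simp_all

lemma module_fscale: "module (fscale :: 'k::field \<Rightarrow> ('x \<Rightarrow> 'k) \<Rightarrow> _)"
  using vector_space_fscale[where 'k = 'k and 'x = 'x]
  by (simp add: module_iff_vector_space)

lemmas fspan_base = module.span_base[OF module_fscale]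
lemmas fspan_mono = module.span_mono[OF module_fscale]
lemmas fsubspace_span = module.subspace_span[OF module_fscale]
lemmas fsubspace_add = module.subspace_add[OF module_fscale]
lemmas fsubspace_scale = module.subspace_scale[OF module_fscale]
lemmas fsubspace_sum = module.subspace_sum[OF module_fscale]

lemma linear_on_span_eq:
  fixes f g :: "('x \<Rightarrow> 'k::field) \<Rightarrow> ('y \<Rightarrow> 'k)"
  assumes f: "linear_on fscale fscale (module.span fscale S) f"
    and g: "linear_on fscale fscale (module.span fscale S) g"
    and eq: "\<And>x. x \<in> S \<Longrightarrow> f x = g x" and X: "X \<in> module.span fscale S"
  shows "f X = g X"
proof -
  interpret module "fscale :: 'k \<Rightarrow> ('x \<Rightarrow> 'k) \<Rightarrow> _" by (rule module_fscale)
  have z: "h 0 = 0" if h: "linear_on fscale fscale (span S) h" for h :: "('x \<Rightarrow> 'k) \<Rightarrow> ('y \<Rightarrow> 'k)"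
  proof -
    have "h (fscale 0 0) = fscale 0 (h 0)" using h span_zero unfolding linear_on_def by blast
    then show ?thesis by (simp only: fscale_simps)
  qed
  from X have "X \<in> span S \<and> f X = g X"
  proof (induction rule: span_induct_alt)
    case base then show ?case using z[OF f] z[OF g] span_zero by simp
  next
    case (step c x y)
    have x: "x \<in> span S" "fscale c x \<in> span S" using step(1) by (auto intro: span_base span_scale)
    have "f (fscale c x + y) = g (fscale c x + y)"
      using f g x step eq[OF step(1)] unfolding linear_on_def by simp
    then show ?case using x step by (auto intro: span_add)
  qed
  then show ?thesis by simp
qed

lemma flin_imp_linear_on: "flin f \<Longrightarrow> linear_on fscale fscale A f"
  by (simp add: linear_on_def flinD)

lemma tpower_eqI_on:
  assumes "linear_on fscale fscale (tpower s A n) f" "linear_on fscale fscale (tpower s A n) g"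
    and "\<And>xs. set xs \<subseteq> A \<Longrightarrow> length xs = n \<Longrightarrow> f (pure s xs) = g (pure s xs)"
    and "X \<in> tpower s A n"
  shows "f X = g X"
  by (rule linear_on_span_eq[OF assms(1,2)[unfolded tpower_def] _ assms(4)[unfolded tpower_def]])
    (use assms(3) in blast)

lemma tpower_eqI:
  assumes "flin f" "flin g"
    and "\<And>xs. set xs \<subseteq> A \<Longrightarrow> length xs = n \<Longrightarrow> f (pure s xs) = g (pure s xs)"
    and "X \<in> tpower s A n"
  shows "f X = g X"
  by (rule tpower_eqI_on[OF flin_imp_linear_on[OF assms(1)] flin_imp_linear_on[OF assms(2)] assms(3,4)])

lemma tensor_eqI:
  assumes "flin f" "flin g" "\<And>xs. f (pure s xs) = g (pure s xs)" "X \<in> tensor_space s"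
  shows "f X = g X"
  by (rule linear_on_span_eq[OF flin_imp_linear_on[OF assms(1)] flin_imp_linear_on[OF assms(2)] _
        assms(4)[unfolded tensor_space_def]]) (use assms(3) in blast)

lemma flin_span_mem:
  fixes f :: "('x \<Rightarrow> 'k::field) \<Rightarrow> ('y \<Rightarrow> 'k)"
  assumes f: "flin f" and W: "module.subspace fscale W" and S: "\<And>x. x \<in> S \<Longrightarrow> f x \<in> W"
    and X: "X \<in> module.span fscale S"
  shows "f X \<in> W"
proof -
  interpret x: module "fscale :: 'k \<Rightarrow> ('x \<Rightarrow> 'k) \<Rightarrow> _" by (rule module_fscale)
  interpret y: module "fscale :: 'k \<Rightarrow> ('y \<Rightarrow> 'k) \<Rightarrow> _" by (rule module_fscale)
  from X show ?thesis
  proof (induction rule: x.span_induct_alt)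
    case base then show ?case using flin_0[OF f] y.subspace_0[OF W] by simp
  next
    case (step c x y)
    then show ?case
      using W S by (auto simp: flinD[OF f] intro: y.subspace_add y.subspace_scale)
  qed
qed

lemma tpower_mem:
  assumes "flin f" "module.subspace fscale W"
    and "\<And>xs. set xs \<subseteq> A \<Longrightarrow> length xs = n \<Longrightarrow> f (pure s xs) \<in> W"
    and "X \<in> tpower s A n"
  shows "f X \<in> W"
  by (rule flin_span_mem[OF assms(1,2) _ assms(4)[unfolded tpower_def]]) (use assms(3) in blast)

lemma tensor_mem:
  assumes "flin f" "module.subspace fscale W" "\<And>xs. f (pure s xs) \<in> W" "X \<in> tensor_space s"
  shows "f X \<in> W"
  by (rule flin_span_mem[OF assms(1,2) _ assms(4)[unfolded tensor_space_def]]) (use assms(3) in blast)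

lemma pure_in_tpower: "set xs \<subseteq> A \<Longrightarrow> length xs = n \<Longrightarrow> pure s xs \<in> tpower s A n"
  unfolding tpower_def by (intro fspan_base) auto

lemma pure_in_tensor_space: "pure s xs \<in> tensor_space s"
  unfolding tensor_space_def by (intro fspan_base) auto

lemma subspace_tpower: "module.subspace fscale (tpower s A n)"
  unfolding tpower_def by (rule fsubspace_span)

lemma subspace_tensor_space: "module.subspace fscale (tensor_space s)"
  unfolding tensor_space_def by (rule fsubspace_span)

lemma tpower_subset_tensor_space: "tpower s A n \<subseteq> tensor_space s"
  unfolding tpower_def tensor_space_def by (rule fspan_mono) auto

lemma tpower_mono: "A \<subseteq> B \<Longrightarrow> tpower s A n \<subseteq> tpower s B n"
  unfolding tpower_def by (rule fspan_mono) auto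

text \<open>Any everywhere linear \<open>h\<close> with the right values on pure tensors shows that
  the choice in \<open>lin_ext\<close> succeeds, and it agrees with the chosen map because pure
  tensors span. The chosen map never has to be inspected further.\<close>

lemma lin_ext_eq:
  assumes h: "flin h" and eq: "\<And>xs. set xs \<subseteq> A \<Longrightarrow> length xs = n \<Longrightarrow> h (pure s xs) = F xs"
    and X: "X \<in> tpower s A n"
  shows "lin_ext s A n F X = h X"
proof -
  have "linear_on fscale fscale (tpower s A n) h \<and> (\<forall>xs. set xs \<subseteq> A \<and> length xs = n \<longrightarrow> h (pure s xs) = F xs)"
    using h eq by (simp add: flin_imp_linear_on)
  then have *: "linear_on fscale fscale (tpower s A n) (lin_ext s A n F) \<and>
      (\<forall>xs. set xs \<subseteq> A \<and> length xs = n \<longrightarrow> lin_ext s A n F (pure s xs) = F xs)"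
    unfolding lin_ext_def by (rule someI[where P = "\<lambda>h. linear_on fscale fscale (tpower s A n) h \<and>
      (\<forall>xs. set xs \<subseteq> A \<and> length xs = n \<longrightarrow> h (pure s xs) = F xs)"])
  show ?thesis
    by (rule tpower_eqI_on[where f = "lin_ext s A n F"])
      (use * h eq X in \<open>auto simp: flin_imp_linear_on\<close>)
qed

text \<open>The functional model of tensors gives an extension operator that is linear on the whole
  function space, so that no domain conditions arise for it.\<close>

definition mext :: "('v list \<Rightarrow> ('x \<Rightarrow> 'k)) \<Rightarrow> ('v, 'k::field) tens \<Rightarrow> ('x \<Rightarrow> 'k)" where
  "mext F a = (\<lambda>g. a (\<lambda>xs. F xs g))"

lemma flin_mext: "flin (mext F)"
  by (rule flinI) (auto simp: mext_def fscale_def fun_eq_iff plus_fun_apply)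

lemma mext_pure:
  fixes F :: "'v::ab_group_add list \<Rightarrow> ('x \<Rightarrow> 'k::field)"
  assumes "multilinear s fscale F" shows "mext F (pure s xs) = F xs"
proof -
  have "multilinear s (*) (\<lambda>zs. F zs g)" for g
    using assms vector_space_mult
    by (auto simp: multilinear_def Vector_Spaces.linear_iff fscale_def plus_fun_apply)
  then show ?thesis by (simp add: mext_def pure_def fun_eq_iff)
qed

text \<open>An element of the type \<open>tens\<close> is an arbitrary function on forms and need
  not be a tensor. The complement of T(V) implicit here is arbitrary; only linearity, the range and
  the values on tensors are used.\<close>

definition tproj :: "('k::field \<Rightarrow> 'v::ab_group_add \<Rightarrow> 'v) \<Rightarrow> ('v, 'k) tens \<Rightarrow> ('v, 'k) tens" where
  "tproj s = (SOME p. flin p \<and> (\<forall>x. p x \<in> tensor_space s) \<and> (\<forall>x \<in> tensor_space s. p x = x))"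

lemma exists_projection:
  fixes W :: "('x \<Rightarrow> 'k::field) set"
  assumes W: "module.subspace fscale W"
  shows "\<exists>p. flin p \<and> (\<forall>x. p x \<in> W) \<and> (\<forall>x \<in> W. p x = x)"
proof -
  interpret f: vector_space "fscale :: 'k \<Rightarrow> ('x \<Rightarrow> 'k) \<Rightarrow> _" by (rule vector_space_fscale)
  interpret ff: vector_space_pair "fscale :: 'k \<Rightarrow> ('x \<Rightarrow> 'k) \<Rightarrow> _" "fscale :: 'k \<Rightarrow> ('x \<Rightarrow> 'k) \<Rightarrow> _" ..
  have "\<exists>p. p ` UNIV \<subseteq> W \<and> flin p \<and> (\<forall>v \<in> W. p (id v) = v)"
    by (rule ff.linear_exists_left_inverse_on[OF f.linear_id W inj_on_id])
  then show ?thesis unfolding id_apply image_subset_iff by blast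
qed

text \<open>Precomposition with a projection onto \<open>W\<close>. In this way the given braiding
  and its inverse become operators on the whole function space.\<close>

lemma linear_on_extend:
  fixes f :: "('x \<Rightarrow> 'k::field) \<Rightarrow> ('y \<Rightarrow> 'k)"
  assumes W: "module.subspace fscale W" and f: "linear_on fscale fscale W f"
  obtains g where "flin g" "\<And>x. x \<in> W \<Longrightarrow> g x = f x"
proof -
  obtain p where p: "flin p" "\<And>x. p x \<in> W" "\<And>x. x \<in> W \<Longrightarrow> p x = x"
    using exists_projection[OF W] by blast
  have "flin (\<lambda>x. f (p x))"
    by (rule flinI) (use p f in \<open>simp_all add: flinD linear_on_def\<close>)
  then show thesis using p(3) by (intro that[of "\<lambda>x. f (p x)"]) simp_all
qed

lemma tproj_props:
  "flin (tproj s) \<and> (\<forall>x. tproj s x \<in> tensor_space s) \<and> (\<forall>x \<in> tensor_space s. tproj s x = x)"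
  unfolding tproj_def by (rule someI_ex[OF exists_projection[OF subspace_tensor_space]])

lemma flin_tproj: "flin (tproj s)" and tproj_in: "tproj s x \<in> tensor_space s"
  and tproj_eq: "x \<in> tensor_space s \<Longrightarrow> tproj s x = x"
  using tproj_props by auto

definition bimultilinear :: "('k::field \<Rightarrow> 'v::ab_group_add \<Rightarrow> 'v) \<Rightarrow> ('v list \<Rightarrow> 'v list \<Rightarrow> ('x \<Rightarrow> 'k)) \<Rightarrow> bool" where
  "bimultilinear s F \<longleftrightarrow> (\<forall>ys. multilinear s fscale (\<lambda>xs. F xs ys)) \<and> (\<forall>xs. multilinear s fscale (F xs))"

text \<open>\<open>bilin_ext\<close> is bilinear on \<open>T(V)\<close> only; composing with a projection makes it bilinear
  on the whole function space.\<close>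

definition tbil :: "('k::field \<Rightarrow> 'v::ab_group_add \<Rightarrow> 'v) \<Rightarrow> ('v list \<Rightarrow> 'v list \<Rightarrow> ('x \<Rightarrow> 'k)) \<Rightarrow>
    ('v, 'k) tens \<Rightarrow> ('v, 'k) tens \<Rightarrow> ('x \<Rightarrow> 'k)" where
  "tbil s F a b = bilin_ext F (tproj s a) (tproj s b)"

lemma bilin_ext_eq_tbil: "a \<in> tensor_space s \<Longrightarrow> b \<in> tensor_space s \<Longrightarrow> bilin_ext F a b = tbil s F a b"
  by (simp add: tbil_def tproj_eq)

lemma bilin_ext_eq_mext: "bilin_ext F a b = mext (\<lambda>xs. mext (F xs) b) a"
  by (simp add: bilin_ext_def mext_def)

text \<open>A general \<open>b\<close> is a function that need not respect sums, so additivity in a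
  slot of \<open>xs\<close> does not pass through it. For a tensor \<open>b\<close> both sides are
  linear in \<open>b\<close> and can be compared on pure tensors.\<close>

lemma mext_multilinear:
  fixes F :: "'v::ab_group_add list \<Rightarrow> 'v list \<Rightarrow> ('x \<Rightarrow> 'k::field)"
  assumes s: "vector_space s" and F: "bimultilinear s F" and b: "b \<in> tensor_space s"
  shows "multilinear s fscale (\<lambda>xs. mext (F xs) b)"
proof -
  have m: "multilinear s fscale (F xs)" for xs using F by (simp add: bimultilinear_def)
  have F1: "F (xs @ (x + y) # ys) zs = F (xs @ x # ys) zs + F (xs @ y # ys) zs"
    "F (xs @ s c x # ys) zs = fscale c (F (xs @ x # ys) zs)" for xs x y ys zs c
    using F unfolding bimultilinear_def multilinear_fscale_iff[OF s] by blast+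
  show ?thesis unfolding multilinear_fscale_iff[OF s]
  proof (intro conjI allI)
    fix xs ys x y
    show "mext (F (xs @ (x + y) # ys)) b = mext (F (xs @ x # ys)) b + mext (F (xs @ y # ys)) b"
      by (rule tensor_eqI[where f = "mext (F (xs @ (x + y) # ys))", OF flin_mext _ _ b])
        (auto simp: mext_pure[OF m] F1 intro: flin_plus flin_mext)
  next
    fix xs ys c x
    show "mext (F (xs @ s c x # ys)) b = fscale c (mext (F (xs @ x # ys)) b)"
      by (rule tensor_eqI[where f = "mext (F (xs @ s c x # ys))", OF flin_mext _ _ b])
        (auto simp: mext_pure[OF m] F1 intro: flin_scale flin_mext)
  qed
qed

lemma flin_tbil_left: "flin (\<lambda>a. tbil s F a b)"
  unfolding tbil_def bilin_ext_eq_mext by (rule flin_comp[OF flin_mext flin_tproj])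

text \<open>Linearity in the left argument holds by the form of \<open>mext\<close>. The right
  argument sits inside the functional of the left one, so here the projected left argument is tested
  on pure tensors.\<close>

lemma flin_tbil_right:
  assumes s: "vector_space s" and F: "bimultilinear s F"
  shows "flin (tbil s F a)"
proof (rule flinI)
  note m = mext_pure[OF mext_multilinear[OF s F tproj_in]]
  fix x y c
  show "tbil s F a (x + y) = tbil s F a x + tbil s F a y"
    unfolding tbil_def bilin_ext_eq_mext
    by (rule tensor_eqI[OF flin_mext flin_plus[OF flin_mext flin_mext] _ tproj_in])
      (unfold m, simp only: flinD[OF flin_mext] flinD[OF flin_tproj])
  show "tbil s F a (fscale c x) = fscale c (tbil s F a x)"
    unfolding tbil_def bilin_ext_eq_mext
    by (rule tensor_eqI[OF flin_mext flin_scale[OF flin_mext] _ tproj_in])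
      (unfold m, simp only: flinD[OF flin_mext] flinD[OF flin_tproj])
qed

lemma tbil_pure:
  assumes "bimultilinear s F" shows "tbil s F (pure s xs) (pure s ys) = F xs ys"
  unfolding tbil_def using assms
  by (simp add: tproj_eq pure_in_tensor_space bilin_ext_pure bimultilinear_def)

lemma bilinear_tensor_mem:
  assumes "\<And>b. flin (\<lambda>a. f a b)" "\<And>a. flin (f a)" "module.subspace fscale W"
    and "\<And>xs ys. f (pure s xs) (pure s ys) \<in> W" and a: "a \<in> tensor_space s" and b: "b \<in> tensor_space s"
  shows "f a b \<in> W"
  by (rule tensor_mem[OF assms(1,3) _ a], rule tensor_mem[OF assms(2,3) _ b], rule assms(4))

lemma bilinear_tpower_eqI:
  assumes "\<And>b. flin (\<lambda>a. f a b)" "\<And>a. flin (f a)" "\<And>b. flin (\<lambda>a. g a b)" "\<And>a. flin (g a)"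
    and "\<And>xs ys. length xs = m \<Longrightarrow> length ys = n \<Longrightarrow> f (pure s xs) (pure s ys) = g (pure s xs) (pure s ys)"
    and a: "a \<in> tpower s UNIV m" and b: "b \<in> tpower s UNIV n"
  shows "f a b = g a b"
  by (rule tpower_eqI[where f = "\<lambda>a. f a b", OF assms(1,3) _ a],
      rule tpower_eqI[where f = "\<lambda>b. f _ b", OF assms(2,4) _ b], rule assms(5))

lemma bilinear_tensor_eqI:
  assumes "\<And>b. flin (\<lambda>a. f a b)" "\<And>a. flin (f a)" "\<And>b. flin (\<lambda>a. g a b)" "\<And>a. flin (g a)"
    and "\<And>xs ys. f (pure s xs) (pure s ys) = g (pure s xs) (pure s ys)"
    and a: "a \<in> tensor_space s" and b: "b \<in> tensor_space s"
  shows "f a b = g a b"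
  by (rule tensor_eqI[where f = "\<lambda>a. f a b", OF assms(1,3) _ a],
      rule tensor_eqI[where f = "\<lambda>b. f _ b", OF assms(2,4) _ b], rule assms(5))

subsection \<open>Concatenation\<close>

definition tconc :: "('k::field \<Rightarrow> 'v::ab_group_add \<Rightarrow> 'v) \<Rightarrow> ('v, 'k) tens \<Rightarrow> ('v, 'k) tens \<Rightarrow> ('v, 'k) tens" where
  "tconc s = tbil s (\<lambda>xs ys. pure s (xs @ ys))"

lemma bimultilinear_append: "vector_space s \<Longrightarrow> bimultilinear s (\<lambda>xs ys. pure s (xs @ ys))"
  unfolding bimultilinear_def multilinear_fscale_iff
  using pure_add[of s] pure_scale[of s] by (simp flip: append_assoc add: append_Cons[symmetric] del: append_Cons append_assoc) auto

lemma tconc_pure: "vector_space s \<Longrightarrow> tconc s (pure s xs) (pure s ys) = pure s (xs @ ys)"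
  unfolding tconc_def by (rule tbil_pure[OF bimultilinear_append])

lemma flin_tconc_left: "flin (\<lambda>a. tconc s a b)"
  unfolding tconc_def by (rule flin_tbil_left)

lemma flin_tconc_right: "vector_space s \<Longrightarrow> flin (tconc s a)"
  unfolding tconc_def by (rule flin_tbil_right[OF _ bimultilinear_append])

lemma conc_eq_tconc: "a \<in> tensor_space s \<Longrightarrow> b \<in> tensor_space s \<Longrightarrow> conc s a b = tconc s a b"
  unfolding conc_def tconc_def by (rule bilin_ext_eq_tbil)

text \<open>\<open>tconc\<close> sees its arguments only through the projection, so identities
  checked on tensors hold for all arguments. This is why \<open>tconc_assoc\<close> carries no
  membership assumptions.\<close>

lemma tconc_tproj: "tconc s (tproj s a) (tproj s b) = tconc s a b"
  by (simp add: tconc_def tbil_def tproj_eq tproj_in)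

lemma tconc_tproj_left: "tconc s (tproj s a) b = tconc s a b"
  by (simp add: tconc_def tbil_def tproj_eq tproj_in)

lemma tconc_tproj_right: "tconc s a (tproj s b) = tconc s a b"
  by (simp add: tconc_def tbil_def tproj_eq tproj_in)

lemma tconc_in_tensor_space:
  assumes "vector_space s" shows "tconc s a b \<in> tensor_space s"
proof -
  have "tconc s (tproj s a) (tproj s b) \<in> tensor_space s"
    by (rule bilinear_tensor_mem[where f = "tconc s"])
      (auto simp: tconc_pure assms pure_in_tensor_space subspace_tensor_space
        intro: flin_tconc_left flin_tconc_right[OF assms] tproj_in)
  then show ?thesis by (simp only: tconc_tproj)
qed

lemma tconc_in_tpower:
  assumes "vector_space s" "a \<in> tpower s A m" "b \<in> tpower s A n"
  shows "tconc s a b \<in> tpower s A (m + n)"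
  by (rule tpower_mem[OF flin_tconc_left subspace_tpower _ assms(2)],
      rule tpower_mem[OF flin_tconc_right[OF assms(1)] subspace_tpower _ assms(3)])
    (auto simp: tconc_pure assms intro!: pure_in_tpower)

lemma tconc_assoc:
  assumes s: "vector_space s"
  shows "tconc s (tconc s a b) c = tconc s a (tconc s b c)"
proof -
  note fl = flin_tconc_left flin_tconc_right[OF s]
  have "tconc s (tconc s (tproj s a) (tproj s b)) (tproj s c) = tconc s (tproj s a) (tconc s (tproj s b) (tproj s c))"
  proof (rule tensor_eqI[where X = "tproj s c" and s = s])
    show "flin (\<lambda>c. tconc s (tconc s (tproj s a) (tproj s b)) c)"
      "flin (\<lambda>c. tconc s (tproj s a) (tconc s (tproj s b) c))" by (intro flin_comp[OF fl(2)] fl flin_comp[OF fl(2) fl(2)])+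
    fix zs
    show "tconc s (tconc s (tproj s a) (tproj s b)) (pure s zs) = tconc s (tproj s a) (tconc s (tproj s b) (pure s zs))"
      by (rule bilinear_tensor_eqI[where f = "\<lambda>a b. tconc s (tconc s a b) (pure s zs)" and
            g = "\<lambda>a b. tconc s a (tconc s b (pure s zs))" and s = s])
        (auto simp: tconc_pure[OF s] tproj_in intro: flin_comp[OF fl(1) fl(1)] flin_comp[OF fl(1) fl(2)]
          flin_comp[OF fl(2) fl(1)] fl)
  qed (rule tproj_in)
  then show ?thesis
    by (simp only: tconc_tproj tconc_tproj_left tconc_tproj_right)
qed

lemma tconc_Nil:
  assumes "vector_space s" "a \<in> tensor_space s"
  shows "tconc s (pure s []) a = a" "tconc s a (pure s []) = a"
  by (rule tensor_eqI[OF flin_tconc_right[OF assms(1)] flin_id _ assms(2)], simp add: tconc_pure assms,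
      rule tensor_eqI[OF flin_tconc_left flin_id _ assms(2)], simp add: tconc_pure assms)

text \<open>The factors in the hypothesis are arbitrary tensors rather than pure ones, because an
  operator applied to one factor leaves the pure tensors.\<close>

lemma tpower_add_eqI:
  assumes s: "vector_space s" and "flin f" "flin g"
    and "\<And>a b. a \<in> tpower s UNIV m \<Longrightarrow> b \<in> tpower s UNIV n \<Longrightarrow> f (tconc s a b) = g (tconc s a b)"
    and "X \<in> tpower s UNIV (m + n)"
  shows "f X = g X"
proof (rule tpower_eqI[OF assms(2,3) _ assms(5)])
  fix xs :: "'b list" assume "length xs = m + n"
  then have "pure s xs = tconc s (pure s (take m xs)) (pure s (drop m xs))"
    "pure s (take m xs) \<in> tpower s UNIV m" "pure s (drop m xs) \<in> tpower s UNIV n"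
    by (auto simp: tconc_pure[OF s] intro: pure_in_tpower)
  then show "f (pure s xs) = g (pure s xs)" using assms(4) by simp
qed

lemma tpower_add_mem:
  assumes s: "vector_space s" and "flin f" "module.subspace fscale W"
    and "\<And>a b. a \<in> tpower s UNIV m \<Longrightarrow> b \<in> tpower s UNIV n \<Longrightarrow> f (tconc s a b) \<in> W"
    and "X \<in> tpower s UNIV (m + n)"
  shows "f X \<in> W"
proof (rule tpower_mem[OF assms(2,3) _ assms(5)])
  fix xs :: "'b list" assume "length xs = m + n"
  then have "pure s xs = tconc s (pure s (take m xs)) (pure s (drop m xs))"
    "pure s (take m xs) \<in> tpower s UNIV m" "pure s (drop m xs) \<in> tpower s UNIV n"
    by (auto simp: tconc_pure[OF s] intro: pure_in_tpower)
  then show "f (pure s xs) \<in> W" using assms(4) by simp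
qed

section \<open>Lifts of permutations to tensor powers\<close>

text \<open>\<open>sg s B i\<close> is \<open>\<sigma>\<^sub>i\<close> in all degrees at once, for an operator \<open>B\<close> that is linear on the whole
  function space; it is \<open>0\<close> in the degrees \<open>n \<le> i\<close>.\<close>

definition sg_body :: "('k::field \<Rightarrow> 'v::ab_group_add \<Rightarrow> 'v) \<Rightarrow> (('v, 'k) tens \<Rightarrow> ('v, 'k) tens) \<Rightarrow> nat \<Rightarrow>
    'v list \<Rightarrow> ('v, 'k) tens" where
  "sg_body s B i xs = (if 1 \<le> i \<and> i < length xs
     then tconc s (tconc s (pure s (take (i - 1) xs)) (B (pure s [xs ! (i - 1), xs ! i]))) (pure s (drop (i + 1) xs))
     else 0)"

definition sg :: "('k::field \<Rightarrow> 'v::ab_group_add \<Rightarrow> 'v) \<Rightarrow> (('v, 'k) tens \<Rightarrow> ('v, 'k) tens) \<Rightarrow> nat \<Rightarrow>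
    ('v, 'k) tens \<Rightarrow> ('v, 'k) tens" where
  "sg s B i = mext (sg_body s B i)"

lemma flin_sg: "flin (sg s B i)"
  unfolding sg_def by (rule flin_mext)

text \<open>As a function of a single entry, \<open>sg_body\<close> is a linear map applied to a
  pure tensor containing that entry. Both halves of multilinearity then follow from those of
  \<open>pure\<close>, with one case analysis.\<close>

lemma sg_body_slot:
  assumes s: "vector_space s" and B: "flin B"
  shows "\<exists>f us ws. flin f \<and> (\<forall>z. sg_body s B i (xs @ z # ys) = f (pure s (us @ z # ws)))"
proof -
  note fl = flin_tconc_left flin_tconc_right[OF s] B
  let ?p = "length xs"
  \<comment> \<open>Counting from 0, \<open>z\<close> stands at \<open>?p\<close> and
    \<open>B\<close> acts at \<open>i - 1\<close> and \<open>i\<close>. The cases are: index out of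
    range, \<open>z\<close> before the pair, at its first place, at its second place, after
    it.\<close>
  consider (out) "\<not> (1 \<le> i \<and> i < Suc (?p + length ys))"
    | (l) "1 \<le> i" "i < Suc (?p + length ys)" "?p < i - 1"
    | (m1) "1 \<le> i" "i < Suc (?p + length ys)" "?p = i - 1"
    | (m2) "1 \<le> i" "i < Suc (?p + length ys)" "?p = i"
    | (r) "1 \<le> i" "i < Suc (?p + length ys)" "i < ?p"
    by linarith
  then show ?thesis
  proof cases
    case out
    then show ?thesis
      by (intro exI[of _ "\<lambda>_. 0"] exI conjI flin_zero) (auto simp: sg_body_def)
  next
    case l
    then have "i = ?p + 2 + (i - (?p + 2))" by linarith
    then obtain k where k: "i = ?p + 2 + k" by blast
    let ?f = "\<lambda>X. tconc s (tconc s X (B (pure s [ys ! (i - 2 - ?p), ys ! (i - 1 - ?p)]))) (pure s (drop (i - ?p) ys))"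
    have "sg_body s B i (xs @ z # ys) = ?f (pure s (xs @ z # take (i - 2 - ?p) ys))" for z
    proof -
      have 1: "take (i - 1) (xs @ z # ys) = xs @ z # take (i - 2 - ?p) ys"
        using k by simp
      have 2: "(xs @ z # ys) ! (i - 1) = ys ! (i - 2 - ?p)" "(xs @ z # ys) ! i = ys ! (i - 1 - ?p)"
        using k by (simp_all add: nth_append)
      have 3: "drop (i + 1) (xs @ z # ys) = drop (i - ?p) ys"
        using l by (simp add: Suc_diff_le)
      show ?thesis unfolding sg_body_def 1 2 3 using l by simp
    qed
    moreover have "flin ?f" by (intro flin_comp[OF fl(1) fl(1)])
    ultimately show ?thesis by blast
  next
    case m1
    then have i: "i = Suc ?p" by linarith
    let ?f = "\<lambda>X. tconc s (tconc s (pure s xs) (B X)) (pure s (drop 1 ys))"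
    have "sg_body s B i (xs @ z # ys) = ?f (pure s ([] @ z # [ys ! 0]))" for z
    proof -
      have 1: "take (i - 1) (xs @ z # ys) = xs" using m1 by simp
      have 2: "(xs @ z # ys) ! (i - 1) = z" "(xs @ z # ys) ! i = ys ! 0"
        using i by (simp_all add: nth_append)
      have 3: "drop (i + 1) (xs @ z # ys) = drop 1 ys"
        using m1 by (simp add: Suc_diff_le)
      show ?thesis unfolding sg_body_def 1 2 3 using m1 by simp
    qed
    moreover have "flin ?f" by (intro flin_comp[OF fl(1) flin_comp[OF fl(2) B]])
    ultimately show ?thesis by blast
  next
    case m2
    let ?f = "\<lambda>X. tconc s (tconc s (pure s (take (i - 1) xs)) (B X)) (pure s ys)"
    have "sg_body s B i (xs @ z # ys) = ?f (pure s ([xs ! (i - 1)] @ z # []))" for z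
    proof -
      have 1: "take (i - 1) (xs @ z # ys) = take (i - 1) xs" using m2 by simp
      have 2: "(xs @ z # ys) ! (i - 1) = xs ! (i - 1)" "(xs @ z # ys) ! i = z"
        using m2 by (simp_all add: nth_append nth_Cons')
      have 3: "drop (i + 1) (xs @ z # ys) = ys"
        using m2 by (simp add: Suc_diff_le)
      show ?thesis unfolding sg_body_def 1 2 3 using m2 by simp
    qed
    moreover have "flin ?f" by (intro flin_comp[OF fl(1) flin_comp[OF fl(2) B]])
    ultimately show ?thesis by blast
  next
    case r
    let ?f = "\<lambda>X. tconc s (tconc s (pure s (take (i - 1) xs)) (B (pure s [xs ! (i - 1), xs ! i]))) X"
    have "sg_body s B i (xs @ z # ys) = ?f (pure s (drop (i + 1) xs @ z # ys))" for z
    proof -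
      have 1: "take (i - 1) (xs @ z # ys) = take (i - 1) xs" using r by simp
      have 2: "(xs @ z # ys) ! (i - 1) = xs ! (i - 1)" "(xs @ z # ys) ! i = xs ! i"
        using r less_imp_diff_less[OF r(3), of 1] by (simp_all add: nth_append nth_Cons')
      have 3: "drop (i + 1) (xs @ z # ys) = drop (i + 1) xs @ z # ys"
        using r by simp
      show ?thesis unfolding sg_body_def 1 2 3 using r by simp
    qed
    moreover have "flin ?f" by (rule fl(2))
    ultimately show ?thesis by blast
  qed
qed

lemma sg_body_multilinear:
  assumes s: "vector_space s" and B: "flin B"
  shows "multilinear s fscale (sg_body s B i)"
  unfolding multilinear_fscale_iff[OF s]
proof (intro conjI allI)
  fix xs ys x y c
  obtain f us ws where f: "flin f" "\<And>z. sg_body s B i (xs @ z # ys) = f (pure s (us @ z # ws))"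
    using sg_body_slot[OF s B] by blast
  show "sg_body s B i (xs @ (x + y) # ys) = sg_body s B i (xs @ x # ys) + sg_body s B i (xs @ y # ys)"
    unfolding f(2) pure_add[OF s] flinD[OF f(1)] ..
  show "sg_body s B i (xs @ s c x # ys) = fscale c (sg_body s B i (xs @ x # ys))"
    unfolding f(2) pure_scale[OF s] flinD[OF f(1)] ..
qed

lemma sg_pure:
  assumes s: "vector_space s" and B: "flin B"
  shows "sg s B i (pure s xs) = sg_body s B i xs"
  unfolding sg_def by (rule mext_pure[OF sg_body_multilinear[OF s B]])

lemma fsubspace_0: "module.subspace fscale W \<Longrightarrow> 0 \<in> W"
  by (rule module.subspace_0[OF module_fscale])

text \<open>Stated for any \<open>A\<close>, since it is applied to tensor powers of V, of T(V) and
  of the generated subalgebra.\<close>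

lemma sg_in_tpower:
  assumes s: "vector_space s" and B: "flin B"
    and B2: "\<And>X. X \<in> tpower s A 2 \<Longrightarrow> B X \<in> tpower s A 2" and X: "X \<in> tpower s A n"
  shows "sg s B i X \<in> tpower s A n"
proof (rule tpower_mem[OF flin_sg subspace_tpower _ X])
  fix xs :: "'b list" assume A: "set xs \<subseteq> A" and len: "length xs = n"
  show "sg s B i (pure s xs) \<in> tpower s A n"
  proof (cases "1 \<le> i \<and> i < length xs")
    case False show ?thesis
      unfolding sg_pure[OF s B] sg_body_def if_not_P[OF False] by (rule fsubspace_0[OF subspace_tpower])
  next
    case True
    then have "xs ! (i - 1) \<in> set xs" "xs ! i \<in> set xs" by auto
    then have "tconc s (tconc s (pure s (take (i - 1) xs)) (B (pure s [xs ! (i - 1), xs ! i]))) (pure s (drop (i + 1) xs))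
        \<in> tpower s A (i - 1 + 2 + (n - (i + 1)))"
      by (intro tconc_in_tpower[OF s] B2 pure_in_tpower) (use True len A set_take_subset[of "i - 1" xs] set_drop_subset[of "i + 1" xs] in auto)
    moreover have "i - 1 + 2 + (n - (i + 1)) = n" using True len by simp
    ultimately show ?thesis using True by (simp only: sg_pure[OF s B] sg_body_def if_True simp_thms)
  qed
qed

lemma sg_tconc_left:
  assumes s: "vector_space s" and B: "flin B" and i: "1 \<le> i" "i < m"
    and a: "a \<in> tpower s UNIV m" and b: "b \<in> tensor_space s"
  shows "sg s B i (tconc s a b) = tconc s (sg s B i a) b"
proof (rule tpower_eqI[OF _ _ _ a], rule flin_comp[OF flin_sg flin_tconc_left],
    rule flin_comp[OF flin_tconc_left flin_sg])
  fix xs :: "'b list" assume len: "length xs = m"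
  show "sg s B i (tconc s (pure s xs) b) = tconc s (sg s B i (pure s xs)) b"
  proof (rule tensor_eqI[OF _ _ _ b], rule flin_comp[OF flin_sg flin_tconc_right[OF s]],
      rule flin_tconc_right[OF s])
    fix ys
    have "i - 1 < length xs" using i len by linarith
    then have "(xs @ ys) ! (i - 1) = xs ! (i - 1)" "(xs @ ys) ! i = xs ! i"
      using i len by (simp_all add: nth_append)
    then have e: "sg_body s B i (xs @ ys) = tconc s (sg_body s B i xs) (pure s ys)"
      using i len by (simp add: sg_body_def tconc_assoc[OF s] tconc_pure[OF s])
    show "sg s B i (tconc s (pure s xs) (pure s ys)) = tconc s (sg s B i (pure s xs)) (pure s ys)"
      by (simp only: tconc_pure[OF s] sg_pure[OF s B] e)
  qed
qed

lemma sg_tconc_right: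
  assumes s: "vector_space s" and B: "flin B" and i: "1 \<le> i" "i < n"
    and a: "a \<in> tpower s UNIV m" and b: "b \<in> tpower s UNIV n"
  shows "sg s B (m + i) (tconc s a b) = tconc s a (sg s B i b)"
proof (rule tpower_eqI[OF _ _ _ a], rule flin_comp[OF flin_sg flin_tconc_left], rule flin_tconc_left)
  fix xs :: "'b list" assume len: "length xs = m"
  show "sg s B (m + i) (tconc s (pure s xs) b) = tconc s (pure s xs) (sg s B i b)"
  proof (rule tpower_eqI[OF _ _ _ b], rule flin_comp[OF flin_sg flin_tconc_right[OF s]],
      rule flin_comp[OF flin_tconc_right[OF s] flin_sg])
    fix ys :: "'b list" assume len': "length ys = n"
    have m: "m + i - 1 = m + (i - 1)" using i by simp
    have n: "(xs @ ys) ! (m + (i - 1)) = ys ! (i - 1)" "(xs @ ys) ! (m + i) = ys ! i"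
      "take (m + (i - 1)) (xs @ ys) = xs @ take (i - 1) ys" "drop (m + i + 1) (xs @ ys) = drop (i + 1) ys"
      using len by (simp_all add: nth_append)
    have e: "sg_body s B (m + i) (xs @ ys) = tconc s (pure s xs) (sg_body s B i ys)"
      using i len len' unfolding sg_body_def m n
      by (simp add: tconc_assoc[OF s, symmetric] tconc_pure[OF s])
    show "sg s B (m + i) (tconc s (pure s xs) (pure s ys)) = tconc s (pure s xs) (sg s B i (pure s ys))"
      by (simp only: tconc_pure[OF s] sg_pure[OF s B] e)
  qed
qed

text \<open>The middle factor \<open>Z\<close> is arbitrary because after one application of
  \<open>B\<close> it is in general no longer pure; \<open>sg_inverse\<close> applies the lemma a
  second time to such a factor.\<close>

lemma sg_tconc_mid:
  assumes s: "vector_space s" and B: "flin B" and Z: "Z \<in> tpower s UNIV 2"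
  shows "sg s B (length us + 1) (tconc s (tconc s (pure s us) Z) (pure s ws)) =
    tconc s (tconc s (pure s us) (B Z)) (pure s ws)"
proof (rule tpower_eqI[OF _ _ _ Z])
  note fl = flin_tconc_left flin_tconc_right[OF s]
  show "flin (\<lambda>Z. sg s B (length us + 1) (tconc s (tconc s (pure s us) Z) (pure s ws)))"
    by (rule flin_comp[OF flin_sg flin_comp[OF fl]])
  show "flin (\<lambda>Z. tconc s (tconc s (pure s us) (B Z)) (pure s ws))"
    by (rule flin_comp[OF fl(1) flin_comp[OF fl(2) B]])
  fix xs :: "'b list" assume "length xs = 2"
  then obtain p q where xs: "xs = [p, q]" by (auto simp: numeral_2_eq_2 length_Suc_conv)
  show "sg s B (length us + 1) (tconc s (tconc s (pure s us) (pure s xs)) (pure s ws)) =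
      tconc s (tconc s (pure s us) (B (pure s xs))) (pure s ws)"
    by (simp add: xs tconc_pure[OF s] sg_pure[OF s B] sg_body_def nth_append)
qed

lemma sg_inverse:
  assumes s: "vector_space s" and B: "flin B" and B': "flin B'"
    and mem: "\<And>X. X \<in> tpower s A 2 \<Longrightarrow> B X \<in> tpower s A 2"
    and inv: "\<And>X. X \<in> tpower s A 2 \<Longrightarrow> B' (B X) = X"
    and i: "1 \<le> i" "i < n" and Y: "Y \<in> tpower s A n"
  shows "sg s B' i (sg s B i Y) = Y"
proof (rule tpower_eqI[OF flin_comp[OF flin_sg flin_sg] flin_id _ Y])
  fix xs :: "'b list" assume xs: "set xs \<subseteq> A" "length xs = n"
  define us p ws where "us = take (i - 1) xs" and "p = [xs ! (i - 1), xs ! i]" and "ws = drop (i + 1) xs"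
  have "xs ! (i - 1) \<in> set xs" "xs ! i \<in> set xs" using xs(2) i by auto
  then have p: "pure s p \<in> tpower s A 2" using xs(1) by (intro pure_in_tpower) (auto simp: p_def)
  then have Bp: "B (pure s p) \<in> tpower s UNIV 2" "pure s p \<in> tpower s UNIV 2"
    using mem tpower_mono[OF subset_UNIV] by blast+
  have len: "i = length us + 1" using i xs(2) by (simp add: us_def)
  have "drop (i - 1) xs = p @ ws"
    using i xs(2) Cons_nth_drop_Suc[of "i - 1" xs] Cons_nth_drop_Suc[of i xs] by (simp add: p_def ws_def)
  then have "us @ p @ ws = xs" unfolding us_def by (metis append_take_drop_id)
  then have e: "pure s xs = tconc s (tconc s (pure s us) (pure s p)) (pure s ws)"
    by (simp add: tconc_pure[OF s])
  show "sg s B' i (sg s B i (pure s xs)) = pure s xs"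
    unfolding e len sg_tconc_mid[OF s B Bp(2)] sg_tconc_mid[OF s B' Bp(1)] inv[OF p] ..
qed

text \<open>The bridge from the operators of the statement. Agreement on the tensor square of
  \<open>A\<close> suffices, and values in T(V) allow \<open>conc\<close> to be replaced by
  \<open>tconc\<close>.\<close>

lemma braid_at_eq_sg:
  assumes s: "vector_space s" and B: "flin B"
    and eq: "\<And>X. X \<in> tpower s A 2 \<Longrightarrow> \<sigma> X = B X" and mem: "\<And>X. X \<in> tpower s A 2 \<Longrightarrow> B X \<in> tensor_space s"
    and i: "1 \<le> i" "i < n" and X: "X \<in> tpower s A n"
  shows "braid_at s A \<sigma> n i X = sg s B i X"
  unfolding braid_at_def
proof (rule lin_ext_eq[OF flin_sg _ X])
  fix xs assume xs: "set xs \<subseteq> A" "length xs = n"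
  have "xs ! (i - 1) \<in> set xs" "xs ! i \<in> set xs" using xs i by auto
  then have p: "pure s [xs ! (i - 1), xs ! i] \<in> tpower s A 2" using xs(1) by (intro pure_in_tpower) auto
  then have "\<sigma> (pure s [xs ! (i - 1), xs ! i]) = B (pure s [xs ! (i - 1), xs ! i])" by (rule eq)
  then show "sg s B i (pure s xs) = conc s (conc s (pure s (take (i - 1) xs)) (\<sigma> (pure s [xs ! (i - 1), xs ! i])))
      (pure s (drop (i + 1) xs))"
    using i xs(2) mem[OF p]
    by (simp only: sg_pure[OF s B] sg_body_def if_True conc_eq_tconc pure_in_tensor_space
        tconc_in_tensor_space[OF s] conj_absorb simp_thms)
qed

section \<open>Lifts of permutations for a fixed braiding operator\<close>

locale braiding =
  fixes s :: "'k::field \<Rightarrow> 'v::ab_group_add \<Rightarrow> 'v" and B :: "('v, 'k) tens \<Rightarrow> ('v, 'k) tens"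
  assumes vs: "vector_space s" and flin_B: "flin B"
    and B_in: "X \<in> tpower s UNIV 2 \<Longrightarrow> B X \<in> tpower s UNIV 2"
    and B_braid: "X \<in> tpower s UNIV 3 \<Longrightarrow>
      sg s B 1 (sg s B 2 (sg s B 1 X)) = sg s B 2 (sg s B 1 (sg s B 2 X))"
begin

abbreviation V :: "nat \<Rightarrow> ('v, 'k) tens set" where "V n \<equiv> tpower s UNIV n"

abbreviation word :: "nat list \<Rightarrow> ('v, 'k) tens \<Rightarrow> ('v, 'k) tens" where
  "word is \<equiv> foldr (sg s B) is"

text \<open>The word is picked by the same \<open>SOME\<close> as in \<open>T_perm\<close>, so
  \<open>T_perm_eq\<close> compares the two letter by letter.\<close>

definition T :: "nat \<Rightarrow> (nat \<Rightarrow> nat) \<Rightarrow> ('v, 'k) tens \<Rightarrow> ('v, 'k) tens" where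
  "T n w = word (SOME is. reduced_expression n w is)"

lemma V_sub: "X \<in> V n \<Longrightarrow> X \<in> tensor_space s"
  using tpower_subset_tensor_space by blast

lemma sg_in: "X \<in> V n \<Longrightarrow> sg s B i X \<in> V n"
  by (rule sg_in_tpower[OF vs flin_B B_in])

lemma word_in: "X \<in> V n \<Longrightarrow> word is X \<in> V n"
  by (induction "is") (auto intro: sg_in)

lemma flin_word: "flin (word is)"
proof (induction "is")
  case Nil then show ?case using flin_id by (simp add: id_def)
next
  case (Cons i "is") then show ?case using flin_comp[OF flin_sg] by (simp add: o_def)
qed

lemma flin_T: "flin (T n w)"
  unfolding T_def by (rule flin_word)

lemma T_in: "X \<in> V n \<Longrightarrow> T n w X \<in> V n"
  unfolding T_def by (rule word_in)

lemma sg_left: "1 \<le> i \<Longrightarrow> i < m \<Longrightarrow> a \<in> V m \<Longrightarrow> b \<in> tensor_space s \<Longrightarrow>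
    sg s B i (tconc s a b) = tconc s (sg s B i a) b"
  by (rule sg_tconc_left[OF vs flin_B])

lemma sg_right: "1 \<le> i \<Longrightarrow> i < n \<Longrightarrow> a \<in> V m \<Longrightarrow> b \<in> V n \<Longrightarrow>
    sg s B (m + i) (tconc s a b) = tconc s a (sg s B i b)"
  by (rule sg_tconc_right[OF vs flin_B])

lemma sg_far:
  assumes i: "1 \<le> i" "i + 1 < j" "j < n" and X: "X \<in> V n"
  shows "sg s B i (sg s B j X) = sg s B j (sg s B i X)"
\<comment> \<open>Cut after \<open>j - 1\<close> factors: the operator at \<open>i\<close> acts
  within the left part because \<open>i < j - 1\<close>, and the operator at \<open>j\<close>
  becomes the one at 1 on the right part.\<close>
proof (rule tpower_add_eqI[OF vs, of "\<lambda>X. sg s B i (sg s B j X)" "\<lambda>X. sg s B j (sg s B i X)" "j - 1" "n - (j - 1)" X])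
  show "X \<in> V (j - 1 + (n - (j - 1)))" using X i by simp
  fix a b assume a: "a \<in> V (j - 1)" and b: "b \<in> V (n - (j - 1))"
  have j: "sg s B j (tconc s a' b) = tconc s a' (sg s B 1 b)" if "a' \<in> V (j - 1)" for a'
    using sg_right[of 1 "n - (j - 1)" a' "j - 1" b] i b that by simp
  have l: "sg s B i (tconc s a b') = tconc s (sg s B i a) b'" if "b' \<in> V (n - (j - 1))" for b'
    using sg_left[of i "j - 1" a b'] i a V_sub[OF that] by simp
  show "sg s B i (sg s B j (tconc s a b)) = sg s B j (sg s B i (tconc s a b))"
    by (simp only: j l a b sg_in)
qed (rule flin_comp[OF flin_sg flin_sg])+

lemma sg_braid:
  assumes i: "1 \<le> i" "i + 1 < n" and X: "X \<in> V n"
  shows "sg s B i (sg s B (i + 1) (sg s B i X)) = sg s B (i + 1) (sg s B i (sg s B (i + 1) X))"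
proof -
  let ?f = "\<lambda>X. sg s B i (sg s B (i + 1) (sg s B i X))" and ?g = "\<lambda>X. sg s B (i + 1) (sg s B i (sg s B (i + 1) X))"
  have "?f X = ?g X"
  proof (rule tpower_add_eqI[OF vs, of ?f ?g "i - 1" "n - (i - 1)" X])
  show "X \<in> V (i - 1 + (n - (i - 1)))" using X i by simp
  fix a c assume a: "a \<in> V (i - 1)" and c: "c \<in> V (n - (i - 1))"
  \<comment> \<open>Behind the first \<open>i - 1\<close> factors, the next three carry both
    operators; on these three the relation is the axiom \<open>B_braid\<close>.\<close>
  have "n - (i - 1) = 3 + (n - (i + 2))" using i by simp
  with c have c': "c \<in> V (3 + (n - (i + 2)))" by simp
  have s1: "sg s B i (tconc s a d) = tconc s a (sg s B 1 d)"
    and s2: "sg s B (i + 1) (tconc s a d) = tconc s a (sg s B 2 d)" if "d \<in> V (n - (i - 1))" for d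
    using sg_right[of 1 "n - (i - 1)" a "i - 1" d] sg_right[of 2 "n - (i - 1)" a "i - 1" d] i a that by simp_all
  have "sg s B 1 (sg s B 2 (sg s B 1 c)) = sg s B 2 (sg s B 1 (sg s B 2 c))"
  proof (rule tpower_add_eqI[OF vs, of "\<lambda>c. sg s B 1 (sg s B 2 (sg s B 1 c))"
        "\<lambda>c. sg s B 2 (sg s B 1 (sg s B 2 c))", OF _ _ _ c'])
    fix u v assume u: "u \<in> V 3" and v: "v \<in> V (n - (i + 2))"
    have t: "sg s B 1 (tconc s u' v) = tconc s (sg s B 1 u') v"
      "sg s B 2 (tconc s u' v) = tconc s (sg s B 2 u') v" if "u' \<in> V 3" for u'
      using sg_left[of 1 3 u' v] sg_left[of 2 3 u' v] that V_sub[OF v] by simp_all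
    show "sg s B 1 (sg s B 2 (sg s B 1 (tconc s u v))) = sg s B 2 (sg s B 1 (sg s B 2 (tconc s u v)))"
      by (simp only: t u sg_in B_braid)
  qed (rule flin_comp[OF flin_sg flin_comp[OF flin_sg flin_sg]])+
  then show "?f (tconc s a c) = ?g (tconc s a c)"
    by (simp only: s1 s2 c sg_in)
  qed (rule flin_comp[OF flin_sg flin_comp[OF flin_sg flin_sg]])+
  then show ?thesis .
qed

lemma word_eq:
  assumes "set is \<subseteq> {1..<n}" "set js \<subseteq> {1..<n}" "word_perm is = word_perm js"
    and "length is = ninv (word_perm is)" "length js = ninv (word_perm js)" and "X \<in> V n"
  shows "word is X = word js X"
  by (rule matsumoto[where X = "V n" and n = n and h = "sg s B", OF sg_in sg_braid sg_far assms])

lemma T_eq_word: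
  assumes "set is \<subseteq> {1..<n}" "length is = ninv (word_perm is)" and X: "X \<in> V n"
  shows "T n (word_perm is) X = word is X"
proof -
  have p: "word_perm is permutes {1..n}" by (rule word_perm_permutes[OF assms(1)])
  define js where "js = (SOME js. reduced_expression n (word_perm is) js)"
  have "reduced_expression n (word_perm is) is" unfolding reduced_expression_iff[OF p] using assms by simp
  then have "reduced_expression n (word_perm is) js" unfolding js_def by (rule someI)
  then have js: "set js \<subseteq> {1..<n}" "word_perm js = word_perm is" "length js = ninv (word_perm is)"
    unfolding reduced_expression_iff[OF p] by auto
  have "word js X = word is X" by (rule word_eq[of _ n]) (use js assms in auto)
  then show ?thesis by (simp add: T_def js_def)
qed

lemma T_word:
  assumes w: "w permutes {1..n}"
  obtains "is" where "set is \<subseteq> {1..<n}" "word_perm is = w" "length is = ninv w"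
    "\<And>X. X \<in> V n \<Longrightarrow> T n w X = word is X"
proof -
  obtain "is" where i: "set is \<subseteq> {1..<n}" "word_perm is = w" "length is = ninv w"
    using exists_expression_ninv[OF w] by blast
  show thesis by (rule that[OF i]) (use T_eq_word[OF i(1)] i in auto)
qed

lemma T_id: "X \<in> V n \<Longrightarrow> T n id X = X"
  using T_eq_word[of "[]" n X] by simp

text \<open>By compatibility the concatenation of reduced words is reduced, its length being the
  number of inversions of the product.\<close>

lemma T_comp:
  assumes u: "u permutes {1..n}" and v: "v permutes {1..n}" and c: "compatible u v" and X: "X \<in> V n"
  shows "T n (u \<circ> v) X = T n u (T n v X)"
proof -
  obtain "is" where i: "set is \<subseteq> {1..<n}" "word_perm is = u" "length is = ninv u"
    "\<And>X. X \<in> V n \<Longrightarrow> T n u X = word is X" using T_word[OF u] by blast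
  obtain js where j: "set js \<subseteq> {1..<n}" "word_perm js = v" "length js = ninv v"
    "\<And>X. X \<in> V n \<Longrightarrow> T n v X = word js X" using T_word[OF v] by blast
  have wp: "word_perm (is @ js) = u \<circ> v" by (simp only: word_perm_append i j)
  have "T n (word_perm (is @ js)) X = word (is @ js) X"
    by (rule T_eq_word[OF _ _ X]) (simp_all only: wp ninv_comp[OF u v c], use i j in auto)
  then show ?thesis by (simp only: wp foldr_append o_apply i j T_in[OF X] word_in[OF X] X)
qed

text \<open>A reduced word of \<open>u\<close> in degree \<open>m\<close> remains reduced in degree
  \<open>m + n\<close>, and all its letters act on the left factor.\<close>

lemma T_left:
  assumes u: "u permutes {1..m}" and a: "a \<in> V m" and b: "b \<in> V n"
  shows "T (m + n) u (tconc s a b) = tconc s (T m u a) b"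
proof -
  obtain "is" where i: "set is \<subseteq> {1..<m}" "word_perm is = u" "length is = ninv u"
    "\<And>X. X \<in> V m \<Longrightarrow> T m u X = word is X" using T_word[OF u] by blast
  have "set is \<subseteq> {1..<m + n}" using i(1) by force
  then have "T (m + n) u (tconc s a b) = word is (tconc s a b)"
    using T_eq_word[of "is" "m + n" "tconc s a b"] i tconc_in_tpower[OF vs a b] by simp
  also have "\<dots> = tconc s (word is a) b"
    using i(1)
  proof (induction "is")
    case (Cons i "is")
    then show ?case using sg_left[of i m "word is a" b] word_in[OF a] V_sub[OF b] by simp
  qed simp
  finally show ?thesis by (simp only: i(4)[OF a])
qed

lemma T_right:
  assumes v: "v permutes {1..n}" and a: "a \<in> V m" and b: "b \<in> V n"
  shows "T (m + n) (shift m v) (tconc s a b) = tconc s a (T n v b)"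
proof -
  obtain "is" where i: "set is \<subseteq> {1..<n}" "word_perm is = v" "length is = ninv v"
    "\<And>X. X \<in> V n \<Longrightarrow> T n v X = word is X" using T_word[OF v] by blast
  have wp: "word_perm (map ((+) m) is) = shift m v" using word_perm_shift[OF i(1)] i(2) by simp
  have "set (map ((+) m) is) \<subseteq> {1..<m + n}" using i(1) by fastforce
  then have "T (m + n) (shift m v) (tconc s a b) = word (map ((+) m) is) (tconc s a b)"
    using T_eq_word[of "map ((+) m) is" "m + n" "tconc s a b"] i wp ninv_shift[OF v] tconc_in_tpower[OF vs a b]
    by simp
  also have "\<dots> = tconc s a (word is b)"
    using i(1)
  proof (induction "is")
    case (Cons i "is")
    then show ?case using sg_right[of i n a m "word is b"] word_in[OF b] a by simp
  qed simp
  finally show ?thesis by (simp only: i(4)[OF b])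
qed

end

text \<open>A reversed reduced word of \<open>w\<close> expresses the inverse permutation and is
  again reduced. Applying the letters of \<open>B\<close> and then those of \<open>B'\<close> in
  reverse order cancels from the middle outwards.\<close>

lemma T_inverse:
  assumes "braiding s B" "braiding s B'"
    and inv: "\<And>X. X \<in> tpower s UNIV 2 \<Longrightarrow> B' (B X) = X"
    and w: "w permutes {1..n}" and X: "X \<in> tpower s UNIV n"
  shows "braiding.T s B' n (inv w) (braiding.T s B n w X) = X"
proof -
  interpret B: braiding s B by fact
  interpret B': braiding s B' by fact
  note sg = sg_inverse[where s = s and A = UNIV and B = B and B' = B', OF B.vs B.flin_B B'.flin_B B.B_in inv]
  obtain "is" where i: "set is \<subseteq> {1..<n}" "word_perm is = w" "length is = ninv w"
    "\<And>X. X \<in> tpower s UNIV n \<Longrightarrow> B.T n w X = B.word is X" using B.T_word[OF w] by blast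
  have rev: "word_perm (rev js) \<circ> word_perm js = id" for js
  proof (induction js)
    case (Cons j js)
    have "word_perm (rev (j # js)) \<circ> word_perm (j # js) = word_perm (rev js) \<circ> (adj j \<circ> (adj j \<circ> word_perm js))"
      by (simp only: rev.simps word_perm_append word_perm_Cons word_perm_Nil o_id o_assoc)
    then show ?case by (simp only: adj_adj_comp Cons)
  qed simp
  have invw: "inv w = word_perm (rev is)"
    by (rule inv_unique_comp) (use rev[of "is"] rev[of "rev is"] i(2) in simp_all)
  have le: "ninv (inv u) \<le> ninv u" if u: "u permutes {1..n}" for u
  proof -
    obtain js where j: "set js \<subseteq> {1..<n}" "word_perm js = u" "length js = ninv u"
      using exists_expression_ninv[OF u] by blast
    have "inv u = word_perm (rev js)"
      by (rule inv_unique_comp) (use rev[of js] rev[of "rev js"] j(2) in simp_all)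
    then show ?thesis using ninv_word_perm_le[of "rev js" n] j by simp
  qed
  \<comment> \<open>Reversal gives one inequality for every permutation; applied to the inverse it
    gives the other.\<close>
  have "ninv (inv w) = ninv w"
    using le[OF w] le[OF permutes_inv[OF w]] permutes_inv_inv[OF w] by simp
  then have "B'.T n (inv w) Y = B'.word (rev is) Y" if "Y \<in> tpower s UNIV n" for Y
    using B'.T_eq_word[of "rev is" n Y] i that invw by simp
  then have "B'.T n (inv w) (B.T n w X) = B'.word (rev is) (B.word is X)"
    using i(4)[OF X] B.word_in[OF X] by simp
  also have "\<dots> = X"
    using i(1) by (induction "is") (use X B.word_in[OF X] sg in \<open>auto simp: foldr_append\<close>)
  finally show ?thesis .
qed

section \<open>The quantum shuffle product and the induced braiding\<close>

text \<open>The operator may depend on the two degrees, since these stay constant while one entry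
  varies.\<close>

lemma bimultilinear_append_comp:
  assumes s: "vector_space s" and f: "\<And>m n. flin (f m n)"
  shows "bimultilinear s (\<lambda>xs ys. f (length xs) (length ys) (pure s (xs @ ys)))"
proof -
  have 1: "pure s ((us @ (x + y) # ws) @ ys) = pure s ((us @ x # ws) @ ys) + pure s ((us @ y # ws) @ ys)"
    "pure s ((us @ s c x # ws) @ ys) = fscale c (pure s ((us @ x # ws) @ ys))"
    "pure s (ys @ us @ (x + y) # ws) = pure s (ys @ us @ x # ws) + pure s (ys @ us @ y # ws)"
    "pure s (ys @ us @ s c x # ws) = fscale c (pure s (ys @ us @ x # ws))" for us ws x y c ys
    using pure_add[OF s, of us x y "ws @ ys"] pure_scale[OF s, of us c x "ws @ ys"]
      pure_add[OF s, of "ys @ us" x y ws] pure_scale[OF s, of "ys @ us" c x ws] by simp_all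
  show ?thesis
    unfolding bimultilinear_def multilinear_fscale_iff[OF s] 1 flinD[OF f] by simp
qed

section \<open>Operators on tensor products of copies of T(V), and cutting\<close>

definition ext2 :: "(('x \<Rightarrow> 'k::field) \<Rightarrow> ('x \<Rightarrow> 'k) \<Rightarrow> ('y \<Rightarrow> 'k)) \<Rightarrow> ('x \<Rightarrow> 'k, 'k) tens \<Rightarrow> ('y \<Rightarrow> 'k)" where
  "ext2 G = mext (\<lambda>xs. if length xs = 2 then G (xs ! 0) (xs ! 1) else 0)"

definition ext3 :: "(('x \<Rightarrow> 'k::field) \<Rightarrow> ('x \<Rightarrow> 'k) \<Rightarrow> ('x \<Rightarrow> 'k) \<Rightarrow> ('y \<Rightarrow> 'k)) \<Rightarrow> ('x \<Rightarrow> 'k, 'k) tens \<Rightarrow> ('y \<Rightarrow> 'k)" where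
  "ext3 G = mext (\<lambda>xs. if length xs = 3 then G (xs ! 0) (xs ! 1) (xs ! 2) else 0)"

lemma flin_ext2: "flin (ext2 G)" and flin_ext3: "flin (ext3 H)"
  unfolding ext2_def ext3_def by (rule flin_mext)+

lemma ext2_pure:
  fixes G :: "('x \<Rightarrow> 'k::field) \<Rightarrow> ('x \<Rightarrow> 'k) \<Rightarrow> ('y \<Rightarrow> 'k)"
  assumes "\<And>b. flin (\<lambda>a. G a b)" "\<And>a. flin (G a)"
  shows "ext2 G (pure fscale [a, b]) = G a b"
proof -
  let ?F = "\<lambda>xs. if length xs = 2 then G (xs ! 0) (xs ! 1) else 0"
  have "flin (\<lambda>z. ?F (us @ z # ws))" for us ws
  proof -
    \<comment> \<open>\<open>undefined\<close> stands for the varying entry, on which the length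
      does not depend.\<close>
    consider "length (us @ undefined # ws) \<noteq> 2" | b where "us = []" "ws = [b]" | a where "us = [a]" "ws = []"
      by (cases us; cases ws) (auto simp: numeral_2_eq_2 length_Suc_conv)
    then show ?thesis
    proof cases
      case 1
      then have "?F (us @ z # ws) = 0" for z by simp
      then show ?thesis by (simp only: flin_zero)
    next
      case 2 then show ?thesis using assms(1)[of b] by simp
    next
      case (3 a) then show ?thesis using assms(2)[of a] by simp
    qed
  qed
  then have "multilinear fscale fscale ?F"
    unfolding multilinear_def by blast
  from mext_pure[OF this, of "[a, b]"] show ?thesis by (simp add: ext2_def)
qed

lemma ext3_pure:
  fixes G :: "('x \<Rightarrow> 'k::field) \<Rightarrow> ('x \<Rightarrow> 'k) \<Rightarrow> ('x \<Rightarrow> 'k) \<Rightarrow> ('y \<Rightarrow> 'k)"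
  assumes "\<And>b c. flin (\<lambda>a. G a b c)" "\<And>a c. flin (\<lambda>b. G a b c)" "\<And>a b. flin (G a b)"
  shows "ext3 G (pure fscale [a, b, c]) = G a b c"
proof -
  let ?F = "\<lambda>xs. if length xs = 3 then G (xs ! 0) (xs ! 1) (xs ! 2) else 0"
  have "flin (\<lambda>z. ?F (us @ z # ws))" for us ws
  proof -
    consider "length (us @ undefined # ws) \<noteq> 3" | b c where "us = []" "ws = [b, c]"
      | a c where "us = [a]" "ws = [c]" | a b where "us = [a, b]" "ws = []"
      by (cases us; cases ws; cases "tl us"; cases "tl ws") (auto simp: numeral_3_eq_3 length_Suc_conv)
    then show ?thesis
    proof cases
      case 1
      then have "?F (us @ z # ws) = 0" for z by simp
      then show ?thesis by (simp only: flin_zero)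
    next
      case 2 then show ?thesis using assms(1)[of b c] by simp
    next
      case (3 a c) then show ?thesis using assms(2)[of a c] by simp
    next
      case (4 a b) then show ?thesis using assms(3)[of a b] by (simp add: numeral_2_eq_2)
    qed
  qed
  then have "multilinear fscale fscale ?F"
    unfolding multilinear_def by blast
  from mext_pure[OF this, of "[a, b, c]"] show ?thesis by (simp add: ext3_def numeral_2_eq_2 numeral_3_eq_3)
qed

lemma multilinear_split:
  fixes P :: "'v::ab_group_add list \<Rightarrow> 'v list \<Rightarrow> ('x \<Rightarrow> 'k::field)"
  assumes s: "vector_space s" and P: "bimultilinear s P"
  shows "multilinear s fscale (\<lambda>zs. P (take j zs) (drop j zs))"
proof -
  have "Vector_Spaces.linear s fscale (\<lambda>z. P (take j (us @ z # ws)) (drop j (us @ z # ws)))" for us ws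
  proof (cases "length us < j")
    case True
    then have "take j (us @ z # ws) = us @ z # take (j - Suc (length us)) ws"
      "drop j (us @ z # ws) = drop (j - Suc (length us)) ws" for z
      by (simp_all add: take_Cons' drop_Cons')
    then show ?thesis using P by (simp only:) (simp add: bimultilinear_def multilinear_def)
  next
    case False
    then have "take j (us @ z # ws) = take j us" "drop j (us @ z # ws) = drop j us @ z # ws" for z by simp_all
    then show ?thesis using P by (simp only:) (simp add: bimultilinear_def multilinear_def)
  qed
  then show ?thesis by (simp add: multilinear_def)
qed

text \<open>The maps \<open>V\<^sup>\<otimes>\<^sup>n \<rightarrow> T(V) \<otimes> T(V)\<close> and \<open>V\<^sup>\<otimes>\<^sup>n \<rightarrow> T(V) \<otimes> T(V) \<otimes> T(V)\<close> cutting a tensor after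
  \<open>i\<close>, respectively after \<open>i\<close> and \<open>i + j\<close> factors.\<close>

definition cut2 :: "('k::field \<Rightarrow> 'v::ab_group_add \<Rightarrow> 'v) \<Rightarrow> nat \<Rightarrow> ('v, 'k) tens \<Rightarrow> (('v, 'k) tens, 'k) tens" where
  "cut2 s i = mext (\<lambda>zs. pure fscale [pure s (take i zs), pure s (drop i zs)])"

definition cut3 :: "('k::field \<Rightarrow> 'v::ab_group_add \<Rightarrow> 'v) \<Rightarrow> nat \<Rightarrow> nat \<Rightarrow> ('v, 'k) tens \<Rightarrow> (('v, 'k) tens, 'k) tens" where
  "cut3 s i j = mext (\<lambda>zs. pure fscale [pure s (take i zs), pure s (take j (drop i zs)), pure s (drop j (drop i zs))])"

lemma flin_cut2: "flin (cut2 s i)" and flin_cut3: "flin (cut3 s i j)"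
  unfolding cut2_def cut3_def by (rule flin_mext)+

lemma flin_pure_slots:
  "flin (\<lambda>x. pure fscale [x, b])" "flin (\<lambda>x. pure fscale [a, x])"
  "flin (\<lambda>x. pure fscale [x, b, c])" "flin (\<lambda>x. pure fscale [a, x, c])" "flin (\<lambda>x. pure fscale [a, b, x])"
  by (rule flinI; simp add: pure_add_short pure_scale_short vector_space_fscale)+

lemma linear_pure_comp:
  assumes s: "vector_space s" and f: "flin f"
  shows "Vector_Spaces.linear s fscale (\<lambda>z. f (pure s (us @ z # ws)))"
  unfolding Vector_Spaces.linear_iff using s f
  by (simp add: vector_space_fscale pure_add pure_scale flinD)

lemma cut2_tconc:
  assumes s: "vector_space s" and a: "a \<in> tpower s UNIV i" and b: "b \<in> tensor_space s"
  shows "cut2 s i (tconc s a b) = pure fscale [a, b]"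
proof (rule tpower_eqI[OF _ _ _ a], rule flin_comp[OF flin_cut2 flin_tconc_left], rule flin_pure_slots)
  have "bimultilinear s (\<lambda>xs ys. pure fscale [pure s xs, pure s ys])"
    unfolding bimultilinear_def multilinear_def
    using linear_pure_comp[OF s flin_pure_slots(1)] linear_pure_comp[OF s flin_pure_slots(2)] by simp
  note m = mext_pure[OF multilinear_split[OF s this]]
  fix xs :: "'b list" assume len: "length xs = i"
  show "cut2 s i (tconc s (pure s xs) b) = pure fscale [pure s xs, b]"
    by (rule tensor_eqI[OF flin_comp[OF flin_cut2 flin_tconc_right[OF s]] flin_pure_slots(2) _ b])
      (use len in \<open>simp add: tconc_pure[OF s] cut2_def m\<close>)
qed

lemma cut3_tconc:
  assumes s: "vector_space s" and a: "a \<in> tpower s UNIV i" and b: "b \<in> tpower s UNIV j" and c: "c \<in> tensor_space s"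
  shows "cut3 s i j (tconc s (tconc s a b) c) = pure fscale [a, b, c]"
proof -
  have m2: "multilinear s fscale (\<lambda>zs. pure fscale [pure s xs, pure s (take j zs), pure s (drop j zs)])" for xs
    by (rule multilinear_split[OF s, of "\<lambda>ys zs. pure fscale [pure s xs, pure s ys, pure s zs]"])
      (use linear_pure_comp[OF s flin_pure_slots(4)] linear_pure_comp[OF s flin_pure_slots(5)]
        in \<open>simp add: bimultilinear_def multilinear_def\<close>)
  have "bimultilinear s (\<lambda>xs zs. pure fscale [pure s xs, pure s (take j zs), pure s (drop j zs)])"
    unfolding bimultilinear_def
    using m2 linear_pure_comp[OF s flin_pure_slots(3)] by (simp add: multilinear_def)
  note m = mext_pure[OF multilinear_split[OF s this]]
  note fl = flin_tconc_left flin_tconc_right[OF s]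
  show ?thesis
  proof (rule tpower_eqI[OF _ _ _ a], rule flin_comp[OF flin_cut3 flin_comp[OF fl(1) fl(1)]], rule flin_pure_slots)
    fix xs :: "'b list" assume len: "length xs = i"
    show "cut3 s i j (tconc s (tconc s (pure s xs) b) c) = pure fscale [pure s xs, b, c]"
    proof (rule tpower_eqI[OF _ _ _ b], rule flin_comp[OF flin_cut3 flin_comp[OF fl(1) fl(2)]], rule flin_pure_slots)
      fix ys :: "'b list" assume len': "length ys = j"
      show "cut3 s i j (tconc s (tconc s (pure s xs) (pure s ys)) c) = pure fscale [pure s xs, pure s ys, c]"
        by (rule tensor_eqI[OF flin_comp[OF flin_cut3 fl(2)] flin_pure_slots(5) _ c])
          (unfold cut3_def tconc_pure[OF s] m, use len len' in simp)
    qed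
  qed
qed

text \<open>T(V) \<otimes> T(V) is spanned by the images of the tensor powers of V under the cuts.
  Identities on it can thus be tested in a fixed total degree, where the operators are lifts of
  permutations.\<close>

lemma tensor_pair_eqI:
  fixes s :: "'k::field \<Rightarrow> 'v::ab_group_add \<Rightarrow> 'v"
  assumes s: "vector_space s" and f: "flin f" and g: "flin g"
    and eq: "\<And>i j Y. Y \<in> tpower s UNIV (i + j) \<Longrightarrow> f (cut2 s i Y) = g (cut2 s i Y)"
    and X: "X \<in> tpower fscale (tensor_space s) 2"
  shows "f X = g X"
proof (rule tpower_eqI[OF f g _ X])
  fix ts :: "('v, 'k) tens list" assume ts: "set ts \<subseteq> tensor_space s" "length ts = 2"
  then obtain a b where ab: "ts = [a, b]" "a \<in> tensor_space s" "b \<in> tensor_space s"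
    by (auto simp: numeral_2_eq_2 length_Suc_conv)
  have "f (pure fscale [pure s xs, pure s ys]) = g (pure fscale [pure s xs, pure s ys])" for xs ys
  proof -
    have "cut2 s (length xs) (tconc s (pure s xs) (pure s ys)) = pure fscale [pure s xs, pure s ys]"
      by (rule cut2_tconc[OF s]) (auto intro: pure_in_tpower pure_in_tensor_space)
    moreover have "tconc s (pure s xs) (pure s ys) \<in> tpower s UNIV (length xs + length ys)"
      by (intro tconc_in_tpower[OF s] pure_in_tpower) auto
    ultimately show ?thesis using eq by metis
  qed
  then show "f (pure fscale ts) = g (pure fscale ts)"
    unfolding ab(1)
    by (intro bilinear_tensor_eqI[where f = "\<lambda>a b. f (pure fscale [a, b])" and g = "\<lambda>a b. g (pure fscale [a, b])",
        OF flin_comp[OF f flin_pure_slots(1)] flin_comp[OF f flin_pure_slots(2)]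
          flin_comp[OF g flin_pure_slots(1)] flin_comp[OF g flin_pure_slots(2)] _ ab(2,3)])
qed

lemma tensor_triple_eqI:
  fixes s :: "'k::field \<Rightarrow> 'v::ab_group_add \<Rightarrow> 'v"
  assumes s: "vector_space s" and f: "flin f" and g: "flin g"
    and eq: "\<And>i j k Y. Y \<in> tpower s UNIV (i + j + k) \<Longrightarrow> f (cut3 s i j Y) = g (cut3 s i j Y)"
    and X: "X \<in> tpower fscale (tensor_space s) 3"
  shows "f X = g X"
proof (rule tpower_eqI[OF f g _ X])
  fix ts :: "('v, 'k) tens list" assume ts: "set ts \<subseteq> tensor_space s" "length ts = 3"
  then obtain a b c where abc: "ts = [a, b, c]" "a \<in> tensor_space s" "b \<in> tensor_space s" "c \<in> tensor_space s"
    by (auto simp: numeral_3_eq_3 length_Suc_conv)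
  have "f (pure fscale [pure s xs, pure s ys, pure s zs]) = g (pure fscale [pure s xs, pure s ys, pure s zs])" for xs ys zs
  proof -
    have "cut3 s (length xs) (length ys) (tconc s (tconc s (pure s xs) (pure s ys)) (pure s zs))
        = pure fscale [pure s xs, pure s ys, pure s zs]"
      by (rule cut3_tconc[OF s]) (auto intro: pure_in_tpower pure_in_tensor_space)
    moreover have "tconc s (tconc s (pure s xs) (pure s ys)) (pure s zs) \<in> tpower s UNIV (length xs + length ys + length zs)"
      by (intro tconc_in_tpower[OF s] pure_in_tpower) auto
    ultimately show ?thesis using eq by metis
  qed
  then have "f (pure fscale [a, b, pure s zs]) = g (pure fscale [a, b, pure s zs])" for zs
    by (intro bilinear_tensor_eqI[where f = "\<lambda>a b. f (pure fscale [a, b, pure s zs])" and g = "\<lambda>a b. g (pure fscale [a, b, pure s zs])",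
        OF flin_comp[OF f flin_pure_slots(3)] flin_comp[OF f flin_pure_slots(4)]
          flin_comp[OF g flin_pure_slots(3)] flin_comp[OF g flin_pure_slots(4)] _ abc(2,3)])
  then show "f (pure fscale ts) = g (pure fscale ts)"
    unfolding abc(1)
    by (rule tensor_eqI[OF flin_comp[OF f flin_pure_slots(5)] flin_comp[OF g flin_pure_slots(5)] _ abc(4)])
qed

lemma cut2_in:
  assumes s: "vector_space s" and Y: "Y \<in> tpower s UNIV (i + j)"
  shows "cut2 s i Y \<in> tpower fscale (tensor_space s) 2"
proof (rule tpower_add_mem[OF s flin_cut2 subspace_tpower _ Y])
  fix a b assume ab: "a \<in> tpower s UNIV i" "b \<in> tpower s UNIV j"
  then have in_ts: "a \<in> tensor_space s" "b \<in> tensor_space s" using tpower_subset_tensor_space by blast+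
  then show "cut2 s i (tconc s a b) \<in> tpower fscale (tensor_space s) 2"
    unfolding cut2_tconc[OF s ab(1) in_ts(2)] by (intro pure_in_tpower) auto
qed

lemma shuffles_perm_0: "shuffles_perm 0 n = {id}" "shuffles_perm n 0 = {id}"
proof -
  have "w = id" if "w permutes {1..n}" "strict_mono_on {1..n} w" for w :: "nat \<Rightarrow> nat"
    using strict_mono_permutes_id[of "{1..n}" w] that by simp
  moreover have "id permutes {1..n}" "strict_mono_on {1..n} (id :: nat \<Rightarrow> nat)" "strict_mono_on {} (id :: nat \<Rightarrow> nat)"
    by (auto simp: permutes_id strict_mono_on_def)
  ultimately show "shuffles_perm 0 n = {id}" "shuffles_perm n 0 = {id}"
    by (auto simp: shuffles_perm_def strict_mono_on_def)
qed

context braiding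
begin

text \<open>Everywhere linear versions of the operators of the definitions: \<open>M\<close> of \<open>qshuffle\<close>, \<open>Bt\<close> of
  \<open>beta\<close>, \<open>Ml\<close> of \<open>mult_id\<close> and \<open>Mr\<close> of \<open>id_mult\<close>.\<close>

definition M :: "('v, 'k) tens \<Rightarrow> ('v, 'k) tens \<Rightarrow> ('v, 'k) tens" where
  "M = tbil s (\<lambda>xs ys. \<Sum>w\<in>shuffles_perm (length xs) (length ys). T (length xs + length ys) w (pure s (xs @ ys)))"

definition bet :: "('v, 'k) tens \<Rightarrow> ('v, 'k) tens \<Rightarrow> (('v, 'k) tens, 'k) tens" where
  "bet = tbil s (\<lambda>xs ys. cut2 s (length ys) (T (length xs + length ys) (chi (length xs) (length ys)) (pure s (xs @ ys))))"

definition Bt :: "(('v, 'k) tens, 'k) tens \<Rightarrow> (('v, 'k) tens, 'k) tens" where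
  "Bt = ext2 bet"

lemma M_bimultilinear: "bimultilinear s
    (\<lambda>xs ys. \<Sum>w\<in>shuffles_perm (length xs) (length ys). T (length xs + length ys) w (pure s (xs @ ys)))"
  by (rule bimultilinear_append_comp[OF vs, of "\<lambda>m n X. \<Sum>w\<in>shuffles_perm m n. T (m + n) w X"])
    (intro flin_sum_fun flin_T)

lemma bet_bimultilinear: "bimultilinear s
    (\<lambda>xs ys. cut2 s (length ys) (T (length xs + length ys) (chi (length xs) (length ys)) (pure s (xs @ ys))))"
  by (rule bimultilinear_append_comp[OF vs, of "\<lambda>m n X. cut2 s n (T (m + n) (chi m n) X)"])
    (rule flin_comp[OF flin_cut2 flin_T])

lemma flin_M: "flin (\<lambda>a. M a b)" "flin (M a)"
  unfolding M_def by (rule flin_tbil_left, rule flin_tbil_right[OF vs M_bimultilinear])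

lemma flin_bet: "flin (\<lambda>a. bet a b)" "flin (bet a)"
  unfolding bet_def by (rule flin_tbil_left, rule flin_tbil_right[OF vs bet_bimultilinear])

text \<open>Extended from pure to homogeneous arguments, because iterated products such as
  \<open>M (M a b) c\<close> have arguments that are not pure.\<close>

lemma M_eq:
  assumes a: "a \<in> V m" and b: "b \<in> V n"
  shows "M a b = (\<Sum>w\<in>shuffles_perm m n. T (m + n) w (tconc s a b))"
proof (rule bilinear_tpower_eqI[where f = M and g = "\<lambda>a b. \<Sum>w\<in>shuffles_perm m n. T (m + n) w (tconc s a b)", OF _ _ _ _ _ a b])
  show "flin (\<lambda>a. M a b)" "flin (M a)" for a b by (rule flin_M)+
  show "flin (\<lambda>a. \<Sum>w\<in>shuffles_perm m n. T (m + n) w (tconc s a b))" for b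
    by (intro flin_sum_fun flin_comp[OF flin_T flin_tconc_left])
  show "flin (\<lambda>b. \<Sum>w\<in>shuffles_perm m n. T (m + n) w (tconc s a b))" for a
    by (intro flin_sum_fun flin_comp[OF flin_T flin_tconc_right[OF vs]])
  show "M (pure s xs) (pure s ys) = (\<Sum>w\<in>shuffles_perm m n. T (m + n) w (tconc s (pure s xs) (pure s ys)))"
    if "length xs = m" "length ys = n" for xs ys
    unfolding M_def tbil_pure[OF M_bimultilinear] tconc_pure[OF vs] that ..
qed

lemma bet_eq:
  assumes a: "a \<in> V m" and b: "b \<in> V n"
  shows "bet a b = cut2 s n (T (m + n) (chi m n) (tconc s a b))"
proof (rule bilinear_tpower_eqI[where f = bet and g = "\<lambda>a b. cut2 s n (T (m + n) (chi m n) (tconc s a b))", OF _ _ _ _ _ a b])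
  show "flin (\<lambda>a. bet a b)" "flin (bet a)" for a b by (rule flin_bet)+
  show "flin (\<lambda>a. cut2 s n (T (m + n) (chi m n) (tconc s a b)))" for b
    by (intro flin_comp[OF flin_cut2 flin_comp[OF flin_T flin_tconc_left]])
  show "flin (\<lambda>b. cut2 s n (T (m + n) (chi m n) (tconc s a b)))" for a
    by (intro flin_comp[OF flin_cut2 flin_comp[OF flin_T flin_tconc_right[OF vs]]])
  show "bet (pure s xs) (pure s ys) = cut2 s n (T (m + n) (chi m n) (tconc s (pure s xs) (pure s ys)))"
    if "length xs = m" "length ys = n" for xs ys
    unfolding bet_def tbil_pure[OF bet_bimultilinear] tconc_pure[OF vs] that ..
qed

lemma flin_Bt: "flin Bt"
  unfolding Bt_def by (rule flin_ext2)

lemma Bt_pure: "Bt (pure fscale [a, b]) = bet a b"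
  unfolding Bt_def by (rule ext2_pure[OF flin_bet])

lemma M_in: "a \<in> V m \<Longrightarrow> b \<in> V n \<Longrightarrow> M a b \<in> V (m + n)"
  unfolding M_eq by (intro fsubspace_sum[OF subspace_tpower] T_in tconc_in_tpower[OF vs])

lemma Bt_cut2:
  assumes Y: "Y \<in> V (i + j)"
  shows "Bt (cut2 s i Y) = cut2 s j (T (i + j) (chi i j) Y)"
proof (rule tpower_add_eqI[OF vs flin_comp[OF flin_Bt flin_cut2] flin_comp[OF flin_cut2 flin_T] _ Y])
  fix a b assume a: "a \<in> V i" and b: "b \<in> V j"
  show "Bt (cut2 s i (tconc s a b)) = cut2 s j (T (i + j) (chi i j) (tconc s a b))"
    unfolding cut2_tconc[OF vs a V_sub[OF b]] Bt_pure by (rule bet_eq[OF a b])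
qed

section \<open>Products of lifted block permutations\<close>

lemma perm_in_add: "w permutes {1..m} \<Longrightarrow> w permutes {1..m + n :: nat}"
  by (rule permutes_subset) auto

lemma shuffles_permD: "w \<in> shuffles_perm i j \<Longrightarrow> w permutes {1..i + j}"
  by (simp add: shuffles_perm_def)

lemma T_chi_add_left:
  assumes X: "X \<in> V (i + j + k)"
  shows "T (i + j + k) (chi i k) (T (i + j + k) (shift i (chi j k)) X) = T (i + j + k) (chi (i + j) k) X"
proof -
  have "chi i k permutes {1..i + k + j}" by (rule perm_in_add[OF chi_permutes])
  moreover have "shift i (chi j k) permutes {1..i + (j + k)}" by (rule shift_permutes_all[OF chi_permutes])
  ultimately show ?thesis
    unfolding chi_add_left
    by (intro T_comp[symmetric] compatible_chi_add_left X) (simp_all only: ac_simps)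
qed

lemma T_chi_add_right:
  assumes X: "X \<in> V (i + j + k)"
  shows "T (i + j + k) (shift j (chi i k)) (T (i + j + k) (chi i j) X) = T (i + j + k) (chi i (j + k)) X"
proof -
  have "chi i j permutes {1..i + j + k}" by (rule perm_in_add[OF chi_permutes])
  moreover have "shift j (chi i k) permutes {1..j + (i + k)}" by (rule shift_permutes_all[OF chi_permutes])
  ultimately show ?thesis
    unfolding chi_add_right
    by (intro T_comp[symmetric] compatible_chi_add_right X) (simp_all only: ac_simps)
qed

lemma T_chi_comp_left:
  assumes v: "v permutes {1..m}" and X: "X \<in> V (m + k)"
  shows "T (m + k) (chi m k) (T (m + k) v X) = T (m + k) (shift k v) (T (m + k) (chi m k) X)"
proof -
  have s: "shift k v permutes {1..m + k}" using shift_permutes_all[OF v, of k] by (simp only: ac_simps)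
  have "T (m + k) (chi m k) (T (m + k) v X) = T (m + k) (chi m k \<circ> v) X"
    by (rule T_comp[symmetric, OF chi_permutes perm_in_add[OF v] compatible_if_mono[OF v chi_strict_mono(1)] X])
  also have "\<dots> = T (m + k) (shift k v) (T (m + k) (chi m k) X)"
    unfolding chi_comp_left[OF v] by (rule T_comp[OF s chi_permutes compatible_shift_chi[OF v] X])
  finally show ?thesis .
qed

lemma T_chi_comp_right:
  assumes v: "v permutes {1..k}" and X: "X \<in> V (i + k)"
  shows "T (i + k) (chi i k) (T (i + k) (shift i v) X) = T (i + k) v (T (i + k) (chi i k) X)"
proof -
  have s: "v permutes {1..i + k}" using perm_in_add[OF v, of i] by (simp only: ac_simps)
  have "T (i + k) (chi i k) (T (i + k) (shift i v) X) = T (i + k) (chi i k \<circ> shift i v) X"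
    by (rule T_comp[symmetric, OF chi_permutes shift_permutes_all[OF v]
          compatible_shift_if_mono[OF v chi_strict_mono(2)] X])
  also have "\<dots> = T (i + k) v (T (i + k) (chi i k) X)"
    unfolding chi_comp_right[OF v] by (rule T_comp[OF s chi_permutes compatible_left_chi[OF v] X])
  finally show ?thesis .
qed

section \<open>The braid equation for \<beta>\<close>

abbreviation b1 :: "(('v, 'k) tens, 'k) tens \<Rightarrow> (('v, 'k) tens, 'k) tens" where "b1 \<equiv> sg fscale Bt 1"
abbreviation b2 :: "(('v, 'k) tens, 'k) tens \<Rightarrow> (('v, 'k) tens, 'k) tens" where "b2 \<equiv> sg fscale Bt 2"

lemma b_pure:
  "b1 (pure fscale [a, b, c]) = tconc fscale (bet a b) (pure fscale [c])"
  "b2 (pure fscale [a, b, c]) = tconc fscale (pure fscale [a]) (bet b c)"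
proof -
  note fs = vector_space_fscale
  note n = tconc_Nil[OF fs]
  have "tconc fscale (tconc fscale (pure fscale []) (bet a b)) (pure fscale [c]) = tconc fscale (bet a b) (pure fscale [c])"
    unfolding tconc_assoc[OF fs] by (rule n(1)[OF tconc_in_tensor_space[OF fs]])
  moreover have "tconc fscale (tconc fscale (pure fscale [a]) (bet b c)) (pure fscale []) = tconc fscale (pure fscale [a]) (bet b c)"
    by (rule n(2)[OF tconc_in_tensor_space[OF fs]])
  ultimately show "b1 (pure fscale [a, b, c]) = tconc fscale (bet a b) (pure fscale [c])"
    "b2 (pure fscale [a, b, c]) = tconc fscale (pure fscale [a]) (bet b c)"
    by (simp_all add: sg_pure[OF fs flin_Bt] sg_body_def Bt_pure)
qed

lemma tconc_cut2_left:
  assumes Z: "Z \<in> V (i + j)" and c: "c \<in> tensor_space s"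
  shows "tconc fscale (cut2 s i Z) (pure fscale [c]) = cut3 s i j (tconc s Z c)"
proof (rule tpower_add_eqI[OF vs flin_comp[OF flin_tconc_left flin_cut2] flin_comp[OF flin_cut3 flin_tconc_left] _ Z])
  fix a b assume a: "a \<in> V i" and b: "b \<in> V j"
  show "tconc fscale (cut2 s i (tconc s a b)) (pure fscale [c]) = cut3 s i j (tconc s (tconc s a b) c)"
    unfolding cut2_tconc[OF vs a V_sub[OF b]] cut3_tconc[OF vs a b c] tconc_pure[OF vector_space_fscale] by simp
qed

lemma tconc_cut2_right:
  assumes a: "a \<in> V i" and Z: "Z \<in> V (j + k)"
  shows "tconc fscale (pure fscale [a]) (cut2 s j Z) = cut3 s i j (tconc s a Z)"
proof (rule tpower_add_eqI[OF vs flin_comp[OF flin_tconc_right[OF vector_space_fscale] flin_cut2]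
      flin_comp[OF flin_cut3 flin_tconc_right[OF vs]] _ Z])
  fix b c assume b: "b \<in> V j" and c: "c \<in> V k"
  show "tconc fscale (pure fscale [a]) (cut2 s j (tconc s b c)) = cut3 s i j (tconc s a (tconc s b c))"
    unfolding cut2_tconc[OF vs b V_sub[OF c]] tconc_assoc[OF vs, symmetric] cut3_tconc[OF vs a b V_sub[OF c]]
      tconc_pure[OF vector_space_fscale] by simp
qed

lemma V_triple_eqI:
  assumes f: "flin f" and g: "flin g" and Y: "Y \<in> V (i + j + k)"
    and eq: "\<And>a b c. a \<in> V i \<Longrightarrow> b \<in> V j \<Longrightarrow> c \<in> V k \<Longrightarrow> f (tconc s (tconc s a b) c) = g (tconc s (tconc s a b) c)"
  shows "f Y = g Y"
proof (rule tpower_add_eqI[OF vs f g _ Y])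
  fix X c assume X: "X \<in> V (i + j)" and c: "c \<in> V k"
  show "f (tconc s X c) = g (tconc s X c)"
    by (rule tpower_add_eqI[OF vs flin_comp[OF f flin_tconc_left] flin_comp[OF g flin_tconc_left] _ X])
      (rule eq[OF _ _ c])
qed

text \<open>In total degree \<open>i + j + k\<close> the operator \<beta> \<otimes> id is one lifted
  permutation, because \<open>chi i j\<close> fixes the last \<open>k\<close> letters; the cut
  positions record the exchange of degrees.\<close>

lemma b1_cut3:
  assumes Y: "Y \<in> V (i + j + k)"
  shows "b1 (cut3 s i j Y) = cut3 s j i (T (i + j + k) (chi i j) Y)"
proof (rule V_triple_eqI[OF flin_comp[OF flin_sg flin_cut3] flin_comp[OF flin_cut3 flin_T] Y])
  fix a b c assume a: "a \<in> V i" and b: "b \<in> V j" and c: "c \<in> V k"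
  have ab: "tconc s a b \<in> V (i + j)" by (rule tconc_in_tpower[OF vs a b])
  have T: "T (i + j) (chi i j) (tconc s a b) \<in> V (j + i)" using T_in[OF ab] by (simp only: ac_simps)
  have "b1 (cut3 s i j (tconc s (tconc s a b) c)) = tconc fscale (bet a b) (pure fscale [c])"
    unfolding cut3_tconc[OF vs a b V_sub[OF c]] by (rule b_pure)
  also have "\<dots> = cut3 s j i (tconc s (T (i + j) (chi i j) (tconc s a b)) c)"
    unfolding bet_eq[OF a b] by (rule tconc_cut2_left[OF T V_sub[OF c]])
  also have "\<dots> = cut3 s j i (T (i + j + k) (chi i j) (tconc s (tconc s a b) c))"
    unfolding T_left[OF chi_permutes ab c] ..
  finally show "b1 (cut3 s i j (tconc s (tconc s a b) c)) = cut3 s j i (T (i + j + k) (chi i j) (tconc s (tconc s a b) c))" .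
qed

lemma b2_cut3:
  assumes Y: "Y \<in> V (i + j + k)"
  shows "b2 (cut3 s i j Y) = cut3 s i k (T (i + j + k) (shift i (chi j k)) Y)"
proof (rule V_triple_eqI[OF flin_comp[OF flin_sg flin_cut3] flin_comp[OF flin_cut3 flin_T] Y])
  fix a b c assume a: "a \<in> V i" and b: "b \<in> V j" and c: "c \<in> V k"
  have bc: "tconc s b c \<in> V (j + k)" by (rule tconc_in_tpower[OF vs b c])
  have T: "T (j + k) (chi j k) (tconc s b c) \<in> V (k + j)" using T_in[OF bc] by (simp only: ac_simps)
  have "b2 (cut3 s i j (tconc s (tconc s a b) c)) = tconc fscale (pure fscale [a]) (bet b c)"
    unfolding cut3_tconc[OF vs a b V_sub[OF c]] by (rule b_pure)
  also have "\<dots> = cut3 s i k (tconc s a (T (j + k) (chi j k) (tconc s b c)))"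
    unfolding bet_eq[OF b c] by (rule tconc_cut2_right[OF a T])
  also have "\<dots> = cut3 s i k (T (i + (j + k)) (shift i (chi j k)) (tconc s a (tconc s b c)))"
    unfolding T_right[OF chi_permutes a bc] ..
  finally show "b2 (cut3 s i j (tconc s (tconc s a b) c)) = cut3 s i k (T (i + j + k) (shift i (chi j k)) (tconc s (tconc s a b) c))"
    by (simp only: tconc_assoc[OF vs] add.assoc)
qed

lemma V_cong: "X \<in> V m \<Longrightarrow> m = n \<Longrightarrow> X \<in> V n" by simp

lemma Bt_in:
  assumes X: "X \<in> tpower fscale (tensor_space s) 2"
  shows "Bt X \<in> tpower fscale (tensor_space s) 2"
proof (rule tpower_mem[OF flin_Bt subspace_tpower _ X])
  fix ts :: "('v, 'k) tens list" assume ts: "set ts \<subseteq> tensor_space s" "length ts = 2"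
  then obtain a b where ab: "ts = [a, b]" "a \<in> tensor_space s" "b \<in> tensor_space s"
    by (auto simp: numeral_2_eq_2 length_Suc_conv)
  have "bet a b \<in> tpower fscale (tensor_space s) 2"
  proof (rule bilinear_tensor_mem[OF flin_bet subspace_tpower _ ab(2,3)])
    fix xs ys :: "'v list"
    have x: "pure s xs \<in> V (length xs)" and y: "pure s ys \<in> V (length ys)" by (auto intro: pure_in_tpower)
    show "bet (pure s xs) (pure s ys) \<in> tpower fscale (tensor_space s) 2"
      unfolding bet_eq[OF x y]
      by (rule cut2_in[OF vs, of _ _ "length xs"]) (rule V_cong[OF T_in[OF tconc_in_tpower[OF vs x y]]], simp)
  qed
  then show "Bt (pure fscale ts) \<in> tpower fscale (tensor_space s) 2" unfolding ab(1) Bt_pure .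
qed

lemma braid_Bt:
  assumes X: "X \<in> tpower fscale (tensor_space s) 3"
  shows "b1 (b2 (b1 X)) = b2 (b1 (b2 X))"
proof (rule tensor_triple_eqI[OF vs, of "\<lambda>X. b1 (b2 (b1 X))" "\<lambda>X. b2 (b1 (b2 X))", OF _ _ _ X])
  show "flin (\<lambda>X. b1 (b2 (b1 X)))" "flin (\<lambda>X. b2 (b1 (b2 X)))"
    by (intro flin_comp[OF flin_sg flin_comp[OF flin_sg flin_sg]])+
  fix i j k Y assume Y: "Y \<in> V (i + j + k)"
  let ?T = "T (i + j + k)"
  have in_V: "?T w Z \<in> V n" if "Z \<in> V (i + j + k)" "n = i + j + k" for w Z n
    using T_in that by simp
  have "b1 (b2 (b1 (cut3 s i j Y))) = cut3 s k j (?T (chi j k) (?T (shift j (chi i k)) (?T (chi i j) Y)))"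
    using b1_cut3[OF Y] b2_cut3[of "?T (chi i j) Y" j i k]
      b1_cut3[of "?T (shift j (chi i k)) (?T (chi i j) Y)" j k i] in_V[OF Y] in_V[OF in_V[OF Y refl]]
    by (simp add: ac_simps)
  also have "\<dots> = cut3 s k j (?T (chi j k) (?T (chi i (j + k)) Y))"
    by (simp only: T_chi_add_right[OF Y])
  \<comment> \<open>\<open>chi j k\<close> acts on the block of \<open>j + k\<close> letters after
    it has moved to the front; pulled through \<open>chi i (j + k)\<close> it acts on that block in
    its original place.\<close>
  also have "\<dots> = cut3 s k j (?T (chi i (k + j)) (?T (shift i (chi j k)) Y))"
    using T_chi_comp_right[OF chi_permutes[of j k], of Y i] Y by (simp add: ac_simps)
  also have "\<dots> = cut3 s k j (?T (shift k (chi i j)) (?T (chi i k) (?T (shift i (chi j k)) Y)))"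
    using T_chi_add_right[of "?T (shift i (chi j k)) Y" i k j] in_V[OF Y] by (simp add: ac_simps)
  also have "\<dots> = b2 (b1 (b2 (cut3 s i j Y)))"
    using b2_cut3[OF Y] b1_cut3[of "?T (shift i (chi j k)) Y" i k j]
      b2_cut3[of "?T (chi i k) (?T (shift i (chi j k)) Y)" k i j] in_V[OF Y] in_V[OF in_V[OF Y refl]]
    by (simp add: ac_simps)
  finally show "b1 (b2 (b1 (cut3 s i j Y))) = b2 (b1 (b2 (cut3 s i j Y)))" .
qed

section \<open>Compatibility of \<beta> with the product\<close>

definition Ml :: "(('v, 'k) tens, 'k) tens \<Rightarrow> (('v, 'k) tens, 'k) tens" where
  "Ml = ext3 (\<lambda>a b c. pure fscale [M a b, c])"

definition Mr :: "(('v, 'k) tens, 'k) tens \<Rightarrow> (('v, 'k) tens, 'k) tens" where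
  "Mr = ext3 (\<lambda>a b c. pure fscale [a, M b c])"

lemma flin_Ml: "flin Ml" and flin_Mr: "flin Mr"
  unfolding Ml_def Mr_def by (rule flin_ext3)+

lemma Ml_pure: "Ml (pure fscale [a, b, c]) = pure fscale [M a b, c]"
  unfolding Ml_def
  by (rule ext3_pure[OF flin_comp[OF flin_pure_slots(1) flin_M(1)] flin_comp[OF flin_pure_slots(1) flin_M(2)] flin_pure_slots(2)])

lemma Mr_pure: "Mr (pure fscale [a, b, c]) = pure fscale [a, M b c]"
  unfolding Mr_def
  by (rule ext3_pure[OF flin_pure_slots(1) flin_comp[OF flin_pure_slots(2) flin_M(1)] flin_comp[OF flin_pure_slots(2) flin_M(2)]])

lemma Ml_cut3:
  assumes Y: "Y \<in> V (i + j + k)"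
  shows "Ml (cut3 s i j Y) = (\<Sum>v\<in>shuffles_perm i j. cut2 s (i + j) (T (i + j + k) v Y))"
proof (rule V_triple_eqI[OF flin_comp[OF flin_Ml flin_cut3] flin_sum_fun[OF flin_comp[OF flin_cut2 flin_T]] Y])
  fix a b c assume a: "a \<in> V i" and b: "b \<in> V j" and c: "c \<in> V k"
  have ab: "tconc s a b \<in> V (i + j)" by (rule tconc_in_tpower[OF vs a b])
  have "Ml (cut3 s i j (tconc s (tconc s a b) c)) = (\<Sum>v\<in>shuffles_perm i j. pure fscale [T (i + j) v (tconc s a b), c])"
    unfolding cut3_tconc[OF vs a b V_sub[OF c]] Ml_pure M_eq[OF a b] by (rule flin_sum[OF flin_pure_slots(1)])
  also have "\<dots> = (\<Sum>v\<in>shuffles_perm i j. cut2 s (i + j) (T (i + j + k) v (tconc s (tconc s a b) c)))"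
    by (intro sum.cong refl) (simp only: T_left[OF shuffles_permD ab c] cut2_tconc[OF vs T_in[OF ab] V_sub[OF c]])
  finally show "Ml (cut3 s i j (tconc s (tconc s a b) c)) =
    (\<Sum>v\<in>shuffles_perm i j. cut2 s (i + j) (T (i + j + k) v (tconc s (tconc s a b) c)))" .
qed

lemma Mr_cut3:
  assumes Y: "Y \<in> V (i + j + k)"
  shows "Mr (cut3 s i j Y) = (\<Sum>v\<in>shuffles_perm j k. cut2 s i (T (i + j + k) (shift i v) Y))"
proof (rule V_triple_eqI[OF flin_comp[OF flin_Mr flin_cut3] flin_sum_fun[OF flin_comp[OF flin_cut2 flin_T]] Y])
  fix a b c assume a: "a \<in> V i" and b: "b \<in> V j" and c: "c \<in> V k"
  have bc: "tconc s b c \<in> V (j + k)" by (rule tconc_in_tpower[OF vs b c])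
  have "Mr (cut3 s i j (tconc s (tconc s a b) c)) = (\<Sum>v\<in>shuffles_perm j k. pure fscale [a, T (j + k) v (tconc s b c)])"
    unfolding cut3_tconc[OF vs a b V_sub[OF c]] Mr_pure M_eq[OF b c] by (rule flin_sum[OF flin_pure_slots(2)])
  also have "\<dots> = (\<Sum>v\<in>shuffles_perm j k. cut2 s i (T (i + (j + k)) (shift i v) (tconc s a (tconc s b c))))"
    by (intro sum.cong refl) (simp only: T_right[OF shuffles_permD a bc] cut2_tconc[OF vs a V_sub[OF T_in[OF bc]]])
  finally show "Mr (cut3 s i j (tconc s (tconc s a b) c)) =
    (\<Sum>v\<in>shuffles_perm j k. cut2 s i (T (i + j + k) (shift i v) (tconc s (tconc s a b) c)))"
    by (simp only: tconc_assoc[OF vs] add.assoc)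
qed

lemma Bt_Ml:
  assumes X: "X \<in> tpower fscale (tensor_space s) 3"
  shows "Bt (Ml X) = Mr (b1 (b2 X))"
proof (rule tensor_triple_eqI[OF vs, of "\<lambda>X. Bt (Ml X)" "\<lambda>X. Mr (b1 (b2 X))", OF _ _ _ X])
  show "flin (\<lambda>X. Bt (Ml X))" "flin (\<lambda>X. Mr (b1 (b2 X)))"
    by (intro flin_comp[OF flin_Bt flin_Ml] flin_comp[OF flin_Mr flin_comp[OF flin_sg flin_sg]])+
  fix i j k Y assume Y: "Y \<in> V (i + j + k)"
  let ?T = "T (i + j + k)"
  have in_V: "?T w Z \<in> V n" if "Z \<in> V (i + j + k)" "n = i + j + k" for w Z n
    using T_in that by simp
  have "Bt (Ml (cut3 s i j Y)) = (\<Sum>v\<in>shuffles_perm i j. cut2 s k (?T (chi (i + j) k) (?T v Y)))"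
    unfolding Ml_cut3[OF Y] flin_sum[OF flin_Bt] by (simp only: Bt_cut2[OF T_in[OF Y]])
  \<comment> \<open>\<open>chi (i + j) k\<close> carries the block permuted by \<open>v\<close>
    behind \<open>k\<close> letters, where \<open>v\<close> becomes \<open>shift k v\<close>, the
    permutation whose lift is summed in \<open>Mr_cut3\<close>.\<close>
  also have "\<dots> = (\<Sum>v\<in>shuffles_perm i j. cut2 s k (?T (shift k v) (?T (chi (i + j) k) Y)))"
    by (intro sum.cong refl) (simp only: T_chi_comp_left[OF shuffles_permD Y])
  also have "\<dots> = Mr (cut3 s k i (?T (chi (i + j) k) Y))"
    using Mr_cut3[of "?T (chi (i + j) k) Y" k i j] in_V[OF Y] by (simp add: ac_simps)
  also have "\<dots> = Mr (b1 (b2 (cut3 s i j Y)))"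
    using b2_cut3[OF Y] b1_cut3[of "?T (shift i (chi j k)) Y" i k j] in_V[OF Y] T_chi_add_left[OF Y]
    by (simp add: ac_simps)
  finally show "Bt (Ml (cut3 s i j Y)) = Mr (b1 (b2 (cut3 s i j Y)))" .
qed

lemma Bt_Mr:
  assumes X: "X \<in> tpower fscale (tensor_space s) 3"
  shows "Bt (Mr X) = Ml (b2 (b1 X))"
proof (rule tensor_triple_eqI[OF vs, of "\<lambda>X. Bt (Mr X)" "\<lambda>X. Ml (b2 (b1 X))", OF _ _ _ X])
  show "flin (\<lambda>X. Bt (Mr X))" "flin (\<lambda>X. Ml (b2 (b1 X)))"
    by (intro flin_comp[OF flin_Bt flin_Mr] flin_comp[OF flin_Ml flin_comp[OF flin_sg flin_sg]])+
  fix i j k Y assume Y: "Y \<in> V (i + j + k)"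
  let ?T = "T (i + j + k)"
  have in_V: "?T w Z \<in> V n" if "Z \<in> V (i + j + k)" "n = i + j + k" for w Z n
    using T_in that by simp
  have "Bt (Mr (cut3 s i j Y)) = (\<Sum>v\<in>shuffles_perm j k. cut2 s (j + k) (?T (chi i (j + k)) (?T (shift i v) Y)))"
    unfolding Mr_cut3[OF Y] flin_sum[OF flin_Bt]
    by (intro sum.cong refl) (use Bt_cut2[of _ i "j + k"] in_V[OF Y] in \<open>simp add: ac_simps\<close>)
  also have "\<dots> = (\<Sum>v\<in>shuffles_perm j k. cut2 s (j + k) (?T v (?T (chi i (j + k)) Y)))"
    by (intro sum.cong refl) (use T_chi_comp_right[OF shuffles_permD, of _ j k Y i] Y in \<open>simp add: ac_simps\<close>)
  also have "\<dots> = Ml (cut3 s j k (?T (chi i (j + k)) Y))"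
    using Ml_cut3[of "?T (chi i (j + k)) Y" j k i] in_V[OF Y] by (simp add: ac_simps)
  also have "\<dots> = Ml (b2 (b1 (cut3 s i j Y)))"
    using b1_cut3[OF Y] b2_cut3[of "?T (chi i j) Y" j i k] in_V[OF Y] T_chi_add_right[OF Y]
    by (simp add: ac_simps)
  finally show "Bt (Mr (cut3 s i j Y)) = Ml (b2 (b1 (cut3 s i j Y)))" .
qed

text \<open>A block transposition with an empty block is the identity, so only the position of the
  cut changes.\<close>

lemma Bt_unit:
  assumes a: "a \<in> tensor_space s"
  shows "Bt (pure fscale [pure s [], a]) = pure fscale [a, pure s []]"
    "Bt (pure fscale [a, pure s []]) = pure fscale [pure s [], a]"
proof -
  have e: "pure s [] \<in> V 0" by (rule pure_in_tpower) auto
  have x: "pure s xs \<in> V (length xs)" for xs by (rule pure_in_tpower) auto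
  have "bet (pure s []) (pure s xs) = pure fscale [pure s xs, pure s []]" for xs
    using cut2_tconc[OF vs x[of xs] V_sub[OF e]]
    by (simp add: bet_eq[OF e x] chi_0 tconc_pure[OF vs] T_id[OF x])
  then show "Bt (pure fscale [pure s [], a]) = pure fscale [a, pure s []]"
    unfolding Bt_pure by (rule tensor_eqI[OF flin_bet(2) flin_pure_slots(1) _ a])
  have "bet (pure s xs) (pure s []) = pure fscale [pure s [], pure s xs]" for xs
    using cut2_tconc[OF vs e V_sub[OF x[of xs]]]
    by (simp add: bet_eq[OF x e] chi_0 tconc_pure[OF vs] T_id[OF x])
  then show "Bt (pure fscale [a, pure s []]) = pure fscale [pure s [], a]"
    unfolding Bt_pure by (rule tensor_eqI[OF flin_bet(1) flin_pure_slots(2) _ a])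
qed

section \<open>Unit and associativity of the shuffle product\<close>

lemma M_unit:
  assumes a: "a \<in> tensor_space s" shows "M (pure s []) a = a" "M a (pure s []) = a"
proof -
  have e: "pure s [] \<in> V 0" by (rule pure_in_tpower) auto
  have x: "pure s xs \<in> V (length xs)" for xs by (rule pure_in_tpower) auto
  have "M (pure s []) (pure s xs) = pure s xs" "M (pure s xs) (pure s []) = pure s xs" for xs
    by (simp_all add: M_eq[OF e x] M_eq[OF x e] shuffles_perm_0 tconc_pure[OF vs] T_id[OF x])
  then show "M (pure s []) a = a" "M a (pure s []) = a"
    by (intro tensor_eqI[OF flin_M(2) flin_id _ a] tensor_eqI[OF flin_M(1) flin_id _ a]; simp)+
qed

lemma M_in_tensor_space:
  assumes "a \<in> tensor_space s" "b \<in> tensor_space s" shows "M a b \<in> tensor_space s"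
  by (rule bilinear_tensor_mem[OF flin_M subspace_tensor_space _ assms])
    (rule V_sub[OF M_in[OF pure_in_tpower[OF subset_UNIV refl] pure_in_tpower[OF subset_UNIV refl]]])

lemma M_assoc_homogeneous:
  assumes a: "a \<in> V i" and b: "b \<in> V j" and c: "c \<in> V k"
  shows "M (M a b) c = M a (M b c)"
proof -
  let ?T = "T (i + j + k)" and ?Y = "tconc s (tconc s a b) c"
  have ab: "tconc s a b \<in> V (i + j)" and bc: "tconc s b c \<in> V (j + k)" by (intro tconc_in_tpower[OF vs] a b c)+
  have Y: "?Y \<in> V (i + j + k)" by (rule tconc_in_tpower[OF vs ab c])
  have "M (M a b) c = (\<Sum>w\<in>shuffles_perm (i + j) k. \<Sum>v\<in>shuffles_perm i j. ?T (w \<circ> v) ?Y)"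
    unfolding M_eq[OF M_in[OF a b] c]
  proof (intro sum.cong refl)
    fix w assume w: "w \<in> shuffles_perm (i + j) k"
    have "?T w (tconc s (M a b) c) = (\<Sum>v\<in>shuffles_perm i j. ?T w (tconc s (T (i + j) v (tconc s a b)) c))"
      unfolding M_eq[OF a b] by (rule flin_sum[OF flin_comp[OF flin_T flin_tconc_left]])
    also have "\<dots> = (\<Sum>v\<in>shuffles_perm i j. ?T (w \<circ> v) ?Y)"
    proof (intro sum.cong refl)
      fix v assume v: "v \<in> shuffles_perm i j"
      \<comment> \<open>\<open>w\<close> increases on the merged block {1..i + j}, which is the
        block that \<open>v\<close> permutes, so the lengths add.\<close>
      have "?T (w \<circ> v) ?Y = ?T w (?T v ?Y)"
        by (rule T_comp[OF shuffles_permD[OF w] perm_in_add[OF shuffles_permD[OF v]]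
              compatible_if_mono[OF shuffles_permD[OF v]] Y])
          (use w in \<open>simp add: shuffles_perm_def\<close>)
      then show "?T w (tconc s (T (i + j) v (tconc s a b)) c) = ?T (w \<circ> v) ?Y"
        by (simp only: T_left[OF shuffles_permD[OF v] ab c])
    qed
    finally show "?T w (tconc s (M a b) c) = (\<Sum>v\<in>shuffles_perm i j. ?T (w \<circ> v) ?Y)" .
  qed
  also have "\<dots> = (\<Sum>u\<in>shuffles3_perm i j k. ?T u ?Y)"
    unfolding sum.cartesian_product
    using sum.reindex_bij_betw[OF shuffles3_bij_left, of "\<lambda>u. ?T u ?Y"] by (simp add: case_prod_unfold)
  also have "\<dots> = (\<Sum>w\<in>shuffles_perm i (j + k). \<Sum>v\<in>shuffles_perm j k. ?T (w \<circ> shift i v) ?Y)"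
    unfolding sum.cartesian_product
    using sum.reindex_bij_betw[OF shuffles3_bij_right, of "\<lambda>u. ?T u ?Y"] by (simp add: case_prod_unfold)
  also have "\<dots> = M a (M b c)"
    unfolding M_eq[OF a M_in[OF b c]]
  proof (intro sum.cong refl)
    fix w assume w: "w \<in> shuffles_perm i (j + k)"
    have Y': "tconc s a (tconc s b c) \<in> V (i + (j + k))" by (rule tconc_in_tpower[OF vs a bc])
    have "(\<Sum>v\<in>shuffles_perm j k. T (i + (j + k)) (w \<circ> shift i v) (tconc s a (tconc s b c)))
        = (\<Sum>v\<in>shuffles_perm j k. T (i + (j + k)) w (tconc s a (T (j + k) v (tconc s b c))))"
    proof (intro sum.cong refl)
      fix v assume v: "v \<in> shuffles_perm j k"
      have "T (i + (j + k)) (w \<circ> shift i v) (tconc s a (tconc s b c)) =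
          T (i + (j + k)) w (T (i + (j + k)) (shift i v) (tconc s a (tconc s b c)))"
        by (rule T_comp[OF shuffles_permD[OF w] shift_permutes_all[OF shuffles_permD[OF v]]
              compatible_shift_if_mono[OF shuffles_permD[OF v]] Y'])
          (use w in \<open>simp add: shuffles_perm_def\<close>)
      then show "T (i + (j + k)) (w \<circ> shift i v) (tconc s a (tconc s b c)) =
          T (i + (j + k)) w (tconc s a (T (j + k) v (tconc s b c)))"
        by (simp only: T_right[OF shuffles_permD[OF v] a bc])
    qed
    also have "\<dots> = T (i + (j + k)) w (tconc s a (M b c))"
      unfolding M_eq[OF b c] by (rule flin_sum[OF flin_comp[OF flin_T flin_tconc_right[OF vs]], symmetric])
    finally show "(\<Sum>v\<in>shuffles_perm j k. ?T (w \<circ> shift i v) ?Y) = T (i + (j + k)) w (tconc s a (M b c))"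
      by (simp only: tconc_assoc[OF vs] add.assoc)
  qed
  finally show ?thesis .
qed

lemma M_assoc:
  assumes a: "a \<in> tensor_space s" and b: "b \<in> tensor_space s" and c: "c \<in> tensor_space s"
  shows "M (M a b) c = M a (M b c)"
proof -
  have x: "pure s xs \<in> V (length xs)" for xs by (rule pure_in_tpower) auto
  have "M (M a b) (pure s zs) = M a (M b (pure s zs))" for zs
    by (rule bilinear_tensor_eqI[where f = "\<lambda>a b. M (M a b) (pure s zs)" and g = "\<lambda>a b. M a (M b (pure s zs))",
          OF flin_comp[OF flin_M(1) flin_M(1)] flin_comp[OF flin_M(1) flin_M(2)] flin_M(1)
            flin_comp[OF flin_M(2) flin_M(1)] _ a b])
      (rule M_assoc_homogeneous[OF x x x])
  then show ?thesis
    by (rule tensor_eqI[OF flin_M(2) flin_comp[OF flin_M(2) flin_M(2)] _ c])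
qed

end

text \<open>In degrees \<open>i\<close> and \<open>j\<close> the first operator lifts
  \<open>chi i j\<close> and moves the cut to \<open>j\<close>; the second lifts
  \<open>chi j i\<close>, the inverse permutation, through \<open>B'\<close> and moves the cut back
  to \<open>i\<close>.\<close>

lemma Bt_inverse:
  assumes "braiding s B" "braiding s B'"
    and inv: "\<And>X. X \<in> tpower s UNIV 2 \<Longrightarrow> B' (B X) = X"
    and X: "X \<in> tpower fscale (tensor_space s) 2"
  shows "braiding.Bt s B' (braiding.Bt s B X) = X"
proof -
  interpret B: braiding s B by fact
  interpret B': braiding s B' by fact
  show ?thesis
  proof (rule tensor_pair_eqI[OF B.vs flin_comp[OF B'.flin_Bt B.flin_Bt] flin_id _ X])
    fix i j Y assume Y: "Y \<in> tpower s UNIV (i + j)"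
    have Z: "B.T (i + j) (chi i j) Y \<in> tpower s UNIV (j + i)" using B.T_in[OF Y] by (simp only: ac_simps)
    have "B'.T (i + j) (chi j i) (B.T (i + j) (chi i j) Y) = Y"
      using T_inverse[where s = s and B = B and B' = B' and w = "chi i j" and n = "i + j" and X = Y, OF assms(1-3) chi_permutes Y]
      unfolding inv_chi .
    then show "B'.Bt (B.Bt (cut2 s i Y)) = cut2 s i Y"
      using B.Bt_cut2[OF Y] B'.Bt_cut2[OF Z] by (simp only: ac_simps)
  qed
qed

section \<open>Generated subalgebras\<close>

text \<open>Two possibly different factors, because the first induction in
  \<open>braiding_preserves_qsym\<close> needs V \<otimes> S.\<close>

definition tens2 :: "('x \<Rightarrow> 'k::field) set \<Rightarrow> ('x \<Rightarrow> 'k) set \<Rightarrow> ('x \<Rightarrow> 'k, 'k) tens set" where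
  "tens2 P Q = module.span fscale {pure fscale [p, q] | p q. p \<in> P \<and> q \<in> Q}"

lemma subspace_tens2: "module.subspace fscale (tens2 P Q)"
  unfolding tens2_def by (rule fsubspace_span)

lemma pure_in_tens2: "p \<in> P \<Longrightarrow> q \<in> Q \<Longrightarrow> pure fscale [p, q] \<in> tens2 P Q"
  unfolding tens2_def by (intro fspan_base) auto

lemma tens2_mono: "P \<subseteq> P' \<Longrightarrow> Q \<subseteq> Q' \<Longrightarrow> tens2 P Q \<subseteq> tens2 P' Q'"
  unfolding tens2_def by (rule fspan_mono) auto

lemma tens2_mem:
  assumes "flin f" "module.subspace fscale W" "\<And>p q. p \<in> P \<Longrightarrow> q \<in> Q \<Longrightarrow> f (pure fscale [p, q]) \<in> W"
    and "X \<in> tens2 P Q"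
  shows "f X \<in> W"
  by (rule flin_span_mem[OF assms(1,2) _ assms(4)[unfolded tens2_def]]) (use assms(3) in auto)

lemma tpower_2_eq_tens2: "tpower fscale A 2 = tens2 A A"
proof -
  have "pure fscale ` {xs. set xs \<subseteq> A \<and> length xs = 2} = {pure fscale [p, q] | p q. p \<in> A \<and> q \<in> A}"
  proof (intro set_eqI iffI)
    fix X assume "X \<in> pure fscale ` {xs. set xs \<subseteq> A \<and> length xs = 2}"
    then obtain xs where xs: "set xs \<subseteq> A" "length xs = 2" "X = pure fscale xs" by blast
    then obtain p q where "xs = [p, q]" by (auto simp: numeral_2_eq_2 length_Suc_conv)
    with xs have "p \<in> A" "q \<in> A" "X = pure fscale [p, q]" by simp_all
    then show "X \<in> {pure fscale [p, q] | p q. p \<in> A \<and> q \<in> A}" by blast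
  next
    fix X assume "X \<in> {pure fscale [p, q] | p q. p \<in> A \<and> q \<in> A}"
    then obtain p q where "p \<in> A" "q \<in> A" "X = pure fscale [p, q]" by blast
    then show "X \<in> pure fscale ` {xs. set xs \<subseteq> A \<and> length xs = 2}"
      by (intro rev_image_eqI[of "[p, q]"]) auto
  qed
  then show ?thesis by (simp only: tpower_def tens2_def)
qed

lemma subalgebra_cong:
  assumes "\<And>x y. x \<in> A \<Longrightarrow> y \<in> A \<Longrightarrow> m x y = m' x y"
  shows "subalgebra s A m e B \<longleftrightarrow> subalgebra s A m' e B"
  unfolding subalgebra_def using assms by (metis subsetD)

text \<open>Membership is part of the set that has to be a subalgebra, so closure under products may
  use that both factors lie in the generated subalgebra.\<close>

lemma generated_subalgebra_induct:
  assumes "subalgebra s A m e {a \<in> generated_subalgebra s A m e G. P a}"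
    and "G \<subseteq> {a \<in> generated_subalgebra s A m e G. P a}" and "a \<in> generated_subalgebra s A m e G"
  shows "P a"
  using assms unfolding generated_subalgebra_def by blast

lemma subalgebra_generated:
  assumes "module s" "subalgebra s A m e A" "G \<subseteq> A"
  shows "subalgebra s A m e (generated_subalgebra s A m e G)" "G \<subseteq> generated_subalgebra s A m e G"
proof -
  show "G \<subseteq> generated_subalgebra s A m e G" by (auto simp: generated_subalgebra_def)
  have sub: "generated_subalgebra s A m e G \<subseteq> A" using assms by (auto simp: generated_subalgebra_def)
  have "module.subspace s (generated_subalgebra s A m e G)"
    unfolding generated_subalgebra_def
    by (rule module.subspace_Inter[OF assms(1)]) (auto simp: subalgebra_def)
  then show "subalgebra s A m e (generated_subalgebra s A m e G)"
    unfolding subalgebra_def using sub by (auto simp: generated_subalgebra_def subalgebra_def)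
qed

context braiding
begin

definition qsym :: "('v, 'k) tens set" where
  "qsym = generated_subalgebra fscale (tensor_space s) M (pure s []) (range (\<lambda>v. pure s [v]))"

lemma subalgebra_tensor_space: "subalgebra fscale (tensor_space s) M (pure s []) (tensor_space s)"
  by (simp add: subalgebra_def subspace_tensor_space pure_in_tensor_space M_in_tensor_space)

lemma subalgebra_qsym: "subalgebra fscale (tensor_space s) M (pure s []) qsym"
  and V1_subset_qsym: "range (\<lambda>v. pure s [v]) \<subseteq> qsym"
  unfolding qsym_def
  by (rule subalgebra_generated[OF module_fscale subalgebra_tensor_space]; use pure_in_tensor_space in blast)+

lemma qsym_props:
  "qsym \<subseteq> tensor_space s" "module.subspace fscale qsym" "pure s [] \<in> qsym"
  "x \<in> qsym \<Longrightarrow> y \<in> qsym \<Longrightarrow> M x y \<in> qsym"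
  using subalgebra_qsym by (auto simp: subalgebra_def)

text \<open>An operator satisfying the axioms of a braided algebra preserves \<open>S \<otimes> S\<close> as soon as it preserves
  \<open>V \<otimes> V\<close>: first induct on the left factor against \<open>V\<close>, then on the right factor against \<open>S\<close>.
  This applies to the inverse of the braiding as well.\<close>

lemma braiding_preserves_qsym:
  assumes b: "flin b"
    and b_Ml: "\<And>X. X \<in> tpower fscale (tensor_space s) 3 \<Longrightarrow> b (Ml X) = Mr (sg fscale b 1 (sg fscale b 2 X))"
    and b_Mr: "\<And>X. X \<in> tpower fscale (tensor_space s) 3 \<Longrightarrow> b (Mr X) = Ml (sg fscale b 2 (sg fscale b 1 X))"
    and unit: "\<And>a. a \<in> tensor_space s \<Longrightarrow> b (pure fscale [pure s [], a]) = pure fscale [a, pure s []]"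
      "\<And>a. a \<in> tensor_space s \<Longrightarrow> b (pure fscale [a, pure s []]) = pure fscale [pure s [], a]"
    and gen: "\<And>v w. b (pure fscale [pure s [v], pure s [w]]) \<in> tens2 (range (\<lambda>v. pure s [v])) (range (\<lambda>v. pure s [v]))"
    and X: "X \<in> tpower fscale qsym 2"
  shows "b X \<in> tpower fscale qsym 2"
proof -
  let ?G = "range (\<lambda>v. pure s [v])"
  note fs = vector_space_fscale
  note fl = flin_tconc_left flin_tconc_right[OF fs]
  have sg1: "sg fscale b 1 (pure fscale [x, y, z]) = tconc fscale (b (pure fscale [x, y])) (pure fscale [z])" for x y z
    using sg_tconc_mid[OF fs b, of "pure fscale [x, y]" "[]" "[z]"]
    by (simp add: tconc_Nil[OF fs] tconc_pure[OF fs] pure_in_tpower tconc_assoc[OF fs] tconc_in_tensor_space[OF fs])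
  have sg2: "sg fscale b 2 (pure fscale [x, y, z]) = tconc fscale (pure fscale [x]) (b (pure fscale [y, z]))" for x y z
    using sg_tconc_mid[OF fs b, of "pure fscale [y, z]" "[x]" "[]"]
    by (simp add: tconc_Nil[OF fs] tconc_pure[OF fs] pure_in_tpower tconc_in_tensor_space[OF fs] numeral_2_eq_2)
  have t3: "pure fscale [x, y, z] \<in> tpower fscale (tensor_space s) 3"
    if "x \<in> qsym" "y \<in> qsym" "z \<in> qsym" for x y z
    using that qsym_props(1) by (intro pure_in_tpower) auto
  have G: "x \<in> qsym" if "x \<in> ?G" for x using that V1_subset_qsym by blast
  \<comment> \<open>The target is V \<otimes> S rather than S \<otimes> S: the generator that has
    passed one factor must again be a generator, so that the hypothesis for the next factor
    applies.\<close>
  have step1: "\<forall>g \<in> ?G. b (pure fscale [a, g]) \<in> tens2 ?G qsym" if "a \<in> qsym" for a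
  proof (rule generated_subalgebra_induct[OF _ _ that[unfolded qsym_def]], fold qsym_def)
    let ?C = "{a \<in> qsym. \<forall>g \<in> ?G. b (pure fscale [a, g]) \<in> tens2 ?G qsym}"
    show "?G \<subseteq> ?C"
      using gen tens2_mono[OF order_refl V1_subset_qsym, of ?G] G by blast
    have "M a a' \<in> ?C" if a: "a \<in> ?C" and a': "a' \<in> ?C" for a a'
    proof -
      have "b (pure fscale [M a a', g]) \<in> tens2 ?G qsym" if g: "g \<in> ?G" for g
      proof -
        \<comment> \<open>First \<open>a'\<close> passes \<open>g\<close>, which produces terms
          \<open>h\<close>, \<open>x\<close> with \<open>h\<close> in V; then \<open>a\<close>
          passes \<open>h\<close>. \<open>Mr\<close> multiplies the two elements of S that end up on
          the right.\<close>
        have "b (pure fscale [M a a', g]) = Mr (sg fscale b 1 (tconc fscale (pure fscale [a]) (b (pure fscale [a', g]))))"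
          using b_Ml[OF t3[of a a' g]] a a' G[OF g] by (simp add: Ml_pure sg2)
        also have "\<dots> \<in> tens2 ?G qsym"
        proof (rule tens2_mem[OF flin_comp[OF flin_Mr flin_comp[OF flin_sg fl(2)]] subspace_tens2])
          show "b (pure fscale [a', g]) \<in> tens2 ?G qsym" using a' g by blast
          fix h x assume h: "h \<in> ?G" and x: "x \<in> qsym"
          have "Mr (tconc fscale (b (pure fscale [a, h])) (pure fscale [x])) \<in> tens2 ?G qsym"
          proof (rule tens2_mem[OF flin_comp[OF flin_Mr fl(1)] subspace_tens2])
            show "b (pure fscale [a, h]) \<in> tens2 ?G qsym" using a h by blast
            fix h' y assume "h' \<in> ?G" "y \<in> qsym"
            then show "Mr (tconc fscale (pure fscale [h', y]) (pure fscale [x])) \<in> tens2 ?G qsym"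
              using x by (simp add: tconc_pure[OF fs] Mr_pure pure_in_tens2 qsym_props)
          qed
          then show "Mr (sg fscale b 1 (tconc fscale (pure fscale [a]) (pure fscale [h, x]))) \<in> tens2 ?G qsym"
            by (simp only: tconc_pure[OF fs] append.simps sg1)
        qed
        finally show ?thesis .
      qed
      then show ?thesis using a a' qsym_props(4) by simp
    qed
    moreover have "module.subspace fscale ?C"
    proof (rule module.subspaceI[OF module_fscale])
      show "0 \<in> ?C"
        by (simp add: flin_0[OF flin_comp[OF b flin_pure_slots(1)]] fsubspace_0[OF qsym_props(2)] fsubspace_0[OF subspace_tens2])
      show "x + y \<in> ?C" if "x \<in> ?C" "y \<in> ?C" for x y
        using that by (simp add: flinD[OF flin_comp[OF b flin_pure_slots(1)]]
            fsubspace_add[OF qsym_props(2)] fsubspace_add[OF subspace_tens2])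
      show "fscale c x \<in> ?C" if "x \<in> ?C" for c x
        using that by (simp add: flinD[OF flin_comp[OF b flin_pure_slots(1)]]
            fsubspace_scale[OF qsym_props(2)] fsubspace_scale[OF subspace_tens2])
    qed
    moreover have "pure s [] \<in> ?C"
      using unit(1) G qsym_props(1,3) pure_in_tens2[of _ ?G "pure s []" qsym] by (auto simp: subset_iff)
    ultimately show "subalgebra fscale (tensor_space s) M (pure s []) ?C"
      unfolding subalgebra_def using qsym_props(1) by blast
  qed
  \<comment> \<open>Now the right factor grows. The base case, a generator passed by any element of
    S, is the first induction with its target enlarged to S \<otimes> S.\<close>
  have step2: "\<forall>x \<in> qsym. b (pure fscale [x, a]) \<in> tens2 qsym qsym" if "a \<in> qsym" for a
  proof (rule generated_subalgebra_induct[OF _ _ that[unfolded qsym_def]], fold qsym_def)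
    let ?C = "{a \<in> qsym. \<forall>x \<in> qsym. b (pure fscale [x, a]) \<in> tens2 qsym qsym}"
    show "?G \<subseteq> ?C"
      using step1 tens2_mono[OF V1_subset_qsym order_refl, of qsym] G by blast
    have "M a a' \<in> ?C" if a: "a \<in> ?C" and a': "a' \<in> ?C" for a a'
    proof -
      have "b (pure fscale [x, M a a']) \<in> tens2 qsym qsym" if x: "x \<in> qsym" for x
      proof -
        have "b (pure fscale [x, M a a']) = Ml (sg fscale b 2 (tconc fscale (b (pure fscale [x, a])) (pure fscale [a'])))"
          using b_Mr[OF t3[of x a a']] a a' x by (simp add: Mr_pure sg1[simplified])
        also have "\<dots> \<in> tens2 qsym qsym"
        proof (rule tens2_mem[OF flin_comp[OF flin_Ml flin_comp[OF flin_sg fl(1)]] subspace_tens2])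
          show "b (pure fscale [x, a]) \<in> tens2 qsym qsym" using a x by blast
          fix p q assume p: "p \<in> qsym" and q: "q \<in> qsym"
          have "Ml (tconc fscale (pure fscale [p]) (b (pure fscale [q, a']))) \<in> tens2 qsym qsym"
          proof (rule tens2_mem[OF flin_comp[OF flin_Ml fl(2)] subspace_tens2])
            show "b (pure fscale [q, a']) \<in> tens2 qsym qsym" using a' q by blast
            fix r t assume "r \<in> qsym" "t \<in> qsym"
            then show "Ml (tconc fscale (pure fscale [p]) (pure fscale [r, t])) \<in> tens2 qsym qsym"
              using p by (simp add: tconc_pure[OF fs] Ml_pure pure_in_tens2 qsym_props)
          qed
          then show "Ml (sg fscale b 2 (tconc fscale (pure fscale [p, q]) (pure fscale [a']))) \<in> tens2 qsym qsym"
            by (simp only: tconc_pure[OF fs] append.simps sg2)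
        qed
        finally show ?thesis .
      qed
      then show ?thesis using a a' qsym_props(4) by simp
    qed
    moreover have "module.subspace fscale ?C"
    proof (rule module.subspaceI[OF module_fscale])
      show "0 \<in> ?C"
        by (simp add: flin_0[OF flin_comp[OF b flin_pure_slots(2)]] fsubspace_0[OF qsym_props(2)] fsubspace_0[OF subspace_tens2])
      show "x + y \<in> ?C" if "x \<in> ?C" "y \<in> ?C" for x y
        using that by (simp add: flinD[OF flin_comp[OF b flin_pure_slots(2)]]
            fsubspace_add[OF qsym_props(2)] fsubspace_add[OF subspace_tens2])
      show "fscale c x \<in> ?C" if "x \<in> ?C" for c x
        using that by (simp add: flinD[OF flin_comp[OF b flin_pure_slots(2)]]
            fsubspace_scale[OF qsym_props(2)] fsubspace_scale[OF subspace_tens2])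
    qed
    moreover have "pure s [] \<in> ?C"
      using unit(2) qsym_props(1,3) pure_in_tens2[of "pure s []" qsym _ qsym] by (auto simp: subset_iff)
    ultimately show "subalgebra fscale (tensor_space s) M (pure s []) ?C"
      unfolding subalgebra_def using qsym_props(1) by blast
  qed
  show ?thesis
    using X unfolding tpower_2_eq_tens2
    by (rule tens2_mem[OF b subspace_tens2, rotated]) (use step2 in blast)
qed

text \<open>Lifts preserve the degree, and cutting a tensor of degree 2 after one factor lands in V
  \<otimes> V. The same fact is used for the instance with the inverse operator.\<close>

lemma Bt_generators:
  "Bt (pure fscale [pure s [v], pure s [w]]) \<in> tens2 (range (\<lambda>v. pure s [v])) (range (\<lambda>v. pure s [v]))"
proof -
  have 1: "pure s [x] \<in> V 1" for x by (rule pure_in_tpower) auto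
  have "T (1 + 1) (chi 1 1) (tconc s (pure s [v]) (pure s [w])) \<in> V (1 + 1)"
    by (intro T_in tconc_in_tpower[OF vs] 1)
  then show ?thesis
    unfolding Bt_pure bet_eq[OF 1 1]
  proof (rule tpower_mem[OF flin_cut2 subspace_tens2, rotated])
    fix xs :: "'v list" assume "length xs = 1 + 1"
    then obtain x y where xs: "xs = [x, y]" by (auto simp: numeral_2_eq_2 length_Suc_conv)
    have "cut2 s 1 (pure s xs) = pure fscale [pure s [x], pure s [y]]"
      using cut2_tconc[OF vs 1 V_sub[OF 1], of x y] by (simp add: xs tconc_pure[OF vs])
    then show "cut2 s 1 (pure s xs) \<in> tens2 (range (\<lambda>v. pure s [v])) (range (\<lambda>v. pure s [v]))"
      by (simp add: pure_in_tens2)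
  qed
qed

lemma Bt_preserves_qsym: "X \<in> tpower fscale qsym 2 \<Longrightarrow> Bt X \<in> tpower fscale qsym 2"
  by (rule braiding_preserves_qsym[OF flin_Bt Bt_Ml Bt_Mr Bt_unit Bt_generators])

end

section \<open>The inverse braiding\<close>

locale invertible_braiding = braiding s B + inv: braiding s B'
  for s :: "'k::field \<Rightarrow> 'v::ab_group_add \<Rightarrow> 'v" and B B' +
  assumes B'B: "X \<in> tpower s UNIV 2 \<Longrightarrow> B' (B X) = X"
    and BB': "X \<in> tpower s UNIV 2 \<Longrightarrow> B (B' X) = X"
begin

lemma Bt'_Bt: "X \<in> tpower fscale (tensor_space s) 2 \<Longrightarrow> inv.Bt (Bt X) = X"
  by (rule Bt_inverse[where B = B and B' = B', OF braiding_axioms inv.braiding_axioms B'B])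

lemma Bt_Bt': "X \<in> tpower fscale (tensor_space s) 2 \<Longrightarrow> Bt (inv.Bt X) = X"
  by (rule Bt_inverse[where B = B' and B' = B, OF inv.braiding_axioms braiding_axioms BB'])

lemma Ml_in: "X \<in> tpower fscale (tensor_space s) 3 \<Longrightarrow> Ml X \<in> tpower fscale (tensor_space s) 2"
proof (erule tpower_mem[OF flin_Ml subspace_tpower, rotated])
  fix ts :: "('v, 'k) tens list" assume ts: "set ts \<subseteq> tensor_space s" "length ts = 3"
  then obtain a b c where "ts = [a, b, c]" "a \<in> tensor_space s" "b \<in> tensor_space s" "c \<in> tensor_space s"
    by (auto simp: numeral_3_eq_3 length_Suc_conv)
  then show "Ml (pure fscale ts) \<in> tpower fscale (tensor_space s) 2"
    using M_in_tensor_space by (auto simp: Ml_pure intro!: pure_in_tpower)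
qed

lemma Mr_in: "X \<in> tpower fscale (tensor_space s) 3 \<Longrightarrow> Mr X \<in> tpower fscale (tensor_space s) 2"
proof (erule tpower_mem[OF flin_Mr subspace_tpower, rotated])
  fix ts :: "('v, 'k) tens list" assume ts: "set ts \<subseteq> tensor_space s" "length ts = 3"
  then obtain a b c where "ts = [a, b, c]" "a \<in> tensor_space s" "b \<in> tensor_space s" "c \<in> tensor_space s"
    by (auto simp: numeral_3_eq_3 length_Suc_conv)
  then show "Mr (pure fscale ts) \<in> tpower fscale (tensor_space s) 2"
    using M_in_tensor_space by (auto simp: Mr_pure intro!: pure_in_tpower)
qed

lemma b'_in: "X \<in> tpower fscale (tensor_space s) 3 \<Longrightarrow> sg fscale inv.Bt i X \<in> tpower fscale (tensor_space s) 3"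
  by (rule sg_in_tpower[OF vector_space_fscale inv.flin_Bt inv.Bt_in])

lemma b_b': "1 \<le> i \<Longrightarrow> i < 3 \<Longrightarrow> X \<in> tpower fscale (tensor_space s) 3 \<Longrightarrow>
    sg fscale Bt i (sg fscale inv.Bt i X) = X"
  by (rule sg_inverse[where A = "tensor_space s" and B = inv.Bt and B' = Bt,
        OF vector_space_fscale inv.flin_Bt flin_Bt inv.Bt_in Bt_Bt'])

text \<open>\<open>Ml\<close> and \<open>Mr\<close> still come from the product of \<open>B\<close>.
  To obtain an axiom for the inverse, write \<open>X\<close> as the image of \<open>?Y\<close> or
  \<open>?Z\<close> under two braiding steps and invert the opposite axiom of \<open>Bt\<close>
  there; left and right multiplication change places.\<close>

lemma Bt'_preserves_qsym: "X \<in> tpower fscale qsym 2 \<Longrightarrow> inv.Bt X \<in> tpower fscale qsym 2"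
proof (rule braiding_preserves_qsym[OF inv.flin_Bt _ _ inv.Bt_unit inv.Bt_generators])
  fix X assume X: "X \<in> tpower fscale (tensor_space s) 3"
  let ?Y = "inv.b1 (inv.b2 X)" and ?Z = "inv.b2 (inv.b1 X)"
  have YZ: "?Y \<in> tpower fscale (tensor_space s) 3" "?Z \<in> tpower fscale (tensor_space s) 3"
    by (intro b'_in X)+
  have "b2 (b1 ?Y) = X" "b1 (b2 ?Z) = X" using b_b' b'_in[OF X] X by simp_all
  then have "Bt (Mr ?Y) = Ml X" "Bt (Ml ?Z) = Mr X"
    using Bt_Mr[OF YZ(1)] Bt_Ml[OF YZ(2)] by simp_all
  then show "inv.Bt (Ml X) = Mr ?Y" "inv.Bt (Mr X) = Ml ?Z"
    using Bt'_Bt[OF Mr_in[OF YZ(1)]] Bt'_Bt[OF Ml_in[OF YZ(2)]] by simp_all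
qed

end

section \<open>The braided algebras\<close>

text \<open>\<open>B\<close> and \<open>B'\<close> are linear extensions of \<open>\<sigma>\<close>
  and of its inverse on V \<otimes> V, and they are inverse to each other only there. On the third
  tensor power, cancelling letters turns the braid relation of \<open>B\<close> into that of
  \<open>B'\<close>.\<close>

lemma braided_vector_space_invertible_braiding:
  assumes V: "braided_vector_space s UNIV \<sigma>"
  obtains B B' where "invertible_braiding s B B'" "\<And>X. X \<in> tpower s UNIV 2 \<Longrightarrow> \<sigma> X = B X"
proof -
  let ?V2 = "tpower s UNIV 2" and ?V3 = "tpower s UNIV 3"
  have s: "vector_space s" and lin: "linear_on fscale fscale ?V2 \<sigma>" and bij: "bij_betw \<sigma> ?V2 ?V2"
    and ybe: "\<And>X. X \<in> ?V3 \<Longrightarrow> braid_at s UNIV \<sigma> 3 1 (braid_at s UNIV \<sigma> 3 2 (braid_at s UNIV \<sigma> 3 1 X)) =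
        braid_at s UNIV \<sigma> 3 2 (braid_at s UNIV \<sigma> 3 1 (braid_at s UNIV \<sigma> 3 2 X))"
    using V by (auto simp: braided_vector_space_def)
  obtain B where B: "flin B" "\<And>X. X \<in> ?V2 \<Longrightarrow> B X = \<sigma> X"
    using linear_on_extend[OF subspace_tpower lin] by blast
  define \<tau> where "\<tau> = inv_into ?V2 \<sigma>"
  have \<tau>: "\<tau> X \<in> ?V2" "\<sigma> (\<tau> X) = X" "\<tau> (\<sigma> X) = X" if "X \<in> ?V2" for X
    unfolding \<tau>_def using that bij
    by (auto simp: bij_betw_inv_into_left bij_betw_inv_into_right intro: bij_betwE[OF bij_betw_inv_into, rule_format])
  have \<sigma>_in: "\<sigma> X \<in> ?V2" if "X \<in> ?V2" for X using that bij by (auto simp: bij_betw_def)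
  note add = fsubspace_add[OF subspace_tpower] and sc = fsubspace_scale[OF subspace_tpower]
  have "linear_on fscale fscale ?V2 \<tau>"
    unfolding linear_on_def
  proof (intro conjI ballI allI)
    fix X Y c assume X: "X \<in> ?V2" and Y: "Y \<in> ?V2"
    have "\<sigma> (\<tau> X + \<tau> Y) = X + Y" using lin \<tau>[OF X] \<tau>[OF Y] by (simp add: linear_on_def)
    then show "\<tau> (X + Y) = \<tau> X + \<tau> Y" using \<tau>(3)[OF add[OF \<tau>(1)[OF X] \<tau>(1)[OF Y]]] by simp
  next
    fix X c assume X: "X \<in> ?V2"
    have "\<sigma> (fscale c (\<tau> X)) = fscale c X" using lin \<tau>[OF X] by (simp add: linear_on_def)
    then show "\<tau> (fscale c X) = fscale c (\<tau> X)" using \<tau>(3)[OF sc[OF \<tau>(1)[OF X]]] by metis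
  qed
  then obtain B' where B': "flin B'" "\<And>X. X \<in> ?V2 \<Longrightarrow> B' X = \<tau> X"
    using linear_on_extend[OF subspace_tpower] by blast
  have B_in: "B X \<in> ?V2" and B'_in: "B' X \<in> ?V2" and B'B: "B' (B X) = X" and BB': "B (B' X) = X" if "X \<in> ?V2" for X
    using B(2) B'(2) \<tau> \<sigma>_in that by simp_all
  have in3: "sg s B i X \<in> ?V3" "sg s B' i X \<in> ?V3" if "X \<in> ?V3" for i X
    using sg_in_tpower[OF s B(1) B_in that] sg_in_tpower[OF s B'(1) B'_in that] by simp_all
  have at: "braid_at s UNIV \<sigma> 3 i X = sg s B i X" if "1 \<le> i" "i < 3" "X \<in> ?V3" for i X
    by (rule braid_at_eq_sg[OF s B(1) B(2)[symmetric] subsetD[OF tpower_subset_tensor_space B_in] that])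
  have br: "sg s B 1 (sg s B 2 (sg s B 1 X)) = sg s B 2 (sg s B 1 (sg s B 2 X))" if "X \<in> ?V3" for X
    using ybe[OF that] that at[of 1] at[of 2] in3(1) by simp
  have i1: "sg s B' i (sg s B i X) = X" if "1 \<le> i" "i < 3" "X \<in> ?V3" for i X
    by (rule sg_inverse[where A = UNIV and B = B and B' = B', OF s B(1) B'(1) B_in B'B that])
  have i2: "sg s B i (sg s B' i X) = X" if "1 \<le> i" "i < 3" "X \<in> ?V3" for i X
    by (rule sg_inverse[where A = UNIV and B = B' and B' = B, OF s B'(1) B(1) B'_in BB' that])
  have br': "sg s B' 1 (sg s B' 2 (sg s B' 1 X)) = sg s B' 2 (sg s B' 1 (sg s B' 2 X))" if X: "X \<in> ?V3" for X
  proof -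
    \<comment> \<open>By cancellation one side of the braid relation of \<open>B\<close> sends
      \<open>Y\<close> to \<open>X\<close>, so the other side does too; undoing that side letter by
      letter expresses \<open>Y\<close> by the second word in \<open>B'\<close>.\<close>
    define Y where "Y = sg s B' 1 (sg s B' 2 (sg s B' 1 X))"
    have Y: "Y \<in> ?V3" unfolding Y_def by (intro in3 X)
    have "sg s B 1 (sg s B 2 (sg s B 1 Y)) = X" unfolding Y_def by (simp add: i2 in3(2) X)
    then have "X = sg s B 2 (sg s B 1 (sg s B 2 Y))" using br[OF Y] by simp
    moreover have "sg s B' 2 (sg s B' 1 (sg s B' 2 (sg s B 2 (sg s B 1 (sg s B 2 Y))))) = Y"
      by (simp add: i1 in3(1) Y)
    ultimately show ?thesis unfolding Y_def[symmetric] by simp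
  qed
  have 1: "braiding s B" by (rule braiding.intro[OF s B(1) B_in br])
  have 2: "braiding s B'" by (rule braiding.intro[OF s B'(1) B'_in br'])
  have "invertible_braiding s B B'"
    by (intro invertible_braiding.intro 1 2 invertible_braiding_axioms.intro B'B BB')
  then show thesis by (rule that) (rule B(2)[symmetric])
qed

section \<open>Transfer to the operators of the statement\<close>

locale braided_tensors = invertible_braiding s B B'
  for s :: "'k::field \<Rightarrow> 'v::ab_group_add \<Rightarrow> 'v" and B B' +
  fixes \<sigma> :: "('v, 'k) tens \<Rightarrow> ('v, 'k) tens"
  assumes \<sigma>_eq: "X \<in> tpower s UNIV 2 \<Longrightarrow> \<sigma> X = B X"
begin

lemma braid_at_eq: "1 \<le> i \<Longrightarrow> i < n \<Longrightarrow> X \<in> V n \<Longrightarrow> braid_at s UNIV \<sigma> n i X = sg s B i X"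
  by (rule braid_at_eq_sg[OF vs flin_B \<sigma>_eq]) (use B_in V_sub in auto)

lemma T_perm_eq:
  assumes w: "w permutes {1..n}" and X: "X \<in> V n"
  shows "T_perm s \<sigma> n w X = T n w X"
proof -
  define js where "js = (SOME js. reduced_expression n w js)"
  obtain "is" where "set is \<subseteq> {1..<n}" "word_perm is = w" "length is = ninv w"
    using exists_expression_ninv[OF w] by blast
  then have "reduced_expression n w is" unfolding reduced_expression_iff[OF w] by simp
  then have "reduced_expression n w js" unfolding js_def by (rule someI)
  then have "set js \<subseteq> {1..<n}" unfolding reduced_expression_iff[OF w] by simp
  then have "foldr (\<lambda>i h. braid_at s UNIV \<sigma> n i \<circ> h) js id X = word js X"
    by (induction js) (simp_all add: braid_at_eq word_in[OF X])
  then show ?thesis by (simp add: T_perm_def T_def js_def)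
qed

lemma pure_append_in: "pure s (xs @ ys) \<in> V (length xs + length ys)"
  by (rule pure_in_tpower) auto

lemma qshuffle_eq:
  assumes "a \<in> tensor_space s" "b \<in> tensor_space s"
  shows "qshuffle s \<sigma> a b = M a b"
proof -
  have "(\<lambda>xs ys. \<Sum>w\<in>shuffles_perm (length xs) (length ys). T_perm s \<sigma> (length xs + length ys) w (pure s (xs @ ys)))
    = (\<lambda>xs ys. \<Sum>w\<in>shuffles_perm (length xs) (length ys). T (length xs + length ys) w (pure s (xs @ ys)))"
    by (intro ext sum.cong refl T_perm_eq shuffles_permD pure_append_in)
  then show ?thesis
    unfolding qshuffle_def M_def using bilin_ext_eq_tbil[OF assms] by simp
qed

lemma deconc_eq:
  assumes Z: "Z \<in> V (j + i)"
  shows "deconc s j i Z = cut2 s j Z"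
  unfolding deconc_def
proof (rule lin_ext_eq[OF flin_cut2 _ Z])
  fix zs :: "'v list" assume len: "length zs = j + i"
  have "pure s (take j zs) \<in> V j" using len by (intro pure_in_tpower) auto
  from cut2_tconc[OF vs this pure_in_tensor_space]
  show "cut2 s j (pure s zs) = pure fscale [pure s (take j zs), pure s (drop j zs)]"
    by (metis append_take_drop_id tconc_pure[OF vs])
qed

lemma beta_pure_eq: "beta_pure s \<sigma> xs ys = bet (pure s xs) (pure s ys)"
proof (cases "xs = [] \<or> ys = []")
  \<comment> \<open>The flips prescribed in degree 0 agree with the general formula by
    \<open>Bt_unit\<close>.\<close>
  case True
  then show ?thesis
    using Bt_unit[OF pure_in_tensor_space] by (auto simp: beta_pure_def Bt_pure)
next
  case False
  have x: "pure s xs \<in> V (length xs)" "pure s ys \<in> V (length ys)" by (auto intro: pure_in_tpower)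
  have "T (length xs + length ys) (chi (length xs) (length ys)) (pure s (xs @ ys)) \<in> V (length ys + length xs)"
    using T_in[OF pure_append_in] by (simp only: add.commute)
  from deconc_eq[OF this] show ?thesis
    using False by (simp add: beta_pure_def bet_eq[OF x] tconc_pure[OF vs] T_perm_eq[OF chi_permutes pure_append_in])
qed

lemma beta_eq:
  assumes X: "X \<in> tpower fscale (tensor_space s) 2"
  shows "beta s \<sigma> X = Bt X"
  unfolding beta_def
proof (rule lin_ext_eq[OF flin_Bt _ X])
  fix ts :: "('v, 'k) tens list" assume ts: "set ts \<subseteq> tensor_space s" "length ts = 2"
  then obtain a b where ab: "ts = [a, b]" "a \<in> tensor_space s" "b \<in> tensor_space s"
    by (auto simp: numeral_2_eq_2 length_Suc_conv)
  have "beta_pure s \<sigma> = (\<lambda>xs ys. cut2 s (length ys) (T (length xs + length ys) (chi (length xs) (length ys)) (pure s (xs @ ys))))"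
    by (intro ext) (simp only: beta_pure_eq bet_def tbil_pure[OF bet_bimultilinear])
  then show "Bt (pure fscale ts) = bilin_ext (beta_pure s \<sigma>) (ts ! 0) (ts ! 1)"
    by (simp add: ab(1) Bt_pure bet_def bilin_ext_eq_tbil[OF ab(2,3)])
qed

text \<open>The conditions on a subalgebra evaluate the product on tensors only, where
  \<open>qshuffle\<close> and \<open>M\<close> agree.\<close>

lemma qsymmetric_eq: "qsymmetric s \<sigma> = qsym"
proof -
  have "subalgebra fscale (tensor_space s) (qshuffle s \<sigma>) (pure s []) C \<longleftrightarrow>
      subalgebra fscale (tensor_space s) M (pure s []) C" for C
    by (rule subalgebra_cong[OF qshuffle_eq])
  then show ?thesis by (simp add: qsymmetric_def qsym_def generated_subalgebra_def)
qed

text \<open>One argument serves T(V) and the generated subalgebra: the identities hold on T(V) and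
  restrict to \<open>A\<close>, while stability under both \<beta> and its inverse makes the
  restriction bijective.\<close>

lemma braided_algebra_on:
  assumes A: "subalgebra fscale (tensor_space s) M (pure s []) A"
    and Bt_A: "\<And>X. X \<in> tpower fscale A 2 \<Longrightarrow> Bt X \<in> tpower fscale A 2"
    and Bt'_A: "\<And>X. X \<in> tpower fscale A 2 \<Longrightarrow> inv.Bt X \<in> tpower fscale A 2"
  shows "braided_algebra fscale A (qshuffle s \<sigma>) (pure s []) (beta s \<sigma>)"
proof -
  note fs = vector_space_fscale
  have sub: "A \<subseteq> tensor_space s" and subsp: "module.subspace fscale A" and e: "pure s [] \<in> A"
    and M_A: "\<And>x y. x \<in> A \<Longrightarrow> y \<in> A \<Longrightarrow> M x y \<in> A"
    using A by (auto simp: subalgebra_def)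
  have TS: "x \<in> tensor_space s" if "x \<in> A" for x using that sub by blast
  have T2: "X \<in> tpower fscale (tensor_space s) 2" if "X \<in> tpower fscale A 2" for X using that tpower_mono[OF sub] by blast
  have T3: "X \<in> tpower fscale (tensor_space s) 3" if "X \<in> tpower fscale A 3" for X using that tpower_mono[OF sub] by blast
  have q: "qshuffle s \<sigma> x y = M x y" if "x \<in> A" "y \<in> A" for x y by (rule qshuffle_eq[OF TS[OF that(1)] TS[OF that(2)]])
  have be: "beta s \<sigma> X = Bt X" if "X \<in> tpower fscale A 2" for X by (rule beta_eq[OF T2[OF that]])
  \<comment> \<open>\<open>braid_at\<close>, \<open>mult_id\<close> and \<open>id_mult\<close> are
    chosen relative to \<open>A\<close>, so they are identified with the global operators for each
    \<open>A\<close> separately instead of being restricted from T(V).\<close>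
  have at: "braid_at fscale A (beta s \<sigma>) 3 i X = sg fscale Bt i X"
    if "1 \<le> i" "i < 3" "X \<in> tpower fscale A 3" for i X
    by (rule braid_at_eq_sg[OF fs flin_Bt be subsetD[OF tpower_subset_tensor_space Bt_A] that])
  have sgA: "sg fscale Bt i X \<in> tpower fscale A 3" if "X \<in> tpower fscale A 3" for i X
    by (rule sg_in_tpower[OF fs flin_Bt Bt_A that])
  have at1: "braid_at fscale A (beta s \<sigma>) 3 1 X = b1 X" and at2: "braid_at fscale A (beta s \<sigma>) 3 2 X = b2 X"
    if "X \<in> tpower fscale A 3" for X using at[of 1 X] at[of 2 X] that by simp_all
  have three: "\<exists>a b c. ts = [a, b, c] \<and> a \<in> A \<and> b \<in> A \<and> c \<in> A" if "set ts \<subseteq> A" "length ts = 3" for ts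
    using that by (auto simp: numeral_3_eq_3 length_Suc_conv)
  have ml: "mult_id fscale A (qshuffle s \<sigma>) X = Ml X" if X: "X \<in> tpower fscale A 3" for X
    unfolding mult_id_def
  proof (rule lin_ext_eq[OF flin_Ml _ X])
    fix ts assume "set ts \<subseteq> A" "length ts = 3"
    then obtain a b c where "ts = [a, b, c]" "a \<in> A" "b \<in> A" "c \<in> A" using three by blast
    then show "Ml (pure fscale ts) = pure fscale [qshuffle s \<sigma> (ts ! 0) (ts ! 1), ts ! 2]"
      by (simp add: Ml_pure q numeral_2_eq_2)
  qed
  have mr: "id_mult fscale A (qshuffle s \<sigma>) X = Mr X" if X: "X \<in> tpower fscale A 3" for X
    unfolding id_mult_def
  proof (rule lin_ext_eq[OF flin_Mr _ X])
    fix ts assume "set ts \<subseteq> A" "length ts = 3"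
    then obtain a b c where "ts = [a, b, c]" "a \<in> A" "b \<in> A" "c \<in> A" using three by blast
    then show "Mr (pure fscale ts) = pure fscale [ts ! 0, qshuffle s \<sigma> (ts ! 1) (ts ! 2)]"
      by (simp add: Mr_pure q numeral_2_eq_2)
  qed
  have ml_in: "Ml X \<in> tpower fscale A 2" if X: "X \<in> tpower fscale A 3" for X
  proof (rule tpower_mem[OF flin_Ml subspace_tpower _ X])
    fix ts assume "set ts \<subseteq> A" "length ts = 3"
    then obtain a b c where "ts = [a, b, c]" "a \<in> A" "b \<in> A" "c \<in> A" using three by blast
    then show "Ml (pure fscale ts) \<in> tpower fscale A 2" using M_A by (auto simp: Ml_pure intro!: pure_in_tpower)
  qed
  have mr_in: "Mr X \<in> tpower fscale A 2" if X: "X \<in> tpower fscale A 3" for X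
  proof (rule tpower_mem[OF flin_Mr subspace_tpower _ X])
    fix ts assume "set ts \<subseteq> A" "length ts = 3"
    then obtain a b c where "ts = [a, b, c]" "a \<in> A" "b \<in> A" "c \<in> A" using three by blast
    then show "Mr (pure fscale ts) \<in> tpower fscale A 2" using M_A by (auto simp: Mr_pure intro!: pure_in_tpower)
  qed
  have alg: "unital_algebra fscale A (qshuffle s \<sigma>) (pure s [])"
    unfolding unital_algebra_def subalgebra_def linear_on_def
    using fs e subsp M_A
    by (simp add: q flinD[OF flin_M(1)] flinD[OF flin_M(2)] M_assoc M_unit TS
        fsubspace_add[OF subsp] fsubspace_scale[OF subsp])
  have "bij_betw Bt (tpower fscale A 2) (tpower fscale A 2)"
    by (rule bij_betw_byWitness[where f' = inv.Bt])
      (use Bt_A Bt'_A Bt'_Bt[OF T2] Bt_Bt'[OF T2] in auto)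
  then have bij: "bij_betw (beta s \<sigma>) (tpower fscale A 2) (tpower fscale A 2)"
    by (rule bij_betw_cong[THEN iffD1, rotated]) (simp add: be)
  have lin: "linear_on fscale fscale (tpower fscale A 2) (beta s \<sigma>)"
    unfolding linear_on_def
    by (simp add: be fsubspace_add[OF subspace_tpower] fsubspace_scale[OF subspace_tpower] flinD[OF flin_Bt])
  have br: "braided_vector_space fscale A (beta s \<sigma>)"
    unfolding braided_vector_space_def
  proof (intro conjI ballI fs subsp lin bij)
    fix X assume X: "X \<in> tpower fscale A 3"
    show "braid_at fscale A (beta s \<sigma>) 3 1 (braid_at fscale A (beta s \<sigma>) 3 2 (braid_at fscale A (beta s \<sigma>) 3 1 X)) =
        braid_at fscale A (beta s \<sigma>) 3 2 (braid_at fscale A (beta s \<sigma>) 3 1 (braid_at fscale A (beta s \<sigma>) 3 2 X))"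
      by (simp only: at1 at2 X sgA braid_Bt[OF T3[OF X]])
  qed
  show ?thesis
    unfolding braided_algebra_def
  proof (intro conjI ballI alg br)
    fix X assume X: "X \<in> tpower fscale A 3"
    show "beta s \<sigma> (mult_id fscale A (qshuffle s \<sigma>) X) = id_mult fscale A (qshuffle s \<sigma>)
        (braid_at fscale A (beta s \<sigma>) 3 1 (braid_at fscale A (beta s \<sigma>) 3 2 X))"
      by (simp only: at1 at2 X sgA ml mr be ml_in Bt_Ml[OF T3[OF X]])
    show "beta s \<sigma> (id_mult fscale A (qshuffle s \<sigma>) X) = mult_id fscale A (qshuffle s \<sigma>)
        (braid_at fscale A (beta s \<sigma>) 3 2 (braid_at fscale A (beta s \<sigma>) 3 1 X))"
      by (simp only: at1 at2 X sgA ml mr be mr_in Bt_Mr[OF T3[OF X]])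
  next
    fix a assume a: "a \<in> A"
    have "pure fscale [pure s [], a] \<in> tpower fscale A 2" "pure fscale [a, pure s []] \<in> tpower fscale A 2"
      using a e by (auto intro!: pure_in_tpower)
    then show "beta s \<sigma> (pure fscale [pure s [], a]) = pure fscale [a, pure s []]"
      "beta s \<sigma> (pure fscale [a, pure s []]) = pure fscale [pure s [], a]"
      by (simp_all only: be Bt_unit[OF TS[OF a]])
  qed
qed

lemma braided_algebra_tensor_space:
  "braided_algebra fscale (tensor_space s) (qshuffle s \<sigma>) (pure s []) (beta s \<sigma>)"
  by (rule braided_algebra_on[OF subalgebra_tensor_space Bt_in inv.Bt_in])

lemma braided_algebra_qsymmetric:
  "braided_algebra fscale (qsymmetric s \<sigma>) (qshuffle s \<sigma>) (pure s []) (beta s \<sigma>)"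
  unfolding qsymmetric_eq by (rule braided_algebra_on[OF subalgebra_qsym Bt_preserves_qsym Bt'_preserves_qsym])

end

theorem theorem3p1:
  fixes scale :: "'k::field_char_0 \<Rightarrow> 'v::ab_group_add \<Rightarrow> 'v"
    and \<sigma> :: "('v, 'k) tens \<Rightarrow> ('v, 'k) tens"
  assumes "braided_vector_space scale UNIV \<sigma>"
  shows "braided_algebra fscale (tensor_space scale) (qshuffle scale \<sigma>) (pure scale []) (beta scale \<sigma>)
    \<and> braided_algebra fscale (qsymmetric scale \<sigma>) (qshuffle scale \<sigma>) (pure scale []) (beta scale \<sigma>)"
proof -
  obtain B B' where B: "invertible_braiding scale B B'" "\<And>X. X \<in> tpower scale UNIV 2 \<Longrightarrow> \<sigma> X = B X"
    using braided_vector_space_invertible_braiding[OF assms] by blast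
  interpret braided_tensors scale B B' \<sigma>
    by (intro braided_tensors.intro braided_tensors_axioms.intro B)
  show ?thesis using braided_algebra_tensor_space braided_algebra_qsymmetric by blast
qed

end
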